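(* Fix $\vartheta>0$ and let $X^{(\vartheta)}$ be the almost sure limit of $\frac{I_n^{(\vartheta)}-n\log n}{n}$, where $I_n^{(\vartheta)}$ is the internal path length of a Hoppe tree with parameter $\vartheta$ and $n$ nodes. Then the distribution of $X^{(\vartheta)}$ has a Lebesgue density $f_\vartheta$ which belongs to the Schwartz space on $\mathbb{R}$, i.e., $f_\vartheta$ is infinitely differentiable and $f_\vartheta$ together with all its derivatives is rapidly decreasing.
   Context: Hoppe tree with parameter $\vartheta>0$: the tree is grown by successive insertion of nodes, all on one probability space. Initially there is only the root. In each step a parent node is chosen among the existing nodes, independently of the past, with probability proportional to its weight, where the root has weight $\vartheta$ and every other node has weight $1$; a new node is attached as a child of the chosen node. The internal path length is the sum over all nodes of their distances to the root. The limit $X^{(\vartheta)}$ exists almost surely and is non-degenerate; its law is the unique integrable solution of $X^{(\vartheta)} \stackrel{d}{=} (1-B)X^{(\vartheta)}+ B \widetilde{X}^{(1)} + B\log B+(1-B)\log(1-B)+B$ with $X^{(\vartheta)},\widetilde{X}^{(1)},B$ independent, $B\sim$ beta$(1,\vartheta)$, $\widetilde{X}^{(1)}\stackrel{d}{=}X^{(1)}$. *)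

theory Defs
  imports "HOL-Probability.Probability"
begin

text \<open>Hoppe tree encoded by a parent function: nodes are 0,1,2,...; node 0 is the root,
  and node k >= 1 is attached as a child of node p k (which must satisfy p k < k).
  The depth (distance to the root) of node k:\<close>

function hoppe_depth :: "(nat \<Rightarrow> nat) \<Rightarrow> nat \<Rightarrow> nat" where
  "hoppe_depth p 0 = 0"
| "hoppe_depth p (Suc k) = (if p (Suc k) \<le> k then Suc (hoppe_depth p (p (Suc k))) else 1)"
  by pat_completeness auto
termination by (relation "Wellfounded.measure snd") auto

definition internal_path_length :: "(nat \<Rightarrow> nat) \<Rightarrow> nat \<Rightarrow> nat" where
  "internal_path_length p n = (\<Sum>k<n. hoppe_depth p k)"

definition schwartz_function :: "(real \<Rightarrow> real) \<Rightarrow> bool" where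
  "schwartz_function f \<longleftrightarrow>
     (\<forall>k x. ((deriv ^^ k) f) differentiable (at x)) \<and>
     (\<forall>k m::nat. bounded (range (\<lambda>x. \<bar>x\<bar> ^ m * \<bar>(deriv ^^ k) f x\<bar>)))"

end

theory Submission
  imports Defs
begin

text \<open>
  Let \<open>W\<^sub>n = \<theta> + n - 1\<close> be the total weight and \<open>I\<^sub>n\<close> the internal path length of the tree on the nodes
  \<open>0, \<dots>, n - 1\<close>. The density is obtained by Fourier inversion, from exponential decay of the
  characteristic function of \<open>X\<close> (smoothness) and from the existence of all moments of \<open>X\<close>
  (rapid decay of the density; Landau's interpolation inequality then gives the derivatives).

  For the decay at frequency \<open>t\<close>, fix \<open>a\<close> of order \<open>t\<close>. Call a node \<open>k\<close> in a window \<open>{b..<B}\<close>,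
  with \<open>b\<close> and \<open>B - b\<close> of order \<open>a\<close>, a source if its parent lies in \<open>{1..<b}\<close>. Given
  everything except the parents of the sources, these are independent and uniform on \<open>{1..<b}\<close>, and
  \<open>I\<^sub>n\<close> is a constant plus the sum of \<open>S\<^sub>k * depth (parent k)\<close> over the sources, \<open>S\<^sub>k\<close> being the size of
  the subtree of \<open>k\<close>. So the conditional characteristic function of \<open>I\<^sub>n / n\<close> is a product with one
  factor for each source. A factor is bounded away from 1 if \<open>t * S\<^sub>k / n\<close> is bounded and bounded away
  from 0, since a positive fraction of the nodes below \<open>b\<close> can be paired up with depths differing by
  one. Up to an event of exponentially small probability this is the case for at least \<open>a\<close>
  sources.

  For the moments, \<open>I\<^sub>n / W\<^sub>n - (1 / W\<^sub>2 + \<dots> + 1 / W\<^sub>n)\<close> is a martingale whose increments are small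
  enough for its even moments to stay bounded.
\<close>

section \<open>Expectations over the parent choices\<close>

text \<open>The size of the window is dictated by the subtrees: a node born near time
  \<open>a\<close> has a subtree of order \<open>n / a\<close>, so for \<open>a\<close> of order
  \<open>t\<close> the phases \<open>t * S / n\<close> are of order one. Moving a source to another
  node below \<open>b\<close> changes neither the tree below \<open>b\<close> nor the subtree of any
  other source; hence the conditional independence. The root is no admissible parent because its
  weight \<open>\<theta>\<close> would spoil uniformity. Two things can go wrong with a phase. It
  may be too large: the subtrees of sources are disjoint, so fewer than \<open>a\<close> of them
  exceed \<open>n / a\<close>, for every tree. It may be too small: sizes evolve as in a Polya urn,
  and joint negative moments of order 1/2 show that many small ones are exponentially unlikely. All
  bounds hold for every \<open>n \<ge> 84 * a\<close> and so survive the limit at fixed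
  \<open>t\<close>. Up to the limit the calculation uses finite weighted sums over parent functions,
  where conditioning on the first nodes is just an unfolding of the recursion. Moments give
  pointwise decay only for a function with a sign, such as the density; this is why its derivatives
  call for interpolation.\<close>

definition hoppe_weight :: "real \<Rightarrow> nat \<Rightarrow> nat \<Rightarrow> real" where
  "hoppe_weight \<theta> n j = (if j = 0 then \<theta> else 1) / (\<theta> + real n - 1)"

text \<open>The expectation of \<open>F\<close> when the parents of \<open>1, \<dots>, n - 1\<close> are chosen at random and every other
  argument of the parent function is mapped to 0.\<close>

primrec hoppe_exp :: "real \<Rightarrow> nat \<Rightarrow> ((nat \<Rightarrow> nat) \<Rightarrow> 'b) \<Rightarrow> 'b::real_vector" where
  "hoppe_exp \<theta> 0 F = F (\<lambda>_. 0)"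
| "hoppe_exp \<theta> (Suc n) F = hoppe_exp \<theta> n
     (\<lambda>p. if n = 0 then F p else \<Sum>j<n. hoppe_weight \<theta> n j *\<^sub>R F (p(n := j)))"

definition recursive_tree :: "nat \<Rightarrow> (nat \<Rightarrow> nat) \<Rightarrow> bool" where
  "recursive_tree n p \<longleftrightarrow> (\<forall>k. 1 \<le> k \<and> k < n \<longrightarrow> p k < k)"

lemma recursive_tree_upd: "recursive_tree n p \<Longrightarrow> j < n \<Longrightarrow> recursive_tree (Suc n) (p(n := j))"
  by (auto simp: recursive_tree_def less_Suc_eq)

lemma hoppe_weight_nonneg: "0 < \<theta> \<Longrightarrow> 1 \<le> n \<Longrightarrow> 0 \<le> hoppe_weight \<theta> n j"
  by (auto simp: hoppe_weight_def)

lemma sum_lessThan_split_0: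
  fixes g :: "nat \<Rightarrow> 'b::comm_monoid_add"
  assumes "1 \<le> n" shows "(\<Sum>j<n. g j) = g 0 + (\<Sum>j\<in>{1..<n}. g j)"
proof -
  have "{..<n} = insert 0 {1..<n}" using assms by auto
  then show ?thesis by simp
qed

lemma sum_hoppe_weight:
  assumes "0 < \<theta>" "1 \<le> n" shows "(\<Sum>j<n. hoppe_weight \<theta> n j) = 1"
proof -
  have "(\<Sum>j<n. hoppe_weight \<theta> n j) = \<theta> / (\<theta> + real n - 1) + (\<Sum>j\<in>{1..<n}. 1 / (\<theta> + real n - 1))"
    using assms by (subst sum_lessThan_split_0) (auto simp: hoppe_weight_def)
  also have "\<dots> = 1" using assms by (simp add: add_divide_distrib[symmetric] of_nat_diff)
  finally show ?thesis .
qed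

lemma hoppe_exp_Suc:
  "1 \<le> n \<Longrightarrow> hoppe_exp \<theta> (Suc n) F = hoppe_exp \<theta> n (\<lambda>p. \<Sum>j<n. hoppe_weight \<theta> n j *\<^sub>R F (p(n := j)))"
  by simp

declare hoppe_exp.simps(2)[simp del]

lemma hoppe_exp_cong:
  assumes "\<And>p. recursive_tree n p \<Longrightarrow> F p = G p"
  shows "hoppe_exp \<theta> n F = hoppe_exp \<theta> n G"
  using assms
proof (induction n arbitrary: F G)
  case 0 then show ?case by (simp add: recursive_tree_def)
next
  case (Suc n)
  have "hoppe_exp \<theta> n (\<lambda>p. if n = 0 then F p else \<Sum>j<n. hoppe_weight \<theta> n j *\<^sub>R F (p(n := j))) =
     hoppe_exp \<theta> n (\<lambda>p. if n = 0 then G p else \<Sum>j<n. hoppe_weight \<theta> n j *\<^sub>R G (p(n := j)))"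
  proof (rule Suc.IH)
    fix p assume p: "recursive_tree n p"
    show "(if n = 0 then F p else \<Sum>j<n. hoppe_weight \<theta> n j *\<^sub>R F (p(n := j))) =
          (if n = 0 then G p else \<Sum>j<n. hoppe_weight \<theta> n j *\<^sub>R G (p(n := j)))"
    proof (cases "n = 0")
      case True then show ?thesis using Suc.prems[of p] by (simp add: recursive_tree_def)
    next
      case False then show ?thesis
        by (auto intro!: sum.cong arg_cong2[where f=scaleR] Suc.prems recursive_tree_upd p)
    qed
  qed
  then show ?case by (simp add: hoppe_exp.simps(2))
qed

lemma hoppe_exp_add:
  "hoppe_exp \<theta> n (\<lambda>p. F p + G p) = hoppe_exp \<theta> n F + hoppe_exp \<theta> n G"
proof (induction n arbitrary: F G)
  case (Suc n)
  show ?case unfolding hoppe_exp.simps(2) Suc.IH[symmetric]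
    by (rule arg_cong[where f="hoppe_exp \<theta> n"]) (auto simp: fun_eq_iff scaleR_add_right sum.distrib)
qed simp

lemma hoppe_exp_linear:
  fixes h :: "'b::real_vector \<Rightarrow> 'c::real_vector"
  assumes "linear h"
  shows "hoppe_exp \<theta> n (\<lambda>p. h (F p)) = h (hoppe_exp \<theta> n F)"
proof (induction n arbitrary: F)
  case (Suc n)
  show ?case unfolding hoppe_exp.simps(2) Suc.IH[symmetric]
    using assms by (intro arg_cong[where f="hoppe_exp \<theta> n"]) (auto simp: fun_eq_iff linear_sum linear_scale)
qed simp

lemma hoppe_exp_cmult: "hoppe_exp \<theta> n (\<lambda>p. (c::real) * F p) = c * hoppe_exp \<theta> n F"
  by (rule hoppe_exp_linear) (auto intro: linearI simp: algebra_simps)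

lemma hoppe_exp_const: "0 < \<theta> \<Longrightarrow> hoppe_exp \<theta> n (\<lambda>p. c) = c"
proof (induction n)
  case (Suc n)
  have "(\<lambda>p::nat\<Rightarrow>nat. if n = 0 then c else \<Sum>j<n. hoppe_weight \<theta> n j *\<^sub>R c) = (\<lambda>p. c)"
    using sum_hoppe_weight[of \<theta> n] Suc.prems by (auto simp: fun_eq_iff scaleR_left.sum[symmetric])
  then show ?case unfolding hoppe_exp.simps(2) using Suc by simp
qed simp

lemma hoppe_exp_sum: "hoppe_exp \<theta> n (\<lambda>p. \<Sum>i\<in>A. F i p) = (\<Sum>i\<in>A. hoppe_exp \<theta> n (F i))"
proof (induction A rule: infinite_finite_induct)
  case (infinite A)
  then show ?case using hoppe_exp_linear[of "\<lambda>x. 0" \<theta> n "\<lambda>_. 0"] by (simp add: linearI)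
next
  case empty
  then show ?case using hoppe_exp_linear[of "\<lambda>x. 0" \<theta> n "\<lambda>_. 0"] by (simp add: linearI)
qed (simp add: hoppe_exp_add)

lemma hoppe_exp_mono:
  fixes F G :: "(nat \<Rightarrow> nat) \<Rightarrow> real"
  assumes "0 < \<theta>" "\<And>p. recursive_tree n p \<Longrightarrow> F p \<le> G p"
  shows "hoppe_exp \<theta> n F \<le> hoppe_exp \<theta> n G"
  using assms(2)
proof (induction n arbitrary: F G)
  case 0 then show ?case by (simp add: recursive_tree_def)
next
  case (Suc n)
  show ?case unfolding hoppe_exp.simps(2)
  proof (rule Suc.IH)
    fix p assume p: "recursive_tree n p"
    show "(if n = 0 then F p else \<Sum>j<n. hoppe_weight \<theta> n j *\<^sub>R F (p(n := j))) \<le>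
          (if n = 0 then G p else \<Sum>j<n. hoppe_weight \<theta> n j *\<^sub>R G (p(n := j)))"
    proof (cases "n = 0")
      case True then show ?thesis using Suc.prems[of p] by (simp add: recursive_tree_def)
    next
      case False then show ?thesis using assms(1)
        by (auto intro!: sum_mono mult_left_mono Suc.prems recursive_tree_upd p hoppe_weight_nonneg)
    qed
  qed
qed

lemma hoppe_exp_nonneg:
  fixes F :: "(nat \<Rightarrow> nat) \<Rightarrow> real"
  assumes "0 < \<theta>" "\<And>p. recursive_tree n p \<Longrightarrow> 0 \<le> F p"
  shows "0 \<le> hoppe_exp \<theta> n F"
  using hoppe_exp_mono[OF assms(1), of n "\<lambda>_. 0" F] assms by (simp add: hoppe_exp_const)

lemma norm_hoppe_exp_le:
  fixes F :: "(nat \<Rightarrow> nat) \<Rightarrow> 'b::real_normed_vector"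
  assumes "0 < \<theta>"
  shows "norm (hoppe_exp \<theta> n F) \<le> hoppe_exp \<theta> n (\<lambda>p. norm (F p))"
proof (induction n arbitrary: F)
  case (Suc n)
  show ?case unfolding hoppe_exp.simps(2)
  proof (rule order_trans[OF Suc.IH hoppe_exp_mono[OF assms]])
    fix p
    show "norm (if n = 0 then F p else \<Sum>j<n. hoppe_weight \<theta> n j *\<^sub>R F (p(n := j))) \<le>
      (if n = 0 then norm (F p) else \<Sum>j<n. hoppe_weight \<theta> n j *\<^sub>R norm (F (p(n := j))))"
      using assms by (auto intro!: order_trans[OF norm_sum] sum_mono simp: hoppe_weight_nonneg)
  qed
qed simp

text \<open>Summing out a parent on which \<open>F\<close> does not depend multiplies by the total
  probability 1.\<close>

lemma hoppe_exp_restrict: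
  assumes "0 < \<theta>" "m \<le> n" and F: "\<And>p q. (\<And>k. k < m \<Longrightarrow> p k = q k) \<Longrightarrow> F p = F q"
  shows "hoppe_exp \<theta> n F = hoppe_exp \<theta> m F"
  using assms(2)
proof (induction n rule: dec_induct)
  case (step n)
  have "(\<lambda>p. if n = 0 then F p else \<Sum>j<n. hoppe_weight \<theta> n j *\<^sub>R F (p(n := j))) = F"
  proof
    fix p
    have "F (p(n := j)) = F p" for j using step by (intro F) auto
    then show "(if n = 0 then F p else \<Sum>j<n. hoppe_weight \<theta> n j *\<^sub>R F (p(n := j))) = F p"
      using sum_hoppe_weight[of \<theta> n] assms(1) by (auto simp: scaleR_left.sum[symmetric])
  qed
  then show ?case using step by (simp add: hoppe_exp.simps(2))
qed simp

section \<open>Transfer from the probability space to finite sums\<close>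

text \<open>Brings a parent function into the normal form over which \<open>hoppe_exp\<close> sums,
  with value 0 at 0 and from \<open>n\<close> on. Only countably many functions have this
  form.\<close>

definition parents_upto :: "nat \<Rightarrow> (nat \<Rightarrow> nat) \<Rightarrow> nat \<Rightarrow> nat" where
  "parents_upto n p = (\<lambda>k. if 1 \<le> k \<and> k < n then p k else 0)"

lemma parents_upto_Suc: "1 \<le> n \<Longrightarrow> parents_upto (Suc n) p = (parents_upto n p)(n := p n)"
  by (auto simp: parents_upto_def fun_eq_iff)

lemma parents_upto_le_1: "n \<le> 1 \<Longrightarrow> parents_upto n p = (\<lambda>_. 0)"
  by (auto simp: parents_upto_def fun_eq_iff)

text \<open>\<open>F\<close> is arbitrary and the space of parent functions carries no
  sigma-algebra. Measurability comes from fixing the last parent, which has countably many values,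
  and induction on the others.\<close>

lemma measurable_parents_upto:
  assumes "\<And>k. 1 \<le> k \<Longrightarrow> k < n \<Longrightarrow> (\<lambda>\<omega>. g \<omega> k) \<in> measurable N (count_space UNIV)"
  shows "(\<lambda>\<omega>. F (parents_upto n (g \<omega>))) \<in> measurable N (count_space UNIV)"
  using assms
proof (induction n arbitrary: F)
  case 0 then show ?case by (simp add: parents_upto_le_1)
next
  case (Suc n)
  show ?case
  proof (cases "n = 0")
    case True then show ?thesis by (simp add: parents_upto_le_1)
  next
    case False
    then have n: "1 \<le> n" by simp
    have "(\<lambda>\<omega>. (\<lambda>j \<omega>. F ((parents_upto n (g \<omega>))(n := j))) (g \<omega> n) \<omega>) \<in> measurable N (count_space UNIV)"
    proof (rule measurable_compose_countable)
      fix j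
      show "(\<lambda>\<omega>. F ((parents_upto n (g \<omega>))(n := j))) \<in> measurable N (count_space UNIV)"
        using Suc.IH[of "\<lambda>p. F (p(n := j))"] Suc.prems by simp
    next
      show "(\<lambda>\<omega>. g \<omega> n) \<in> measurable N (count_space UNIV)"
        using Suc.prems n by simp
    qed
    then show ?thesis using n by (simp only: parents_upto_Suc)
  qed
qed

lemma borel_measurable_parents_upto:
  fixes F :: "_ \<Rightarrow> 'b::topological_space"
  assumes "\<And>k. 1 \<le> k \<Longrightarrow> k < n \<Longrightarrow> (\<lambda>\<omega>. g \<omega> k) \<in> measurable N (count_space UNIV)"
  shows "(\<lambda>\<omega>. F (parents_upto n (g \<omega>))) \<in> borel_measurable N"
proof -
  have "(\<lambda>x::'b. x) \<in> measurable (count_space UNIV) borel" by simp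
  from measurable_compose[OF measurable_parents_upto[of n g N F, OF assms] this]
  show ?thesis by simp
qed

context prob_space begin

text \<open>\<open>P n\<close> is independent of the earlier parents, so splitting by its value
  reproduces one step of the recursion that defines \<open>hoppe_exp\<close>.\<close>

lemma expectation_parents_upto:
  fixes F :: "(nat \<Rightarrow> nat) \<Rightarrow> 'b::{real_normed_field, banach, second_countable_topology}"
  assumes \<theta>: "\<theta> > 0"
    and ind: "indep_vars (\<lambda>_. count_space UNIV) P {1..}"
    and P0: "\<And>k. k \<ge> 1 \<Longrightarrow> prob {\<omega> \<in> space M. P k \<omega> = 0} = \<theta> / (\<theta> + real k - 1)"
    and Pj: "\<And>k j. 1 \<le> j \<Longrightarrow> j < k \<Longrightarrow> prob {\<omega> \<in> space M. P k \<omega> = j} = 1 / (\<theta> + real k - 1)"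
  shows "integrable M (\<lambda>\<omega>. F (parents_upto n (\<lambda>k. P k \<omega>)))
    \<and> (\<integral>\<omega>. F (parents_upto n (\<lambda>k. P k \<omega>)) \<partial>M) = hoppe_exp \<theta> n F"
proof (induction n arbitrary: F)
  case 0
  then show ?case by (simp add: parents_upto_le_1 prob_space)
next
  case (Suc n)
  show ?case
  proof (cases "n = 0")
    case True then show ?thesis by (simp add: parents_upto_le_1 prob_space hoppe_exp.simps)
  next
    case False
    then have n: "1 \<le> n" by simp
    have Pm [measurable]: "P k \<in> measurable M (count_space UNIV)" if "1 \<le> k" for k
      using ind that by (auto simp: indep_vars_def)
    note [measurable] = Pm[OF n]
    have w: "prob {\<omega> \<in> space M. P n \<omega> = j} = hoppe_weight \<theta> n j" if "j < n" for j
      using that P0[OF n] Pj[of j n] by (cases "j = 0") (auto simp: hoppe_weight_def)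
    \<comment> \<open>The hypotheses only give the probabilities of the values below
      \<open>n\<close>. As these sum to 1, a parent is almost surely smaller than its child.\<close>
    have "prob {\<omega> \<in> space M. P n \<omega> < n} = (\<Sum>j<n. prob {\<omega> \<in> space M. P n \<omega> = j})"
    proof (subst finite_measure_finite_Union[symmetric])
      show "prob {\<omega> \<in> space M. P n \<omega> < n} = prob (\<Union>j\<in>{..<n}. {\<omega> \<in> space M. P n \<omega> = j})"
        by (rule arg_cong[where f=prob]) auto
    qed (auto simp: disjoint_family_on_def)
    also have "\<dots> = 1" using w \<theta> n by (simp add: sum_hoppe_weight)
    finally have lt: "AE \<omega> in M. P n \<omega> < n" by (subst (asm) prob_Collect_eq_1) auto
    let ?T = "\<lambda>\<omega>. parents_upto n (\<lambda>k. P k \<omega>)"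
    \<comment> \<open>The indicator is made \<open>'b\<close>-valued because the product rule for
      independent variables takes both factors from one field.\<close>
    let ?I = "\<lambda>j \<omega>. indicator {j} (P n \<omega>) *\<^sub>R (1 :: 'b)"
    have Tm: "(\<lambda>\<omega>. G (?T \<omega>)) \<in> borel_measurable M" for G :: "(nat \<Rightarrow> nat) \<Rightarrow> 'b"
      using Pm by (intro borel_measurable_parents_upto)
    have part: "AE \<omega> in M. F (parents_upto (Suc n) (\<lambda>k. P k \<omega>)) = (\<Sum>j<n. ?I j \<omega> * F ((?T \<omega>)(n := j)))"
      using lt AE_space
    proof eventually_elim
      case (elim \<omega>)
      have "(\<Sum>j<n. ?I j \<omega> * F ((?T \<omega>)(n := j))) = (\<Sum>j<n. if j = P n \<omega> then F ((?T \<omega>)(n := j)) else 0)"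
        using elim by (intro sum.cong) auto
      also have "\<dots> = F (parents_upto (Suc n) (\<lambda>k. P k \<omega>))" using elim n by (simp add: parents_upto_Suc)
      finally show ?case by simp
    qed
    have indep: "indep_var borel (?I j) borel (\<lambda>\<omega>. G (?T \<omega>))" for j and G :: "(nat \<Rightarrow> nat) \<Rightarrow> 'b"
    proof -
      have 1: "indep_var (PiM {n} (\<lambda>_. count_space UNIV)) (\<lambda>\<omega>. restrict (\<lambda>i. P i \<omega>) {n})
          (PiM {1..<n} (\<lambda>_. count_space UNIV)) (\<lambda>\<omega>. restrict (\<lambda>i. P i \<omega>) {1..<n})"
        using n by (intro indep_var_restrict[OF ind]) auto
      have m2: "(\<lambda>g. G (parents_upto n g)) \<in> measurable (PiM {1..<n} (\<lambda>_. count_space UNIV)) borel"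
        by (intro borel_measurable_parents_upto measurable_component_singleton) auto
      have m1: "(\<lambda>g. indicator {j} (g n) *\<^sub>R (1::'b)) \<in> measurable (PiM {n} (\<lambda>_. count_space UNIV)) borel"
        by (rule measurable_compose[of "\<lambda>g. g n" _ "count_space UNIV"]) auto
      have "indep_var borel ((\<lambda>g. indicator {j} (g n) *\<^sub>R (1::'b)) \<circ> (\<lambda>\<omega>. restrict (\<lambda>i. P i \<omega>) {n}))
         borel ((\<lambda>g. G (parents_upto n g)) \<circ> (\<lambda>\<omega>. restrict (\<lambda>i. P i \<omega>) {1..<n}))"
        by (rule indep_var_compose[OF 1 m1 m2])
      also have "((\<lambda>g. G (parents_upto n g)) \<circ> (\<lambda>\<omega>. restrict (\<lambda>i. P i \<omega>) {1..<n})) = (\<lambda>\<omega>. G (?T \<omega>))"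
        by (auto simp: fun_eq_iff parents_upto_def intro!: arg_cong[where f=G])
      finally show ?thesis by (simp add: comp_def)
    qed
    have I1: "has_bochner_integral M (\<lambda>\<omega>. indicator {\<omega> \<in> space M. P n \<omega> = j} \<omega>) (prob {\<omega> \<in> space M. P n \<omega> = j})" for j
      by (intro has_bochner_integral_real_indicator) (auto simp: less_top[symmetric])
    have I2: "has_bochner_integral M (\<lambda>\<omega>. indicator {j} (P n \<omega>)) (prob {\<omega> \<in> space M. P n \<omega> = j})" for j
      by (rule has_bochner_integral_cong[THEN iffD1, OF refl _ refl I1]) (auto simp: indicator_def)
    have I3: "has_bochner_integral M (?I j) (prob {\<omega> \<in> space M. P n \<omega> = j} *\<^sub>R 1)" for j
      by (rule has_bochner_integral_scaleR_left) (use I2 in blast)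
    have Iint: "integrable M (?I j)" for j using I3 by (rule integrable.intros)
    have Tint: "integrable M (\<lambda>\<omega>. F ((?T \<omega>)(n := j)))"
      and Tval: "(\<integral>\<omega>. F ((?T \<omega>)(n := j)) \<partial>M) = hoppe_exp \<theta> n (\<lambda>p. F (p(n := j)))" for j
      using Suc.IH[of "\<lambda>p. F (p(n := j))"] by auto
    have int: "integrable M (\<lambda>\<omega>. ?I j \<omega> * F ((?T \<omega>)(n := j)))" for j
      by (rule indep_var_integrable[OF indep[of j "\<lambda>p. F (p(n := j))"] Iint Tint])
    have val: "(\<integral>\<omega>. ?I j \<omega> * F ((?T \<omega>)(n := j)) \<partial>M) = hoppe_weight \<theta> n j *\<^sub>R hoppe_exp \<theta> n (\<lambda>p. F (p(n := j)))"
      if "j < n" for j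
    proof -
      have "(\<integral>\<omega>. ?I j \<omega> * F ((?T \<omega>)(n := j)) \<partial>M) = (\<integral>\<omega>. ?I j \<omega> \<partial>M) * (\<integral>\<omega>. F ((?T \<omega>)(n := j)) \<partial>M)"
        by (rule indep_var_lebesgue_integral[OF indep[of j "\<lambda>p. F (p(n := j))"] Iint Tint])
      also have "(\<integral>\<omega>. ?I j \<omega> \<partial>M) = hoppe_weight \<theta> n j *\<^sub>R 1"
        using has_bochner_integral_integral_eq[OF I3[of j]] w[OF that] by simp
      finally show ?thesis by (simp add: Tval del: fun_upd_apply)
    qed
    have Fm: "(\<lambda>\<omega>. F (parents_upto (Suc n) (\<lambda>k. P k \<omega>))) \<in> borel_measurable M"
      using Pm by (intro borel_measurable_parents_upto)
    have sum_int: "integrable M (\<lambda>\<omega>. \<Sum>j<n. ?I j \<omega> * F ((?T \<omega>)(n := j)))"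
      by (intro Bochner_Integration.integrable_sum int)
    then have "integrable M (\<lambda>\<omega>. F (parents_upto (Suc n) (\<lambda>k. P k \<omega>)))"
      by (subst integrable_cong_AE[OF Fm borel_measurable_integrable[OF sum_int] part])
    moreover have "(\<integral>\<omega>. F (parents_upto (Suc n) (\<lambda>k. P k \<omega>)) \<partial>M) = (\<integral>\<omega>. (\<Sum>j<n. ?I j \<omega> * F ((?T \<omega>)(n := j))) \<partial>M)"
      by (rule integral_cong_AE[OF Fm borel_measurable_integrable[OF sum_int] part])
    moreover have "\<dots> = (\<Sum>j<n. hoppe_weight \<theta> n j *\<^sub>R hoppe_exp \<theta> n (\<lambda>p. F (p(n := j))))"
      unfolding Bochner_Integration.integral_sum[OF int] by (rule sum.cong[OF refl], rule val) simp
    moreover have "\<dots> = hoppe_exp \<theta> (Suc n) F"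
      using n by (simp add: hoppe_exp_Suc hoppe_exp_sum hoppe_exp_linear[OF linear_scale_self])
    ultimately show ?thesis by simp
  qed
qed

end

section \<open>Depths and reattachment of subtrees\<close>

lemma depth_cong: "(\<And>i. 1 \<le> i \<Longrightarrow> i \<le> k \<Longrightarrow> p i = q i) \<Longrightarrow> hoppe_depth p k = hoppe_depth q k"
proof (induction k rule: less_induct)
  case (less k)
  show ?case
  proof (cases k)
    case (Suc m)
    have "p (Suc m) = q (Suc m)" using less.prems Suc by simp
    moreover have "hoppe_depth p (q (Suc m)) = hoppe_depth q (q (Suc m))" if "q (Suc m) \<le> m"
      using less Suc that by simp
    ultimately show ?thesis using Suc by simp
  qed simp
qed

lemma depth_upd_less: "k < n \<Longrightarrow> hoppe_depth (p(n := j)) k = hoppe_depth p k"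
  by (rule depth_cong) auto

lemma depth_upd_eq: "j < n \<Longrightarrow> hoppe_depth (p(n := j)) n = Suc (hoppe_depth p j)"
  by (cases n) (auto simp: depth_upd_less)

lemma internal_path_length_cong:
  "(\<And>i. 1 \<le> i \<Longrightarrow> i < n \<Longrightarrow> p i = q i) \<Longrightarrow> internal_path_length p n = internal_path_length q n"
  unfolding internal_path_length_def by (intro sum.cong depth_cong) auto

lemma internal_path_length_parents_upto:
  "internal_path_length (parents_upto n p) n = internal_path_length p n"
  by (rule internal_path_length_cong) (auto simp: parents_upto_def)

text \<open>\<open>last_below p c j\<close> is the largest ancestor of \<open>j\<close> (including \<open>j\<close> itself) that is smaller than \<open>c\<close>.
  In particular \<open>k\<close> is an ancestor of \<open>j\<close> iff \<open>last_below p (Suc k) j = k\<close>.\<close>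

function last_below :: "(nat \<Rightarrow> nat) \<Rightarrow> nat \<Rightarrow> nat \<Rightarrow> nat" where
  "last_below p c j = (if j < c then j else if p j < j then last_below p c (p j) else 0)"
  by pat_completeness auto
termination by (relation "Wellfounded.measure (\<lambda>(p, c, j). j)") auto

declare last_below.simps[simp del]

lemma last_below_less: "j < c \<Longrightarrow> last_below p c j = j"
  by (simp add: last_below.simps)

lemma last_below_step: "c \<le> j \<Longrightarrow> p j < j \<Longrightarrow> last_below p c j = last_below p c (p j)"
  by (subst last_below.simps) auto

lemma last_below_bad: "c \<le> j \<Longrightarrow> \<not> p j < j \<Longrightarrow> last_below p c j = 0"
  by (subst last_below.simps) auto

lemma last_below_last_below:
  assumes "c \<le> c'" "1 \<le> c" shows "last_below p c (last_below p c' j) = last_below p c j"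
proof (induction j rule: less_induct)
  case (less j)
  consider "j < c'" | "c' \<le> j" "p j < j" | "c' \<le> j" "\<not> p j < j" by linarith
  then show ?case
  proof cases
    case 1 then show ?thesis by (simp add: last_below_less)
  next
    case 2 then show ?thesis using less[of "p j"] assms by (simp add: last_below_step)
  next
    case 3 then show ?thesis using assms by (simp add: last_below_bad last_below_less)
  qed
qed

lemma last_below_cong:
  "(\<And>i. c \<le> i \<Longrightarrow> i \<le> j \<Longrightarrow> p i = q i) \<Longrightarrow> last_below p c j = last_below q c j"
proof (induction j rule: less_induct)
  case (less j)
  show ?case
  proof (cases "j < c")
    case False
    then have "p j = q j" using less.prems by simp
    moreover have "last_below p c (q j) = last_below q c (q j)" if "q j < j"
      using less that by simp
    ultimately show ?thesis using False by (simp add: last_below.simps[of _ c j])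
  qed (simp add: last_below_less)
qed

section \<open>Moving a subtree to another parent\<close>

definition subtree_size :: "(nat \<Rightarrow> nat) \<Rightarrow> nat \<Rightarrow> nat \<Rightarrow> nat" where
  "subtree_size p n k = card {j. j < n \<and> last_below p (Suc k) j = k}"

text \<open>A step from \<open>j\<close> to its parent lowers both depths by one, so a difference
  can only arise where the chain of ancestors meets \<open>k\<close>; there it is the difference
  between the new and the old parent.\<close>

lemma depth_reattach:
  assumes "p k < k" "v < k"
  shows "real (hoppe_depth (p(k := v)) j) = real (hoppe_depth p j) +
    (if last_below p (Suc k) j = k then real (hoppe_depth p v) - real (hoppe_depth p (p k)) else 0)"
proof (induction j rule: less_induct)
  case (less j)
  have D: "hoppe_depth q i = (if q i < i then Suc (hoppe_depth q (q i)) else 1)" if "1 \<le> i" for q i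
    using that by (cases i) auto
  consider "j < k" | "j = k" | "j > k" by linarith
  then show ?case
  proof cases
    case 1 then show ?thesis by (simp add: depth_upd_less last_below_less del: fun_upd_apply)
  next
    case 2
    have "hoppe_depth p k = Suc (hoppe_depth p (p k))" using D[of k p] assms by simp
    then show ?thesis using 2 assms by (simp add: depth_upd_eq last_below_less del: fun_upd_apply)
  next
    case 3
    show ?thesis
    proof (cases "p j < j")
      case True
      have "last_below p (Suc k) j = last_below p (Suc k) (p j)" using 3 True by (simp add: last_below_step)
      moreover have "(p(k := v)) j = p j" using 3 by simp
      ultimately show ?thesis using less[OF True] 3 True D[of j p] D[of j "p(k := v)"]
        by (simp del: fun_upd_apply)
    next
      case False
      \<comment> \<open>Such a \<open>j\<close> has the default depth 1 for both parent functions,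
        and the default 0 of \<open>last_below\<close> differs from \<open>k\<close> because
        \<open>v < k\<close>.\<close>
      then have "last_below p (Suc k) j = 0" using 3 by (simp add: last_below_bad)
      moreover have "(p(k := v)) j = p j" using 3 by simp
      ultimately show ?thesis using 3 False assms D[of j p] D[of j "p(k := v)"]
        by (simp del: fun_upd_apply)
    qed
  qed
qed

lemma internal_path_length_reattach:
  assumes "p k < k" "v < k"
  shows "real (internal_path_length (p(k := v)) n) = real (internal_path_length p n) +
    real (subtree_size p n k) * (real (hoppe_depth p v) - real (hoppe_depth p (p k)))"
proof -
  have "real (internal_path_length (p(k := v)) n) = (\<Sum>j<n. real (hoppe_depth p j) +
     (if last_below p (Suc k) j = k then real (hoppe_depth p v) - real (hoppe_depth p (p k)) else 0))"
    unfolding internal_path_length_def of_nat_sum by (intro sum.cong refl depth_reattach assms)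
  also have "\<dots> = real (internal_path_length p n) + (\<Sum>j\<in>{j. j < n \<and> last_below p (Suc k) j = k}. real (hoppe_depth p v) - real (hoppe_depth p (p k)))"
    unfolding sum.distrib internal_path_length_def of_nat_sum
    by (subst sum.inter_filter[symmetric]) (auto intro: sum.cong simp: lessThan_def)
  finally show ?thesis by (simp add: subtree_size_def)
qed

text \<open>A chain that reaches \<open>k > k'\<close> drops below \<open>b \<le> k'\<close> at its
  next step, whichever of the two parents \<open>k\<close> has, and so misses \<open>k'\<close>. For
  \<open>k \<le> k'\<close> the changed edge lies beyond the point where \<open>last_below\<close>
  stops.\<close>

lemma last_below_reattach:
  assumes "b \<le> k'" "b \<le> k" "p k < b" "v < b"
  shows "last_below (p(k := v)) (Suc k') j = k' \<longleftrightarrow> last_below p (Suc k') j = k'"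
proof (induction j rule: less_induct)
  case (less j)
  show ?case
  proof (cases "j \<le> k'")
    case True then show ?thesis by (simp add: last_below_less)
  next
    case False
    show ?thesis
    proof (cases "j = k")
      case True
      have "p j < j" "v < j" using True assms by auto
      then show ?thesis using True False assms by (simp add: last_below_step last_below_less)
    next
      case neq: False
      show ?thesis
      proof (cases "p j < j")
        case True
        then show ?thesis using less[OF True] neq False by (simp add: last_below_step)
      next
        case False
        then show ?thesis using neq \<open>\<not> j \<le> k'\<close> by (simp add: last_below_bad)
      qed
    qed
  qed
qed

lemma subtree_size_reattach:
  assumes "b \<le> k'" "b \<le> k" "p k < b" "v < b"
  shows "subtree_size (p(k := v)) n k' = subtree_size p n k'"
  unfolding subtree_size_def using last_below_reattach[of b k' k p v] assms by simp

text \<open>Conditionally on the event that \<open>k\<close> chooses its parent in \<open>{1..<b}\<close>, the parent is uniform there;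
  \<open>reattach_avg\<close> is the corresponding conditional expectation.\<close>

definition reattach_avg :: "nat \<Rightarrow> nat \<Rightarrow> ((nat \<Rightarrow> nat) \<Rightarrow> complex) \<Rightarrow> (nat \<Rightarrow> nat) \<Rightarrow> complex" where
  "reattach_avg b k F p = (if 1 \<le> p k \<and> p k < b then (\<Sum>u\<in>{1..<b}. F (p(k := u))) / of_nat (b - 1) else F p)"

text \<open>The nodes in \<open>{1..<b}\<close> carry equal weights, so averaging over them
  preserves the mean over the parent of \<open>k\<close>. Later choices do not interfere, since
  their probabilities do not depend on the tree built so far.\<close>

lemma hoppe_exp_reattach_avg:
  assumes "0 < \<theta>" "2 \<le> b" "b \<le> k" "k < n"
  shows "hoppe_exp \<theta> n (reattach_avg b k F) = hoppe_exp \<theta> n F"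
proof -
  have "Suc k \<le> n" using assms by simp
  then show ?thesis
  proof (induction n arbitrary: F rule: dec_induct)
    case base
    have "(\<Sum>j<k. hoppe_weight \<theta> k j *\<^sub>R reattach_avg b k F (p(k := j))) = (\<Sum>j<k. hoppe_weight \<theta> k j *\<^sub>R F (p(k := j)))" for p
    proof -
      let ?W = "\<theta> + real k - 1"
      have split: "{..<k} = insert 0 ({1..<b} \<union> {b..<k})" using assms by auto
      have "(\<Sum>j<k. hoppe_weight \<theta> k j *\<^sub>R reattach_avg b k F (p(k := j))) =
        hoppe_weight \<theta> k 0 *\<^sub>R F (p(k := 0)) + ((\<Sum>j\<in>{1..<b}. hoppe_weight \<theta> k j *\<^sub>R reattach_avg b k F (p(k := j)))
         + (\<Sum>j\<in>{b..<k}. hoppe_weight \<theta> k j *\<^sub>R F (p(k := j))))"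
        unfolding split using assms
        by (subst sum.insert) (auto simp: sum.union_disjoint reattach_avg_def)
      also have "(\<Sum>j\<in>{1..<b}. hoppe_weight \<theta> k j *\<^sub>R reattach_avg b k F (p(k := j))) =
          (\<Sum>j\<in>{1..<b}. (1 / ?W) *\<^sub>R ((\<Sum>u\<in>{1..<b}. F (p(k := u))) / of_nat (b - 1)))"
        by (intro sum.cong) (auto simp: hoppe_weight_def reattach_avg_def)
      also have "\<dots> = (1 / ?W) *\<^sub>R (\<Sum>u\<in>{1..<b}. F (p(k := u)))"
        using assms by (simp add: scaleR_conv_of_real)
      also have "\<dots> = (\<Sum>u\<in>{1..<b}. hoppe_weight \<theta> k u *\<^sub>R F (p(k := u)))"
        unfolding scaleR_sum_right by (intro sum.cong) (auto simp: hoppe_weight_def)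
      also have "hoppe_weight \<theta> k 0 *\<^sub>R F (p(k := 0)) + ((\<Sum>j\<in>{1..<b}. hoppe_weight \<theta> k j *\<^sub>R F (p(k := j)))
         + (\<Sum>j\<in>{b..<k}. hoppe_weight \<theta> k j *\<^sub>R F (p(k := j)))) = (\<Sum>j<k. hoppe_weight \<theta> k j *\<^sub>R F (p(k := j)))"
        unfolding split using assms by (subst sum.insert) (auto simp: sum.union_disjoint)
      finally show ?thesis .
    qed
    then show ?case using assms by (simp add: hoppe_exp_Suc)
  next
    case (step n)
    have n: "1 \<le> n" "k \<noteq> n" using step by auto
    have "(\<Sum>j<n. hoppe_weight \<theta> n j *\<^sub>R reattach_avg b k F (p(n := j))) =
       reattach_avg b k (\<lambda>q. \<Sum>j<n. hoppe_weight \<theta> n j *\<^sub>R F (q(n := j))) p" for p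
    proof (cases "1 \<le> p k \<and> p k < b")
      case True
      have "(\<Sum>j<n. hoppe_weight \<theta> n j *\<^sub>R reattach_avg b k F (p(n := j))) =
        (\<Sum>j<n. hoppe_weight \<theta> n j *\<^sub>R ((\<Sum>u\<in>{1..<b}. F (p(k := u, n := j))) / of_nat (b - 1)))"
        using True n by (simp add: reattach_avg_def fun_upd_twist)
      also have "\<dots> = (\<Sum>u\<in>{1..<b}. \<Sum>j<n. hoppe_weight \<theta> n j *\<^sub>R F (p(k := u, n := j))) / of_nat (b - 1)"
        by (subst sum.swap) (simp add: sum_divide_distrib scaleR_sum_right scaleR_conv_of_real sum_distrib_left)
      finally show ?thesis using True by (simp add: reattach_avg_def)
    next
      case False then show ?thesis using n by (auto simp: reattach_avg_def)
    qed
    then show ?case using step.IH n by (simp add: hoppe_exp_Suc)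
  qed
qed

section \<open>Conditional independence of the sources\<close>

text \<open>The characteristic function of the depth of a uniformly chosen node of
  \<open>{1..<b}\<close>.\<close>

definition depth_char :: "nat \<Rightarrow> (nat \<Rightarrow> nat) \<Rightarrow> real \<Rightarrow> complex" where
  "depth_char b p y = (\<Sum>u\<in>{1..<b}. iexp (y * real (hoppe_depth p u))) / of_nat (b - 1)"

definition attached_below :: "nat \<Rightarrow> nat set \<Rightarrow> (nat \<Rightarrow> nat) \<Rightarrow> nat set" where
  "attached_below b Q p = {k \<in> Q. 1 \<le> p k \<and> p k < b}"

text \<open>The sources are averaged one at a time, by an exact identity; the modulus is taken only
  after the last one, when all remaining phases have modulus 1. Factors already obtained are
  constant under further averaging, because moving \<open>k\<close> affects neither depths below
  \<open>b\<close> nor other subtree sizes.\<close>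

lemma norm_hoppe_exp_iexp_le:
  assumes \<theta>: "0 < \<theta>" and b: "2 \<le> b" and Q: "Q \<subseteq> {b..<n}"
  shows "cmod (hoppe_exp \<theta> n (\<lambda>p. iexp (s * real (internal_path_length p n)))) \<le>
    hoppe_exp \<theta> n (\<lambda>p. \<Prod>k\<in>attached_below b Q p. cmod (depth_char b p (s * real (subtree_size p n k))))"
proof -
  let ?F = "\<lambda>p. iexp (s * real (internal_path_length p n))"
  \<comment> \<open>The second factor cancels the phase of the present parent, in place of which the
    averaged phase \<open>depth_char\<close> appears.\<close>
  let ?c = "\<lambda>k p. depth_char b p (s * real (subtree_size p n k)) * iexp (- (s * real (subtree_size p n k) * real (hoppe_depth p (p k))))"
  have "finite Q" using Q finite_subset by blast
  then have "hoppe_exp \<theta> n ?F = hoppe_exp \<theta> n (\<lambda>p. ?F p * (\<Prod>k\<in>attached_below b Q p. ?c k p))"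
    using Q
  proof (induction Q rule: finite_induct)
    case empty then show ?case by (simp add: attached_below_def)
  next
    case (insert k Q)
    have k: "b \<le> k" "k < n" using insert by auto
    let ?G = "\<lambda>p. ?F p * (\<Prod>k\<in>attached_below b Q p. ?c k p)"
    have "hoppe_exp \<theta> n ?F = hoppe_exp \<theta> n (reattach_avg b k ?G)"
      using insert hoppe_exp_reattach_avg[OF \<theta> b k] by simp
    also have "reattach_avg b k ?G = (\<lambda>p. ?F p * (\<Prod>k\<in>attached_below b (insert k Q) p. ?c k p))"
    proof
      fix p
      show "reattach_avg b k ?G p = ?F p * (\<Prod>k\<in>attached_below b (insert k Q) p. ?c k p)"
      proof (cases "1 \<le> p k \<and> p k < b")
        case False
        then have "attached_below b (insert k Q) p = attached_below b Q p"
          by (auto simp: attached_below_def)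
        then show ?thesis using False by (auto simp: reattach_avg_def)
      next
        case True
        then have *: "attached_below b (insert k Q) p = insert k (attached_below b Q p)" "k \<notin> attached_below b Q p"
          "finite (attached_below b Q p)"
          using insert by (auto simp: attached_below_def)
        have G: "?G (p(k := u)) = ?F p * (\<Prod>k\<in>attached_below b Q p. ?c k p) *
           (iexp (s * real (subtree_size p n k) * real (hoppe_depth p u)) * iexp (- (s * real (subtree_size p n k) * real (hoppe_depth p (p k)))))"
          if u: "u \<in> {1..<b}" for u
        proof -
          have "?F (p(k := u)) = ?F p * (iexp (s * real (subtree_size p n k) * real (hoppe_depth p u)) * iexp (- (s * real (subtree_size p n k) * real (hoppe_depth p (p k)))))"
          proof -
            have "s * real (internal_path_length (p(k := u)) n) = s * real (internal_path_length p n) +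
              (s * real (subtree_size p n k) * real (hoppe_depth p u) + - (s * real (subtree_size p n k) * real (hoppe_depth p (p k))))"
              using arg_cong[OF internal_path_length_reattach[of p k u n], of "\<lambda>x. s * x"] u k True
              by (simp add: algebra_simps)
            then show ?thesis by (simp only: of_real_add distrib_left exp_add)
          qed
          moreover have "attached_below b Q (p(k := u)) = attached_below b Q p"
            using insert by (auto simp: attached_below_def)
          moreover have "(\<Prod>k'\<in>attached_below b Q p. ?c k' (p(k := u))) = (\<Prod>k\<in>attached_below b Q p. ?c k p)"
          proof (rule prod.cong[OF refl])
            fix k' assume k': "k' \<in> attached_below b Q p"
            then have k'b: "b \<le> k'" "k' \<noteq> k" "p k' < b" using insert by (auto simp: attached_below_def)
            have "subtree_size (p(k := u)) n k' = subtree_size p n k'"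
              using k'b k True u by (intro subtree_size_reattach) auto
            moreover have "hoppe_depth (p(k := u)) i = hoppe_depth p i" if "i < b" for i
              using that k by (intro depth_upd_less) auto
            ultimately show "?c k' (p(k := u)) = ?c k' p" using k'b by (simp add: depth_char_def)
          qed
          ultimately show ?thesis by (simp add: mult_ac)
        qed
        have "reattach_avg b k ?G p = (\<Sum>u\<in>{1..<b}. ?G (p(k := u))) / of_nat (b - 1)"
          using True by (simp add: reattach_avg_def)
        also have "(\<Sum>u\<in>{1..<b}. ?G (p(k := u))) = (\<Sum>u\<in>{1..<b}. ?F p * (\<Prod>k\<in>attached_below b Q p. ?c k p) *
           (iexp (s * real (subtree_size p n k) * real (hoppe_depth p u)) * iexp (- (s * real (subtree_size p n k) * real (hoppe_depth p (p k))))))"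
          by (rule sum.cong[OF refl G])
        also have "\<dots> = ?F p * (\<Prod>k\<in>attached_below b Q p. ?c k p) *
           ((\<Sum>u\<in>{1..<b}. iexp (s * real (subtree_size p n k) * real (hoppe_depth p u))) * iexp (- (s * real (subtree_size p n k) * real (hoppe_depth p (p k)))))"
          by (simp only: sum_distrib_left[symmetric] sum_distrib_right[symmetric])
        also have "\<dots> / of_nat (b - 1) = ?F p * (\<Prod>k\<in>attached_below b Q p. ?c k p) * ?c k p"
          unfolding depth_char_def[of b p "s * real (subtree_size p n k)"]
          by (simp only: times_divide_eq_right times_divide_eq_left)
        also have "\<dots> = ?F p * (\<Prod>k\<in>attached_below b (insert k Q) p. ?c k p)"
          unfolding *(1) prod.insert[OF *(3) *(2)] by (simp only: mult_ac)
        finally show ?thesis .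
      qed
    qed
    finally show ?case .
  qed
  then have "cmod (hoppe_exp \<theta> n ?F) \<le> hoppe_exp \<theta> n (\<lambda>p. cmod (?F p * (\<Prod>k\<in>attached_below b Q p. ?c k p)))"
    by (simp only: norm_hoppe_exp_le[OF \<theta>])
  also have "(\<lambda>p. cmod (?F p * (\<Prod>k\<in>attached_below b Q p. ?c k p))) =
     (\<lambda>p. \<Prod>k\<in>attached_below b Q p. cmod (depth_char b p (s * real (subtree_size p n k))))"
    by (simp only: norm_mult prod_norm[symmetric] norm_exp_i_times mult_1_left mult_1_right)
  finally show ?thesis .
qed

section \<open>Decay of the characteristic function\<close>

lemma norm_one_plus_iexp: "cmod (1 + iexp y) = 2 * \<bar>cos (y / 2)\<bar>"
proof -
  have "sin y = 2 * sin (y / 2) * cos (y / 2)" "cos y = 2 * (cos (y / 2))\<^sup>2 - 1"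
    using sin_double[of "y / 2"] cos_double_cos[of "y / 2"] by simp_all
  then have "1 + cis y = cis (y / 2) * of_real (2 * cos (y / 2))"
    by (simp add: complex_eq_iff power2_eq_square)
  then have "cmod (1 + cis y) = \<bar>2 * cos (y / 2)\<bar>"
    by (simp only: norm_mult norm_cis norm_of_real)
  then show ?thesis by (simp add: cis_conv_exp abs_mult)
qed

definition matched :: "nat \<Rightarrow> nat \<Rightarrow> (nat \<Rightarrow> nat) \<Rightarrow> nat set" where
  "matched K n p = p ` {K..<n} \<inter> {1..<K}"

lemma finite_matched [simp]: "finite (matched K n p)"
  by (simp add: matched_def)

text \<open>Each \<open>v \<in> matched K b p\<close> is paired with one of its children in \<open>{K..<b}\<close>. The two depths in a
  pair differ by one, so the pair contributes at most \<open>cmod (1 + iexp y)\<close> to \<open>depth_char\<close>.\<close>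

lemma norm_depth_char_le:
  assumes "2 \<le> b" "K \<le> b"
  shows "cmod (depth_char b p y) \<le> 1 - 2 * real (card (matched K b p)) / real (b - 1) * (1 - \<bar>cos (y / 2)\<bar>)"
proof -
  let ?V = "matched K b p" and ?z = "\<lambda>u. iexp (y * real (hoppe_depth p u))"
  have "\<forall>v\<in>?V. \<exists>j. j \<in> {K..<b} \<and> p j = v" by (auto simp: matched_def)
  then obtain \<sigma> where \<sigma>: "\<And>v. v \<in> ?V \<Longrightarrow> \<sigma> v \<in> {K..<b} \<and> p (\<sigma> v) = v" by metis
  have inj: "inj_on \<sigma> ?V" using \<sigma> by (metis inj_onI)
  have V: "v \<in> {1..<K}" if "v \<in> ?V" for v using that by (auto simp: matched_def)
  have disj: "?V \<inter> \<sigma> ` ?V = {}" using \<sigma> V by fastforce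
  have sub: "?V \<union> \<sigma> ` ?V \<subseteq> {1..<b}"
  proof
    fix x assume "x \<in> ?V \<union> \<sigma> ` ?V"
    then show "x \<in> {1..<b}" using V \<sigma> assms by fastforce
  qed
  have depth: "hoppe_depth p (\<sigma> v) = Suc (hoppe_depth p v)" if v: "v \<in> ?V" for v
    using \<sigma>[OF v] V[OF v] by (cases "\<sigma> v") auto
  have card: "card (?V \<union> \<sigma> ` ?V) = 2 * card ?V"
    using card_image[OF inj] disj by (subst card_Un_disjoint) auto
  have "(\<Sum>u\<in>{1..<b}. ?z u) = (\<Sum>u\<in>?V \<union> \<sigma> ` ?V. ?z u) + (\<Sum>u\<in>{1..<b} - (?V \<union> \<sigma> ` ?V). ?z u)"
    using sum.subset_diff[OF sub] by (simp add: add.commute)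
  also have "(\<Sum>u\<in>?V \<union> \<sigma> ` ?V. ?z u) = (\<Sum>v\<in>?V. ?z v) + (\<Sum>v\<in>?V. ?z (\<sigma> v))"
    using disj by (subst sum.union_disjoint) (auto simp: sum.reindex[OF inj])
  also have "\<dots> = (\<Sum>v\<in>?V. ?z v * (1 + iexp y))"
    unfolding sum.distrib[symmetric]
    by (intro sum.cong refl) (simp add: depth algebra_simps exp_add[symmetric])
  finally have eq: "(\<Sum>u\<in>{1..<b}. ?z u) = (\<Sum>v\<in>?V. ?z v * (1 + iexp y)) + (\<Sum>u\<in>{1..<b} - (?V \<union> \<sigma> ` ?V). ?z u)" .
  have "cmod (\<Sum>v\<in>?V. ?z v * (1 + iexp y)) \<le> (\<Sum>v\<in>?V. 2 * \<bar>cos (y / 2)\<bar>)"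
    by (rule sum_norm_le) (simp only: norm_mult norm_exp_i_times norm_one_plus_iexp mult_1_left order_refl)
  moreover have "cmod (\<Sum>u\<in>{1..<b} - (?V \<union> \<sigma> ` ?V). ?z u) \<le> (\<Sum>u\<in>{1..<b} - (?V \<union> \<sigma> ` ?V). 1)"
    by (rule sum_norm_le) (simp only: norm_exp_i_times order_refl)
  moreover have "(\<Sum>u\<in>{1..<b} - (?V \<union> \<sigma> ` ?V). 1::real) = real (b - 1) - 2 * real (card ?V)"
    using sub card card_mono[OF _ sub] by (simp add: card_Diff_subset of_nat_diff)
  ultimately have "cmod (\<Sum>u\<in>{1..<b}. ?z u) \<le> real (card ?V) * (2 * \<bar>cos (y / 2)\<bar>) + (real (b - 1) - 2 * real (card ?V))"
    unfolding eq by (intro order_trans[OF norm_triangle_ineq]) simp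
  then have "cmod (depth_char b p y) \<le> (real (card ?V) * (2 * \<bar>cos (y / 2)\<bar>) + (real (b - 1) - 2 * real (card ?V))) / real (b - 1)"
    unfolding depth_char_def norm_divide norm_of_nat by (rule divide_right_mono) simp
  also have "\<dots> = 1 - 2 * real (card ?V) / real (b - 1) * (1 - \<bar>cos (y / 2)\<bar>)"
    using assms by (simp add: field_simps)
  finally show ?thesis .
qed

text \<open>Fewer than \<open>J\<close> of the candidates below \<open>4 * J\<close> are matched
  before each step, so a new node hits a fresh one with probability at least 1/2. A hit halves the
  weight, whence the mean factor 3/4. The result is an exponential moment for Markov's
  inequality.\<close>

lemma hoppe_exp_matched:
  assumes \<theta>: "0 < \<theta>" and J: "\<theta> + 2 \<le> real J" and i: "i \<le> J"
  shows "hoppe_exp \<theta> (4 * J + i) (\<lambda>p. (1 / 2) ^ card (matched (4 * J) (4 * J + i) p)) \<le> (3 / 4 :: real) ^ i"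
  using i
proof (induction i)
  case 0
  then show ?case using \<theta> by (simp add: matched_def hoppe_exp_const)
next
  case (Suc i)
  let ?K = "4 * J" let ?n = "?K + i"
  have J1: "1 \<le> J" using J \<theta> by linarith
  then have n: "1 \<le> ?n" by linarith
  have "hoppe_exp \<theta> (Suc ?n) (\<lambda>p. (1 / 2) ^ card (matched ?K (Suc ?n) p)) \<le>
    hoppe_exp \<theta> ?n (\<lambda>p. 3 / 4 * (1 / 2) ^ card (matched ?K ?n p) :: real)"
    unfolding hoppe_exp_Suc[OF n]
  proof (rule hoppe_exp_mono[OF \<theta>])
    fix p
    let ?V = "matched ?K ?n p" let ?A = "{1..<?K} - ?V"
    have upd: "matched ?K (Suc ?n) (p(?n := j)) = ?V \<union> ({j} \<inter> {1..<?K})" for j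
      by (auto simp: matched_def image_iff less_Suc_eq)
    have cV: "card ?V \<le> i" using card_mono[of "p ` {?K..<?n}" ?V] card_image_le[of "{?K..<?n}" p]
      by (simp add: matched_def)
    have VK: "?V \<subseteq> {1..<?K}" by (auto simp: matched_def)
    have cA: "real (card ?A) = real ?K - 1 - real (card ?V)"
      using VK card_mono[OF _ VK] J1 by (subst card_Diff_subset) (auto simp: of_nat_diff)
    have "(\<Sum>j<?n. hoppe_weight \<theta> ?n j *\<^sub>R ((1 / 2) ^ card (matched ?K (Suc ?n) (p(?n := j))) :: real)) =
      (\<Sum>j<?n. hoppe_weight \<theta> ?n j * (1 / 2) ^ card ?V - (if j \<in> ?A then 1 / (2 * (\<theta> + real ?n - 1)) * (1 / 2) ^ card ?V else 0))"
    proof (intro sum.cong refl)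
      fix j
      show "hoppe_weight \<theta> ?n j *\<^sub>R ((1 / 2) ^ card (matched ?K (Suc ?n) (p(?n := j))) :: real) =
         hoppe_weight \<theta> ?n j * (1 / 2) ^ card ?V - (if j \<in> ?A then 1 / (2 * (\<theta> + real ?n - 1)) * (1 / 2) ^ card ?V else 0)"
      proof (cases "j \<in> ?A")
        case True
        then have "{j} \<inter> {1..<?K} = {j}" "j \<notin> ?V" "j \<noteq> 0" by auto
        then have "card (matched ?K (Suc ?n) (p(?n := j))) = Suc (card ?V)" unfolding upd by simp
        moreover have "1 / W * (1 / 2) ^ Suc c = 1 / W * (1 / 2) ^ c - 1 / (2 * W) * (1 / 2) ^ c" for W :: real and c
          by (simp add: field_simps)
        ultimately show ?thesis using True \<open>j \<noteq> 0\<close> by (simp only: hoppe_weight_def if_True if_False real_scaleR_def)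
      next
        case False
        then have "?V \<union> ({j} \<inter> {1..<?K}) = ?V" by auto
        then show ?thesis using False by (auto simp: upd)
      qed
    qed
    also have "\<dots> = (1 / 2) ^ card ?V - real (card ?A) * (1 / (2 * (\<theta> + real ?n - 1)) * (1 / 2) ^ card ?V)"
    proof -
      have "(\<Sum>j<?n. if j \<in> ?A then 1 / (2 * (\<theta> + real ?n - 1)) * (1 / 2) ^ card ?V else 0) =
         (\<Sum>j\<in>?A. 1 / (2 * (\<theta> + real ?n - 1)) * (1 / 2) ^ card ?V)"
        by (rule sum.mono_neutral_cong_right) auto
      then show ?thesis
        using sum_hoppe_weight[OF \<theta> n] by (simp add: sum_subtractf sum_distrib_right[symmetric])
    qed
    also have "\<dots> = (1 - (real ?K - 1 - real (card ?V)) / (2 * (\<theta> + real ?n - 1))) * (1 / 2) ^ card ?V"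
      unfolding cA by (simp add: algebra_simps)
    also have "\<dots> \<le> 3 / 4 * (1 / 2) ^ card ?V"
    proof (rule mult_right_mono)
      have "1 / 4 \<le> (real ?K - 1 - real (card ?V)) / (2 * (\<theta> + real ?n - 1))"
        using cV Suc.prems J \<theta> by (subst pos_le_divide_eq) (auto simp: of_nat_le_iff[symmetric, where 'a=real] simp del: of_nat_le_iff)
      then show "1 - (real ?K - 1 - real (card ?V)) / (2 * (\<theta> + real ?n - 1)) \<le> 3 / 4" by simp
    qed simp
    finally show "(\<Sum>j<?n. hoppe_weight \<theta> ?n j *\<^sub>R ((1 / 2) ^ card (matched ?K (Suc ?n) (p(?n := j))) :: real)) \<le> 3 / 4 * (1 / 2) ^ card ?V" .
  qed
  also have "\<dots> \<le> 3 / 4 * (3 / 4) ^ i"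
    using Suc by (subst hoppe_exp_cmult) (auto intro!: mult_left_mono)
  finally show ?case by simp
qed

section \<open>Tail bounds for numbers of exceptional nodes\<close>

text \<open>A Chernoff bound in which joint probabilities take the place of independence: Markov's
  inequality is applied to \<open>2 ^ N\<close>, with \<open>N\<close> the count, and
  \<open>2 ^ N\<close> is the sum over all \<open>R \<subseteq> Q\<close> of the indicator that
  every \<open>k \<in> R\<close> is counted.\<close>

lemma hoppe_exp_count_le:
  fixes X :: "'i \<Rightarrow> (nat \<Rightarrow> nat) \<Rightarrow> bool"
  assumes \<theta>: "0 < \<theta>" and Q: "finite Q" and \<rho>: "0 \<le> \<rho>"
    and X: "\<And>R. R \<subseteq> Q \<Longrightarrow> hoppe_exp \<theta> n (\<lambda>p. \<Prod>k\<in>R. of_bool (X k p)) \<le> \<rho> ^ card R"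
  shows "hoppe_exp \<theta> n (\<lambda>p. of_bool (m \<le> card {k \<in> Q. X k p})) \<le> (1 + \<rho>) ^ card Q / (2::real) ^ m"
proof -
  have prod: "(\<Prod>k\<in>Q. g k + 1) = (\<Sum>R\<in>Pow Q. \<Prod>k\<in>R. g k)" for g :: "'i \<Rightarrow> real"
    using prod_add[OF Q, of g "\<lambda>_. 1"] by simp
  have "of_bool (m \<le> card {k \<in> Q. X k p}) \<le> 1 / 2 ^ m * (\<Sum>R\<in>Pow Q. \<Prod>k\<in>R. of_bool (X k p) :: real)" for p
  proof -
    have "(\<Prod>k\<in>Q. of_bool (X k p) + 1 :: real) = (\<Prod>k\<in>Q. if X k p then 2 else 1)"
      by (intro prod.cong) auto
    also have "\<dots> = 2 ^ card {k \<in> Q. X k p}"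
      using Q by (simp add: prod.If_cases Int_def)
    finally show ?thesis unfolding prod[symmetric] by (auto simp: of_bool_def field_simps)
  qed
  then have "hoppe_exp \<theta> n (\<lambda>p. of_bool (m \<le> card {k \<in> Q. X k p})) \<le>
     hoppe_exp \<theta> n (\<lambda>p. 1 / 2 ^ m * (\<Sum>R\<in>Pow Q. \<Prod>k\<in>R. of_bool (X k p) :: real))"
    by (intro hoppe_exp_mono[OF \<theta>])
  also have "\<dots> = 1 / 2 ^ m * (\<Sum>R\<in>Pow Q. hoppe_exp \<theta> n (\<lambda>p. \<Prod>k\<in>R. of_bool (X k p) :: real))"
    by (simp only: hoppe_exp_cmult hoppe_exp_sum)
  also have "\<dots> \<le> 1 / 2 ^ m * (\<Sum>R\<in>Pow Q. \<rho> ^ card R)"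
    by (intro mult_left_mono sum_mono X) auto
  also have "(\<Sum>R\<in>Pow Q. \<rho> ^ card R) = (1 + \<rho>) ^ card Q"
    using prod[of "\<lambda>_. \<rho>"] by (simp add: add.commute)
  finally show ?thesis by simp
qed

lemma hoppe_exp_prod_coords:
  fixes g :: "nat \<Rightarrow> nat \<Rightarrow> real"
  assumes \<theta>: "0 < \<theta>"
  shows "R \<subseteq> {1..<n} \<Longrightarrow> hoppe_exp \<theta> n (\<lambda>p. \<Prod>k\<in>R. g k (p k)) = (\<Prod>k\<in>R. \<Sum>j<k. hoppe_weight \<theta> k j * g k j)"
proof (induction n arbitrary: R)
  case 0 then show ?case by simp
next
  case (Suc n)
  show ?case
  proof (cases "n = 0")
    case True then show ?thesis using Suc.prems \<theta> by (simp add: hoppe_exp_const)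
  next
    case False
    then have n: "1 \<le> n" by simp
    define R' where "R' = R - {n}"
    have R': "R' \<subseteq> {1..<n}" "finite R'" "n \<notin> R'" using Suc.prems finite_subset[of R] by (auto simp: R'_def)
    have upd: "(\<Prod>k\<in>R'. g k ((p(n := j)) k)) = (\<Prod>k\<in>R'. g k (p k))" for p j
      using R' by (intro prod.cong) auto
    show ?thesis
    proof (cases "n \<in> R")
      case True
      then have R: "R = insert n R'" by (auto simp: R'_def)
      have "hoppe_exp \<theta> (Suc n) (\<lambda>p. \<Prod>k\<in>R. g k (p k)) =
          hoppe_exp \<theta> n (\<lambda>p. (\<Sum>j<n. hoppe_weight \<theta> n j * g n j) * (\<Prod>k\<in>R'. g k (p k)))"
        unfolding hoppe_exp_Suc[OF n] R prod.insert[OF R'(2,3)] upd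
        by (simp add: sum_distrib_right sum_distrib_left mult_ac)
      then show ?thesis unfolding hoppe_exp_cmult Suc.IH[OF R'(1)] R prod.insert[OF R'(2,3)] .
    next
      case False
      then have R: "R = R'" by (auto simp: R'_def)
      show ?thesis unfolding hoppe_exp_Suc[OF n] R upd
        using Suc.IH[OF R'(1)] sum_hoppe_weight[OF \<theta> n] by (simp add: scaleR_left.sum[symmetric] sum_distrib_right[symmetric])
    qed
  qed
qed

text \<open>Different nodes choose independently, and a window node misses \<open>{1..<b}\<close>
  only by choosing the root, of weight \<open>\<theta>\<close>, or one of at most \<open>l\<close>
  older window nodes.\<close>

lemma hoppe_exp_not_attached:
  assumes \<theta>: "0 < \<theta>" and b: "2 \<le> b" and B: "b + l \<le> n" and R: "R \<subseteq> {b..<b + l}"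
    and \<rho>: "(\<theta> + real l) / (\<theta> + real b - 1) \<le> \<rho>"
  shows "hoppe_exp \<theta> n (\<lambda>p. \<Prod>k\<in>R. of_bool (\<not> (1 \<le> p k \<and> p k < b))) \<le> \<rho> ^ card R"
proof -
  have "hoppe_exp \<theta> n (\<lambda>p. \<Prod>k\<in>R. of_bool (\<not> (1 \<le> p k \<and> p k < b))) =
     (\<Prod>k\<in>R. \<Sum>j<k. hoppe_weight \<theta> k j * of_bool (\<not> (1 \<le> j \<and> j < b)))"
    using R B b by (intro hoppe_exp_prod_coords[OF \<theta>, of R n "\<lambda>k j. of_bool (\<not> (1 \<le> j \<and> j < b))"]) auto
  also have "\<dots> \<le> (\<Prod>k\<in>R. \<rho>)"
  proof (rule prod_mono, intro conjI)
    fix k assume "k \<in> R"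
    then have k: "b \<le> k" "k < b + l" using R by auto
    show "0 \<le> (\<Sum>j<k. hoppe_weight \<theta> k j * of_bool (\<not> (1 \<le> j \<and> j < b)))"
      using k b \<theta> by (intro sum_nonneg mult_nonneg_nonneg hoppe_weight_nonneg) auto
    have "(\<Sum>j<k. hoppe_weight \<theta> k j * of_bool (\<not> (1 \<le> j \<and> j < b))) = (\<Sum>j\<in>insert 0 {b..<k}. hoppe_weight \<theta> k j)"
      using k b by (intro sum.mono_neutral_cong_right) auto
    also have "\<dots> = \<theta> / (\<theta> + real k - 1) + (\<Sum>j\<in>{b..<k}. 1 / (\<theta> + real k - 1))"
      using b by (subst sum.insert) (auto simp: hoppe_weight_def intro!: sum.cong)
    also have "\<dots> = (\<theta> + real (k - b)) / (\<theta> + real k - 1)" by (simp add: add_divide_distrib)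
    also have "\<dots> \<le> (\<theta> + real l) / (\<theta> + real b - 1)"
      using k b \<theta> by (intro frac_le) auto
    finally show "(\<Sum>j<k. hoppe_weight \<theta> k j * of_bool (\<not> (1 \<le> j \<and> j < b))) \<le> \<rho>" using \<rho> by simp
  qed
  finally show ?thesis by simp
qed

section \<open>Class sizes as a Polya urn\<close>

text \<open>Subtrees of nodes below \<open>B\<close> may be nested, whereas the classes of distinct
  \<open>k < B\<close> are disjoint. From time \<open>B\<close> on they grow like the colours of a
  Polya urn, each from a single element.\<close>

definition class_size :: "nat \<Rightarrow> nat \<Rightarrow> (nat \<Rightarrow> nat) \<Rightarrow> nat \<Rightarrow> nat" where
  "class_size B n p k = card {j. j < n \<and> last_below p B j = k}"

text \<open>The weight behaves like \<open>S powr (-1/2)\<close>, but is chosen so that the expected product over disjoint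
  classes can be computed exactly. It provides the negative moments that rule out small classes.\<close>

definition urn_weight :: "nat \<Rightarrow> real" where
  "urn_weight S = (\<Prod>i\<in>{1..<S}. 1 - 1 / (2 * real i))"

lemma urn_weight_Suc: "1 \<le> S \<Longrightarrow> urn_weight (Suc S) = (1 - 1 / (2 * real S)) * urn_weight S"
  by (simp add: urn_weight_def)

lemma urn_weight_nonneg: "0 \<le> urn_weight S"
  unfolding urn_weight_def by (intro prod_nonneg) (auto simp: field_simps)

text \<open>The square of the weight dominates a telescoping product, by
  \<open>1 - 1 / i \<le> (1 - 1 / (2 * i))\<^sup>2\<close>.\<close>

lemma urn_weight_ge:
  assumes "1 \<le> S" shows "1 / (2 * sqrt (real S)) \<le> urn_weight S"
proof -
  \<comment> \<open>The telescoping factor vanishes at \<open>i = 1\<close>, so the induction starts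
    from two elements, where the weight is 1/2.\<close>
  have ge: "1 / (4 * real (m + 1)) \<le> (urn_weight (m + 2))\<^sup>2" for m
  proof (induction m)
    case 0 then show ?case by (simp add: urn_weight_def power2_eq_square numeral_2_eq_2)
  next
    case (Suc m)
    have "1 - 1 / real (m + 2) = real (m + 1) / real (m + 2)" by (simp add: field_simps)
    moreover have "y / z * (1 / (4 * y)) = 1 / (4 * z)" if "y \<noteq> 0" for y z :: real using that by simp
    ultimately have "1 / (4 * real (Suc m + 1)) = (1 - 1 / real (m + 2)) * (1 / (4 * real (m + 1)))"
      by (simp only: of_nat_eq_0_iff) simp
    also have "\<dots> \<le> (1 - 1 / (2 * real (m + 2)))\<^sup>2 * (urn_weight (m + 2))\<^sup>2"
    proof (rule mult_mono)
      have "1 - 1 / x \<le> (1 - 1 / (2 * x))\<^sup>2" for x :: real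
        by (simp add: power2_diff)
      then show "1 - 1 / real (m + 2) \<le> (1 - 1 / (2 * real (m + 2)))\<^sup>2" .
    qed (use Suc.IH in auto)
    also have "\<dots> = (urn_weight (Suc m + 2))\<^sup>2"
      using urn_weight_Suc[of "m + 2"] by (simp add: power_mult_distrib)
    finally show ?case .
  qed
  show ?thesis
  proof (cases "S = 1")
    case True then show ?thesis by (simp add: urn_weight_def)
  next
    case False
    have "(1 / (2 * sqrt (real S)))\<^sup>2 = 1 / (4 * real S)" by (simp add: power_mult_distrib power_divide)
    also have "\<dots> \<le> 1 / (4 * real (S - 2 + 1))" using assms False by (intro divide_left_mono) auto
    also have "\<dots> \<le> (urn_weight S)\<^sup>2"
    proof -
      have "S - 2 + 2 = S" using assms False by simp
      then show ?thesis using ge[of "S - 2"] by (simp only:)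
    qed
    finally show ?thesis by (rule power2_le_imp_le) (rule urn_weight_nonneg)
  qed
qed

lemma class_size_start: "k < B \<Longrightarrow> class_size B B p k = 1"
proof -
  assume "k < B"
  then have "{j. j < B \<and> last_below p B j = k} = {k}" by (auto simp: last_below_less)
  then show ?thesis by (simp add: class_size_def)
qed

lemma class_size_pos: "k < B \<Longrightarrow> B \<le> n \<Longrightarrow> 1 \<le> class_size B n p k"
proof -
  assume "k < B" "B \<le> n"
  then have "{k} \<subseteq> {j. j < n \<and> last_below p B j = k}" by (auto simp: last_below_less)
  from card_mono[OF _ this] show ?thesis by (simp add: class_size_def)
qed

lemma class_size_upd:
  assumes "B \<le> n" "j < n"
  shows "class_size B (Suc n) (p(n := j)) k = class_size B n p k + of_bool (last_below p B j = k)"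
proof -
  have lb: "last_below (p(n := j)) B i = last_below p B i" if "i < n" for i
    using that by (intro last_below_cong) auto
  have n: "last_below (p(n := j)) B n = last_below p B j"
    using assms lb[of j] by (simp add: last_below_step del: fun_upd_apply) (simp add: last_below_step)
  have "{i. i < Suc n \<and> last_below (p(n := j)) B i = k} =
     {i. i < n \<and> last_below p B i = k} \<union> (if last_below p B j = k then {n} else {})"
    using lb n by (auto simp: less_Suc_eq simp del: fun_upd_apply)
  then show ?thesis by (auto simp: class_size_def card_insert_if)
qed

text \<open>The root belongs to class 0, so all members of a class \<open>k \<ge> 1\<close> have
  weight one.\<close>

lemma class_size_weight:
  assumes "1 \<le> k" "1 \<le> n" "1 \<le> B"
  shows "(\<Sum>j<n. hoppe_weight \<theta> n j * of_bool (last_below p B j = k)) = real (class_size B n p k) / (\<theta> + real n - 1)"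
proof -
  have "(\<Sum>j<n. hoppe_weight \<theta> n j * of_bool (last_below p B j = k)) =
     (\<Sum>j\<in>{j. j < n \<and> last_below p B j = k}. 1 / (\<theta> + real n - 1))"
  proof (rule sum.mono_neutral_cong_right)
    fix j assume j: "j \<in> {j. j < n \<and> last_below p B j = k}"
    then have "j \<noteq> 0" using assms last_below_less[of 0 B p] by (intro notI) auto
    then show "hoppe_weight \<theta> n j * of_bool (last_below p B j = k) = 1 / (\<theta> + real n - 1)"
      using j by (simp add: hoppe_weight_def)
  qed auto
  then show ?thesis by (simp add: class_size_def)
qed

text \<open>A new node joins a class of size \<open>c\<close> with probability \<open>c / W\<close>
  and then costs it the fraction \<open>1 / (2 * c)\<close> of its weight. The size cancels: the
  mean loss is \<open>1 / (2 * W)\<close> in every state. Since classes are disjoint, only one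
  factor changes at a time and the losses over \<open>R\<close> add up.\<close>

lemma hoppe_exp_urn:
  assumes \<theta>: "0 < \<theta>" and B: "1 \<le> B" and R: "R \<subseteq> {1..<B}" and n: "B \<le> n"
  shows "hoppe_exp \<theta> n (\<lambda>p. \<Prod>k\<in>R. urn_weight (class_size B n p k)) =
    (\<Prod>i\<in>{B..<n}. 1 - real (card R) / (2 * (\<theta> + real i - 1)))"
  using n
proof (induction n rule: dec_induct)
  case base
  have "hoppe_exp \<theta> B (\<lambda>p. \<Prod>k\<in>R. urn_weight (class_size B B p k)) = hoppe_exp \<theta> B (\<lambda>p. 1)"
    using R by (intro hoppe_exp_cong prod.neutral) (auto simp: class_size_start urn_weight_def)
  then show ?case using \<theta> by (simp add: hoppe_exp_const)
next
  case (step n)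
  have n1: "1 \<le> n" using B step by simp
  have finR: "finite R" using R finite_subset by blast
  let ?c = "\<lambda>p k. class_size B n p k"
  have "(\<Sum>j<n. hoppe_weight \<theta> n j *\<^sub>R (\<Prod>k\<in>R. urn_weight (class_size B (Suc n) (p(n := j)) k))) =
     (1 - real (card R) / (2 * (\<theta> + real n - 1))) * (\<Prod>k\<in>R. urn_weight (?c p k))" for p
  proof -
    have c1: "1 \<le> ?c p k" if "k \<in> R" for k using that R step by (intro class_size_pos) auto
    have prod: "(\<Prod>k\<in>R. urn_weight (class_size B (Suc n) (p(n := j)) k)) =
       (\<Prod>k\<in>R. urn_weight (?c p k)) * (1 - (\<Sum>k\<in>R. of_bool (last_below p B j = k) * (1 / (2 * real (?c p k)))))" if j: "j < n" for j
    proof -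
      have "(\<Prod>k\<in>R. urn_weight (class_size B (Suc n) (p(n := j)) k)) =
        (\<Prod>k\<in>R. urn_weight (?c p k) * (if k = last_below p B j then 1 - 1 / (2 * real (?c p k)) else 1))"
        using c1 j step by (intro prod.cong refl) (auto simp: class_size_upd urn_weight_Suc mult_ac simp del: fun_upd_apply)
      also have "\<dots> = (\<Prod>k\<in>R. urn_weight (?c p k)) * (if last_below p B j \<in> R then 1 - 1 / (2 * real (?c p (last_below p B j))) else 1)"
        using finR by (simp add: prod.distrib prod.delta)
      also have "(if last_below p B j \<in> R then 1 - 1 / (2 * real (?c p (last_below p B j))) else 1) =
         1 - (\<Sum>k\<in>R. if k = last_below p B j then 1 / (2 * real (?c p k)) else 0)"
        using finR by (simp add: sum.delta)
      also have "(\<Sum>k\<in>R. if k = last_below p B j then 1 / (2 * real (?c p k)) else 0) = (\<Sum>k\<in>R. of_bool (last_below p B j = k) * (1 / (2 * real (?c p k))))"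
        by (intro sum.cong) auto
      finally show ?thesis .
    qed
    then have "(\<Sum>j<n. hoppe_weight \<theta> n j *\<^sub>R (\<Prod>k\<in>R. urn_weight (class_size B (Suc n) (p(n := j)) k))) =
      (\<Sum>j<n. (\<Prod>k\<in>R. urn_weight (?c p k)) * (hoppe_weight \<theta> n j - (\<Sum>k\<in>R. hoppe_weight \<theta> n j * of_bool (last_below p B j = k) * (1 / (2 * real (?c p k))))))"
    proof (intro sum.cong refl)
      fix j assume "j \<in> {..<n}"
      have "(\<Sum>k\<in>R. hoppe_weight \<theta> n j * of_bool (last_below p B j = k) * (1 / (2 * real (?c p k)))) =
        hoppe_weight \<theta> n j * (\<Sum>k\<in>R. of_bool (last_below p B j = k) * (1 / (2 * real (?c p k))))"
        by (simp only: sum_distrib_left mult.assoc)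
      then show "hoppe_weight \<theta> n j *\<^sub>R (\<Prod>k\<in>R. urn_weight (class_size B (Suc n) (p(n := j)) k)) =
         (\<Prod>k\<in>R. urn_weight (?c p k)) * (hoppe_weight \<theta> n j - (\<Sum>k\<in>R. hoppe_weight \<theta> n j * of_bool (last_below p B j = k) * (1 / (2 * real (?c p k)))))"
        using prod[of j] \<open>j \<in> {..<n}\<close> by (simp only: lessThan_iff real_scaleR_def) (simp only: right_diff_distrib mult_1_right mult_ac)
    qed
    also have "\<dots> = (\<Prod>k\<in>R. urn_weight (?c p k)) * ((\<Sum>j<n. hoppe_weight \<theta> n j) - (\<Sum>k\<in>R. \<Sum>j<n. hoppe_weight \<theta> n j * of_bool (last_below p B j = k) * (1 / (2 * real (?c p k)))))"
      unfolding sum_distrib_left[symmetric] sum_subtractf by (subst sum.swap) simp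
    also have "(\<Sum>k\<in>R. \<Sum>j<n. hoppe_weight \<theta> n j * of_bool (last_below p B j = k) * (1 / (2 * real (?c p k)))) =
       (\<Sum>k\<in>R. 1 / (2 * (\<theta> + real n - 1)))"
    proof (rule sum.cong[OF refl])
      fix k assume k: "k \<in> R"
      show "(\<Sum>j<n. hoppe_weight \<theta> n j * of_bool (last_below p B j = k) * (1 / (2 * real (?c p k)))) = 1 / (2 * (\<theta> + real n - 1))"
        unfolding sum_distrib_right[symmetric] using c1[OF k] k R class_size_weight[of k n B \<theta> p] n1 B by auto
    qed
    finally show ?thesis using sum_hoppe_weight[OF \<theta> n1] by (simp add: mult.commute del: fun_upd_apply)
  qed
  then have "hoppe_exp \<theta> (Suc n) (\<lambda>p. \<Prod>k\<in>R. urn_weight (class_size B (Suc n) p k)) =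
     (1 - real (card R) / (2 * (\<theta> + real n - 1))) * hoppe_exp \<theta> n (\<lambda>p. \<Prod>k\<in>R. urn_weight (?c p k))"
    unfolding hoppe_exp_Suc[OF n1] by (simp only: hoppe_exp_cmult)
  then show ?case using step by (simp add: prod.atLeastLessThan_Suc mult.commute)
qed

text \<open>The right-hand side is chosen so that products over consecutive total weights
  telescope.\<close>

lemma one_minus_half_le_sqrt:
  assumes "0 < (W::real)" shows "1 - 1 / (2 * W) \<le> sqrt (W / (W + 1))"
proof (cases "W \<le> 1 / 2")
  case True
  then have "1 - 1 / (2 * W) \<le> 0" using assms by (simp add: field_simps)
  also have "0 \<le> sqrt (W / (W + 1))" using assms by simp
  finally show ?thesis .
next
  case False
  have "(1 - 1 / (2 * W))\<^sup>2 \<le> W / (W + 1)"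
  proof -
    have "(1 - 1 / (2 * W))\<^sup>2 = (4 * W * W - 4 * W + 1) / (4 * W * W)"
      using assms by (simp add: power2_eq_square field_simps)
    also have "\<dots> \<le> W / (W + 1)"
      using assms False by (simp add: divide_simps) (simp add: algebra_simps)
    finally show ?thesis .
  qed
  then show ?thesis by (rule real_le_rsqrt)
qed

text \<open>Bernoulli's inequality splits the joint factor into one factor for each class; these
  then telescope over time.\<close>

lemma hoppe_exp_urn_le:
  assumes \<theta>: "0 < \<theta>" and B: "1 \<le> B" and R: "R \<subseteq> {1..<B}" and n: "B \<le> n"
  shows "hoppe_exp \<theta> n (\<lambda>p. \<Prod>k\<in>R. urn_weight (class_size B n p k)) \<le>
    sqrt ((\<theta> + real B - 1) / (\<theta> + real n - 1)) ^ card R"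
proof -
  let ?W = "\<lambda>i. \<theta> + real i - 1"
  have cR: "card R \<le> B - 1" using card_mono[OF _ R] by simp
  have "(\<Prod>i\<in>{B..<n}. 1 - real (card R) / (2 * ?W i)) \<le> (\<Prod>i\<in>{B..<n}. sqrt (?W i / ?W (Suc i)) ^ card R)"
  proof (rule prod_mono, intro conjI)
    fix i assume i: "i \<in> {B..<n}"
    have W: "0 < ?W i" "real (card R) \<le> ?W i" "1 \<le> real i" using i B cR \<theta> by auto
    then show "0 \<le> 1 - real (card R) / (2 * ?W i)" by simp
    \<comment> \<open>Bernoulli's inequality asks for \<open>1 / (2 * W) \<le> 1\<close>, which a
      nonempty \<open>R\<close> provides through \<open>card R \<le> W\<close>.\<close>
    have "- 1 \<le> - (1 / (2 * ?W i)) \<or> card R = 0"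
    proof (cases "card R = 0")
      case False
      then have "1 \<le> ?W i" using W by linarith
      then show ?thesis by simp
    qed simp
    then have "1 - real (card R) / (2 * ?W i) \<le> (1 - 1 / (2 * ?W i)) ^ card R"
      using Bernoulli_inequality[of "- (1 / (2 * ?W i))" "card R"] by auto
    also have "\<dots> \<le> sqrt (?W i / ?W (Suc i)) ^ card R"
    proof (cases "card R = 0")
      case False
      then have "1 \<le> ?W i" using W by linarith
      then show ?thesis using one_minus_half_le_sqrt[of "?W i"] by (intro power_mono) (auto simp: algebra_simps)
    qed simp
    finally show "1 - real (card R) / (2 * ?W i) \<le> sqrt (?W i / ?W (Suc i)) ^ card R" .
  qed
  also have "\<dots> = sqrt (?W B / ?W n) ^ card R"
    using n
  proof (induction n rule: dec_induct)
    case base then show ?case using \<theta> B by simp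
  next
    case (step m)
    then show ?case using \<theta> B
      by (simp add: prod.atLeastLessThan_Suc power_mult_distrib[symmetric] real_sqrt_mult[symmetric])
  qed
  finally show ?thesis unfolding hoppe_exp_urn[OF assms] .
qed

text \<open>Markov's inequality for a negative moment: a class of size at most \<open>x\<close> has
  \<open>urn_weight\<close> at least \<open>1 / (2 * sqrt x)\<close>, so its indicator is at most
  \<open>2 * sqrt x\<close> times that weight.\<close>

lemma hoppe_exp_small_class:
  assumes \<theta>: "0 < \<theta>" and B: "1 \<le> B" and R: "R \<subseteq> {1..<B}" and n: "B \<le> n" and x: "0 \<le> x"
    and \<rho>: "2 * sqrt x * sqrt ((\<theta> + real B - 1) / (\<theta> + real n - 1)) \<le> \<rho>"
  shows "hoppe_exp \<theta> n (\<lambda>p. \<Prod>k\<in>R. of_bool (real (class_size B n p k) \<le> x)) \<le> \<rho> ^ card R"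
proof -
  have "hoppe_exp \<theta> n (\<lambda>p. \<Prod>k\<in>R. of_bool (real (class_size B n p k) \<le> x)) \<le>
    hoppe_exp \<theta> n (\<lambda>p. (2 * sqrt x) ^ card R * (\<Prod>k\<in>R. urn_weight (class_size B n p k)))"
  proof (rule hoppe_exp_mono[OF \<theta>])
    fix p
    have "(\<Prod>k\<in>R. of_bool (real (class_size B n p k) \<le> x)) \<le> (\<Prod>k\<in>R. 2 * sqrt x * urn_weight (class_size B n p k))"
    proof (rule prod_mono, intro conjI)
      fix k assume k: "k \<in> R"
      show "of_bool (real (class_size B n p k) \<le> x) \<le> 2 * sqrt x * urn_weight (class_size B n p k)"
      proof (cases "real (class_size B n p k) \<le> x")
        case True
        have c: "1 \<le> class_size B n p k" using k R n by (intro class_size_pos) auto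
        have "1 = 2 * sqrt (real (class_size B n p k)) * (1 / (2 * sqrt (real (class_size B n p k))))"
          using c by simp
        also have "\<dots> \<le> 2 * sqrt x * urn_weight (class_size B n p k)"
          using c True x by (intro mult_mono urn_weight_ge) auto
        finally show ?thesis using True by simp
      qed (use x urn_weight_nonneg in simp)
    qed simp
    then show "(\<Prod>k\<in>R. of_bool (real (class_size B n p k) \<le> x)) \<le> (2 * sqrt x) ^ card R * (\<Prod>k\<in>R. urn_weight (class_size B n p k))"
      by (simp add: prod.distrib)
  qed
  also have "\<dots> \<le> (2 * sqrt x) ^ card R * sqrt ((\<theta> + real B - 1) / (\<theta> + real n - 1)) ^ card R"
    unfolding hoppe_exp_cmult using x by (intro mult_left_mono hoppe_exp_urn_le assms) auto
  also have "\<dots> \<le> \<rho> ^ card R"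
    unfolding power_mult_distrib[symmetric] using \<theta> B n x by (intro power_mono \<rho>) auto
  finally show ?thesis .
qed

section \<open>Subtrees of the sources\<close>

lemma class_size_le_subtree_size:
  assumes "k < B" shows "class_size B n p k \<le> subtree_size p n k"
proof -
  have "last_below p (Suc k) j = k" if "last_below p B j = k" for j
    using last_below_last_below[of "Suc k" B p j] that assms by (simp add: last_below_less)
  then show ?thesis unfolding class_size_def subtree_size_def by (intro card_mono) auto
qed

text \<open>Subtrees of sources are disjoint: if \<open>k < k'\<close> were ancestors of a common
  node, then \<open>k\<close> would be an ancestor of \<open>k'\<close>, but the parent of
  \<open>k'\<close> already lies below \<open>b \<le> k\<close>.\<close>

lemma sum_subtree_size_le:
  assumes Q: "finite Q" "Q \<subseteq> {b..}"
  shows "(\<Sum>k\<in>attached_below b Q p. subtree_size p n k) \<le> n"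
proof -
  let ?S = "\<lambda>k. {j. j < n \<and> last_below p (Suc k) j = k}"
  let ?A = "attached_below b Q p"
  have disj: "?S k \<inter> ?S k' = {}" if "k \<in> ?A" "k' \<in> ?A" "k < k'" for k k'
  proof (rule ccontr)
    assume "?S k \<inter> ?S k' \<noteq> {}"
    then obtain j where j: "last_below p (Suc k) j = k" "last_below p (Suc k') j = k'" by auto
    have *: "p k' < b" "b \<le> k" using that Q by (auto simp: attached_below_def)
    have "k = last_below p (Suc k) k'"
      using last_below_last_below[of "Suc k" "Suc k'" p j] j that by simp
    also have "\<dots> = p k'" using * that by (simp add: last_below_step last_below_less)
    finally show False using * by simp
  qed
  have "(\<Sum>k\<in>?A. card (?S k)) = card (\<Union>k\<in>?A. ?S k)"
  proof (rule card_UN_disjoint[symmetric])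
    show "finite ?A" using Q by (simp add: attached_below_def)
    show "\<forall>i\<in>?A. \<forall>j\<in>?A. i \<noteq> j \<longrightarrow> ?S i \<inter> ?S j = {}"
    proof (intro ballI impI)
      fix i j assume ij: "i \<in> ?A" "j \<in> ?A" "i \<noteq> j"
      then consider "i < j" | "j < i" by linarith
      then show "?S i \<inter> ?S j = {}"
      proof cases
        case 1 then show ?thesis by (rule disj[OF ij(1,2)])
      next
        case 2 then show ?thesis by (subst Int_commute) (rule disj[OF ij(2,1)])
      qed
    qed
  qed simp
  also have "\<dots> \<le> card {..<n}" by (intro card_mono) auto
  finally show ?thesis by (simp add: subtree_size_def)
qed

text \<open>Disjoint subtrees have total size at most \<open>n\<close>, so fewer than
  \<open>a\<close> of them exceed \<open>n / a\<close>. This limits the number of large phases for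
  every tree, without probability.\<close>

lemma card_large_subtrees:
  assumes Q: "finite Q" "Q \<subseteq> {b..}" and a: "1 \<le> a"
  shows "card {k \<in> attached_below b Q p. n < a * subtree_size p n k} < a"
proof -
  let ?A = "attached_below b Q p" let ?L = "{k \<in> ?A. n < a * subtree_size p n k}"
  have fin: "finite ?A" using Q by (simp add: attached_below_def)
  show ?thesis
  proof (cases "?L = {}")
    case False
    have "card ?L * n = (\<Sum>k\<in>?L. n)" by simp
    also have "\<dots> < (\<Sum>k\<in>?L. a * subtree_size p n k)" using fin False by (intro sum_strict_mono) auto
    also have "\<dots> \<le> (\<Sum>k\<in>?A. a * subtree_size p n k)" using fin by (intro sum_mono2) auto
    also have "\<dots> \<le> a * n" using sum_subtree_size_le[OF Q] by (simp add: sum_distrib_left[symmetric])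
    finally show ?thesis by simp
  next
    case True
    then show ?thesis unfolding True using a by simp
  qed
qed

text \<open>With \<open>b = 80 * a\<close>, \<open>B = 84 * a\<close> and \<open>real a \<le> t\<close>, a source whose class has more than
  \<open>n / (80000 * a)\<close> nodes satisfies \<open>t * S / (2 * n) \<ge> 1 / 160000\<close>, and the paired nodes make up at
  least a tenth of \<open>{1..<b}\<close>.\<close>

definition decay_base :: real where
  "decay_base = 1 - (1 - cos (1 / 160000)) / 10"

lemma decay_base: "9 / 10 \<le> decay_base" "decay_base < 1"
proof -
  have "cos (1 / 160000 :: real) < cos 0" using pi_gt3 by (intro cos_monotone_0_pi) auto
  moreover have "0 \<le> cos (1 / 160000 :: real)" using pi_gt3 by (intro cos_ge_zero) auto
  ultimately show "9 / 10 \<le> decay_base" "decay_base < 1" by (auto simp: decay_base_def)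
qed

section \<open>The bound at a fixed frequency\<close>

text \<open>Of the \<open>4 * a\<close> window nodes, fewer than \<open>a\<close> are lost to each
  of three defects: a parent outside \<open>{1..<80 * a}\<close>, a small class, a large subtree. At
  least \<open>a\<close> sources remain with a factor at most \<open>decay_base\<close>; the other
  factors are at most 1.\<close>

lemma prod_depth_char_le:
  assumes a: "1 \<le> a" and n: "84 * a \<le> n" and t: "real a \<le> t" "t \<le> 2 * real a"
    and V: "4 * a \<le> card (matched (64 * a) (80 * a) p)"
    and att: "card {k \<in> {80 * a..<84 * a}. \<not> (1 \<le> p k \<and> p k < 80 * a)} < a"
    and cls: "card {k \<in> {80 * a..<84 * a}. real (class_size (84 * a) n p k) \<le> real n / (80000 * real a)} < a"
  shows "(\<Prod>k\<in>attached_below (80 * a) {80 * a..<84 * a} p. cmod (depth_char (80 * a) p (t / real n * real (subtree_size p n k))))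
     \<le> decay_base ^ a"
proof -
  let ?Q = "{80 * a..<84 * a}" let ?A = "attached_below (80 * a) ?Q p"
  let ?S = "subtree_size p n"
  define G where "G = {k \<in> ?A. real (class_size (84 * a) n p k) > real n / (80000 * real a) \<and> \<not> n < a * ?S k}"
  have fin: "finite ?A" "finite G" by (auto simp: attached_below_def G_def)
  have n0: "0 < real n" "0 < real a" using a n by auto
  have "?Q \<subseteq> G \<union> {k \<in> ?Q. \<not> (1 \<le> p k \<and> p k < 80 * a)} \<union> {k \<in> ?Q. real (class_size (84 * a) n p k) \<le> real n / (80000 * real a)}
     \<union> {k \<in> ?A. n < a * ?S k}"
    by (auto simp: G_def attached_below_def)
  then have "card ?Q \<le> card (G \<union> {k \<in> ?Q. \<not> (1 \<le> p k \<and> p k < 80 * a)} \<union> {k \<in> ?Q. real (class_size (84 * a) n p k) \<le> real n / (80000 * real a)}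
     \<union> {k \<in> ?A. n < a * ?S k})"
    using fin by (intro card_mono) auto
  also have "\<dots> \<le> card G + card {k \<in> ?Q. \<not> (1 \<le> p k \<and> p k < 80 * a)} + card {k \<in> ?Q. real (class_size (84 * a) n p k) \<le> real n / (80000 * real a)}
     + card {k \<in> ?A. n < a * ?S k}"
    by (intro order_trans[OF card_Un_le] add_mono order_refl)
  finally have cQ: "card ?Q \<le> card G + card {k \<in> ?Q. \<not> (1 \<le> p k \<and> p k < 80 * a)} + card {k \<in> ?Q. real (class_size (84 * a) n p k) \<le> real n / (80000 * real a)}
     + card {k \<in> ?A. n < a * ?S k}" .
  then have cG: "a \<le> card G"
  proof -
    have Q80: "?Q \<subseteq> {80 * a..}" and "card ?Q = 4 * a" by auto
    then show ?thesis
      using att cls card_large_subtrees[OF finite_atLeastLessThan Q80 a, of p n] cQ by linarith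
  qed
  \<comment> \<open>The fraction is at least \<open>8 * a / (80 * a)\<close>.\<close>
  have frac: "1 / 10 \<le> 2 * real (card (matched (64 * a) (80 * a) p)) / real (80 * a - 1)"
    using V a by (subst pos_le_divide_eq) (auto simp: of_nat_diff)
  have dc: "cmod (depth_char (80 * a) p y) \<le> 1 - 2 * real (card (matched (64 * a) (80 * a) p)) / real (80 * a - 1) * (1 - \<bar>cos (y / 2)\<bar>)" for y
    using a by (intro norm_depth_char_le) auto
  have good: "cmod (depth_char (80 * a) p (t / real n * real (?S k))) \<le> decay_base" if k: "k \<in> G" for k
  proof -
    let ?x = "t / real n * real (?S k) / 2"
    have "real (?S k) > real n / (80000 * real a)"
      using k class_size_le_subtree_size[of k "84 * a" n p] by (auto simp: G_def attached_below_def)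
    then have "real a / real n * (real n / (80000 * real a)) / 2 \<le> ?x"
      using t n0 by (intro divide_right_mono mult_mono) auto
    then have x1: "1 / 160000 \<le> ?x" using n0 by simp
    \<comment> \<open>The upper bound on the size keeps half the phase in the range where the cosine
      is nonnegative and decreasing; a larger phase might be close to a multiple of the period and
      give no gain.\<close>
    have "real (?S k) \<le> real n / real a"
      using k n0 by (simp add: G_def field_simps not_less of_nat_mult[symmetric] del: of_nat_mult)
    then have "?x \<le> (2 * real a) / real n * (real n / real a) / 2"
      using t n0 by (intro divide_right_mono mult_mono) auto
    then have x2: "?x \<le> 1" using n0 by simp
    have "cos ?x \<le> cos (1 / 160000)" using x1 x2 pi_gt3 by (intro cos_monotone_0_pi_le) auto
    moreover have "0 \<le> cos ?x" using x1 x2 pi_gt3 by (intro cos_ge_zero) auto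
    ultimately have c: "1 - cos (1 / 160000) \<le> 1 - \<bar>cos ?x\<bar>" by simp
    have "1 / 10 * (1 - cos (1 / 160000)) \<le> 2 * real (card (matched (64 * a) (80 * a) p)) / real (80 * a - 1) * (1 - \<bar>cos ?x\<bar>)"
      by (rule mult_mono[OF frac c]) auto
    from order_trans[OF dc[of "t / real n * real (?S k)"] diff_left_mono[OF this, of 1]]
    show ?thesis by (simp add: decay_base_def)
  qed
  have le1: "cmod (depth_char (80 * a) p y) \<le> 1" for y
  proof -
    have "0 \<le> 2 * real (card (matched (64 * a) (80 * a) p)) / real (80 * a - 1) * (1 - \<bar>cos (y / 2)\<bar>)"
      using abs_cos_le_one[of "y / 2"] by (intro mult_nonneg_nonneg) auto
    from order_trans[OF dc[of y] diff_left_mono[OF this, of 1]] show ?thesis by simp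
  qed
  have "(\<Prod>k\<in>?A. cmod (depth_char (80 * a) p (t / real n * real (?S k)))) \<le> (\<Prod>k\<in>?A. if k \<in> G then decay_base else 1)"
    using good le1 by (intro prod_mono) auto
  also have "\<dots> = decay_base ^ card G"
    using fin by (simp add: prod.If_cases G_def Int_def conj_commute conj_left_commute)
  also have "\<dots> \<le> decay_base ^ a"
    using cG decay_base by (intro power_decreasing) auto
  finally show ?thesis .
qed

lemma hoppe_exp_char_le:
  assumes \<theta>: "0 < \<theta>" and a: "\<theta> + 2 \<le> real a" and n: "84 * a \<le> n" and t: "real a \<le> t" "t \<le> 2 * real a"
  shows "cmod (hoppe_exp \<theta> n (\<lambda>p. iexp (t / real n * real (internal_path_length p n)))) \<le> 4 * decay_base ^ a"
proof -
  let ?Q = "{80 * a..<84 * a}"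
  let ?E1 = "\<lambda>p. card (matched (64 * a) (80 * a) p) < 4 * a"
  let ?E2 = "\<lambda>p. a \<le> card {k \<in> ?Q. \<not> (1 \<le> p k \<and> p k < 80 * a)}"
  let ?E3 = "\<lambda>p. a \<le> card {k \<in> ?Q. real (class_size (84 * a) n p k) \<le> real n / (80000 * real a)}"
  let ?P = "\<lambda>p. \<Prod>k\<in>attached_below (80 * a) ?Q p. cmod (depth_char (80 * a) p (t / real n * real (subtree_size p n k)))"
  have a1: "1 \<le> a" using a \<theta> by linarith
  have b2: "2 \<le> 80 * a" using a1 by simp
  have P1: "?P p \<le> 1" for p
  proof (rule prod_le_1, intro conjI)
    fix k
    \<comment> \<open>With \<open>K = b\<close> nothing is matched, and the general estimate
      degenerates to the trivial bound 1.\<close>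
    have "cmod (depth_char (80 * a) p y) \<le> 1 - 2 * real (card (matched (80 * a) (80 * a) p)) / real (80 * a - 1) * (1 - \<bar>cos (y / 2)\<bar>)" for y
      using a1 by (intro norm_depth_char_le) auto
    then show "cmod (depth_char (80 * a) p (t / real n * real (subtree_size p n k))) \<le> 1"
      by (simp add: matched_def)
  qed simp
  have "?P p \<le> of_bool (?E1 p) + of_bool (?E2 p) + of_bool (?E3 p) + decay_base ^ a" for p
  proof (cases "?E1 p \<or> ?E2 p \<or> ?E3 p")
    case True
    have "(0::real) \<le> decay_base ^ a" using decay_base by simp
    then show ?thesis using P1[of p] True by (auto simp: of_bool_def split: if_splits)
  next
    case False
    then show ?thesis using prod_depth_char_le[OF a1 n t, of p] by (auto simp: not_less not_le)
  qed
  then have "hoppe_exp \<theta> n ?P \<le> hoppe_exp \<theta> n (\<lambda>p. of_bool (?E1 p) + of_bool (?E2 p) + of_bool (?E3 p) + decay_base ^ a)"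
    by (intro hoppe_exp_mono[OF \<theta>])
  also have "\<dots> = hoppe_exp \<theta> n (\<lambda>p. of_bool (?E1 p)) + hoppe_exp \<theta> n (\<lambda>p. of_bool (?E2 p)) + hoppe_exp \<theta> n (\<lambda>p. of_bool (?E3 p)) + decay_base ^ a"
    by (simp only: hoppe_exp_add hoppe_exp_const[OF \<theta>])
  also have "\<dots> \<le> decay_base ^ a + decay_base ^ a + decay_base ^ a + decay_base ^ a"
  proof (intro add_mono order_refl)
    \<comment> \<open>Few pairs: Markov's inequality for a power of 1/2. The event concerns the
      first \<open>80 * a\<close> nodes only, and \<open>J = 16 * a\<close> yields the cut at
      \<open>64 * a\<close>. The numerical input is
      \<open>2 ^ 4 * (3 / 4) ^ 16 < 9 / 10\<close>.\<close>
    have "hoppe_exp \<theta> n (\<lambda>p. of_bool (?E1 p)) \<le> hoppe_exp \<theta> n (\<lambda>p. 2 ^ (4 * a) * (1 / 2) ^ card (matched (64 * a) (80 * a) p) :: real)"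
    proof (rule hoppe_exp_mono[OF \<theta>])
      fix p
      show "of_bool (?E1 p) \<le> (2 ^ (4 * a) * (1 / 2) ^ card (matched (64 * a) (80 * a) p) :: real)"
      proof (cases "?E1 p")
        case True
        then have "(2::real) ^ card (matched (64 * a) (80 * a) p) \<le> 2 ^ (4 * a)" by (intro power_increasing) auto
        then show ?thesis using True by (simp add: power_divide)
      qed simp
    qed
    also have "\<dots> = 2 ^ (4 * a) * hoppe_exp \<theta> (80 * a) (\<lambda>p. (1 / 2) ^ card (matched (64 * a) (80 * a) p) :: real)"
    proof -
      have "hoppe_exp \<theta> n (\<lambda>p. (1 / 2) ^ card (matched (64 * a) (80 * a) p) :: real) = hoppe_exp \<theta> (80 * a) (\<lambda>p. (1 / 2) ^ card (matched (64 * a) (80 * a) p))"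
      proof (rule hoppe_exp_restrict[OF \<theta>])
        fix p q :: "nat \<Rightarrow> nat" assume "\<And>k. k < 80 * a \<Longrightarrow> p k = q k"
        then have "matched (64 * a) (80 * a) p = matched (64 * a) (80 * a) q"
          unfolding matched_def by (intro arg_cong2[where f="(\<inter>)"] image_cong) auto
        then show "(1 / 2 :: real) ^ card (matched (64 * a) (80 * a) p) = (1 / 2) ^ card (matched (64 * a) (80 * a) q)" by simp
      qed (use n in simp)
      then show ?thesis by (simp only: hoppe_exp_cmult)
    qed
    also have "\<dots> \<le> 2 ^ (4 * a) * (3 / 4) ^ (16 * a)"
      using hoppe_exp_matched[OF \<theta>, of "16 * a" "16 * a"] a by (intro mult_left_mono) auto
    also have "\<dots> = (2 ^ 4 * (3 / 4) ^ 16) ^ a"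
      unfolding power_mult power_mult_distrib ..
    also have "\<dots> \<le> decay_base ^ a"
      by (intro power_mono order_trans[OF _ decay_base(1)]) (simp_all add: power_divide)
    finally show "hoppe_exp \<theta> n (\<lambda>p. of_bool (?E1 p)) \<le> decay_base ^ a" .
  next
    \<comment> \<open>For the other two events the joint probabilities are at most
      \<open>(1 / 10) ^ card R\<close>, which suffices because
      \<open>(11 / 10) ^ 4 / 2 < 9 / 10\<close>.\<close>
    have step: "(1 + 1 / 10 :: real) ^ card ?Q / (2::real) ^ a \<le> decay_base ^ a"
    proof -
      have card_Q: "card ?Q = 4 * a" by simp
      have "(1 + 1 / 10 :: real) ^ card ?Q / (2::real) ^ a = ((1 + 1 / 10) ^ 4 / 2) ^ a"
        by (simp only: power_mult power_divide card_Q)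
      also have "\<dots> \<le> decay_base ^ a"
        by (intro power_mono order_trans[OF _ decay_base(1)]) (simp_all add: power_divide)
      finally show ?thesis .
    qed
    show "hoppe_exp \<theta> n (\<lambda>p. of_bool (?E2 p)) \<le> decay_base ^ a"
    proof (rule order_trans[OF hoppe_exp_count_le[OF \<theta>] step])
      fix R assume "R \<subseteq> ?Q"
      then have "R \<subseteq> {80 * a..<80 * a + 4 * a}" by simp
      then show "hoppe_exp \<theta> n (\<lambda>p. \<Prod>k\<in>R. of_bool (\<not> (1 \<le> p k \<and> p k < 80 * a))) \<le> (1 / 10 :: real) ^ card R"
        using n a \<theta> by (intro hoppe_exp_not_attached[OF \<theta> b2, of "4 * a"]) (auto simp: field_simps)
    qed auto
    show "hoppe_exp \<theta> n (\<lambda>p. of_bool (?E3 p)) \<le> decay_base ^ a"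
    proof (rule order_trans[OF hoppe_exp_count_le[OF \<theta>] step])
      fix R assume "R \<subseteq> ?Q"
      then have R: "R \<subseteq> {1..<84 * a}" using a1 by auto
      have W: "real n / 2 \<le> \<theta> + real n - 1" "0 < \<theta> + real n - 1" using n a1 \<theta> by auto
      let ?x = "real n / (80000 * real a)"
      \<comment> \<open>As \<open>\<theta> + 84 * a - 1 \<le> 85 * a\<close>, the quantity is at
        most \<open>4 * 85 * 2 / 80000 < 1 / 100\<close>; this explains the constant 80000.\<close>
      have "4 * ?x * ((\<theta> + real (84 * a) - 1) / (\<theta> + real n - 1)) \<le> 4 * ?x * ((85 * real a) / (real n / 2))"
        using W a a1 n \<theta> by (intro mult_left_mono frac_le) auto
      also have "\<dots> \<le> 1 / 100" using a1 n by simp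
      finally have "sqrt (4 * ?x * ((\<theta> + real (84 * a) - 1) / (\<theta> + real n - 1))) \<le> sqrt (1 / 100)"
        by (rule real_sqrt_le_mono)
      moreover have "sqrt (1 / 100) = 1 / 10" by (simp add: real_sqrt_divide)
      moreover have "sqrt (4 * ?x * ((\<theta> + real (84 * a) - 1) / (\<theta> + real n - 1))) = 2 * sqrt ?x * sqrt ((\<theta> + real (84 * a) - 1) / (\<theta> + real n - 1))"
        by (simp only: real_sqrt_mult real_sqrt_four)
      ultimately have "2 * sqrt ?x * sqrt ((\<theta> + real (84 * a) - 1) / (\<theta> + real n - 1)) \<le> 1 / 10" by linarith
      then show "hoppe_exp \<theta> n (\<lambda>p. \<Prod>k\<in>R. of_bool (real (class_size (84 * a) n p k) \<le> ?x)) \<le> (1 / 10 :: real) ^ card R"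
        using R a1 n by (intro hoppe_exp_small_class[OF \<theta>]) auto
    qed auto
  qed
  finally have "hoppe_exp \<theta> n ?P \<le> 4 * decay_base ^ a" by simp
  moreover have "cmod (hoppe_exp \<theta> n (\<lambda>p. iexp (t / real n * real (internal_path_length p n)))) \<le> hoppe_exp \<theta> n ?P"
    using n by (intro norm_hoppe_exp_iexp_le[OF \<theta> b2]) auto
  ultimately show ?thesis by (rule order_trans[rotated])
qed

section \<open>Bounded moments\<close>

lemma internal_path_length_Suc_upd:
  "j < n \<Longrightarrow> internal_path_length (p(n := j)) (Suc n) = internal_path_length p n + Suc (hoppe_depth p j)"
  unfolding internal_path_length_def by (simp add: depth_upd_less depth_upd_eq del: fun_upd_apply)

text \<open>The root contributes 0 to both sides. The right-hand side is therefore the conditional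
  mean depth of the next parent.\<close>

lemma sum_weight_depth:
  assumes "1 \<le> n"
  shows "(\<Sum>j<n. hoppe_weight \<theta> n j * real (hoppe_depth p j)) = real (internal_path_length p n) / (\<theta> + real n - 1)"
proof -
  have "hoppe_weight \<theta> n j * real (hoppe_depth p j) = real (hoppe_depth p j) / (\<theta> + real n - 1)" for j
    by (simp add: hoppe_weight_def)
  then show ?thesis by (simp add: internal_path_length_def sum_divide_distrib)
qed

section \<open>Moments of the depth of a random parent\<close>

text \<open>Attaching a child to a node of depth \<open>d\<close> adds \<open>2 * 2 ^ d\<close> to
  the weighted sum of \<open>2 ^ depth\<close>, so the mean of that sum is multiplied by
  \<open>(W + 2) / W\<close>. It grows at most quadratically in \<open>W\<close>, hence linearly
  after normalisation.\<close>

lemma hoppe_exp_two_power_depth: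
  assumes \<theta>: "0 < \<theta>" and n: "1 \<le> n"
  shows "hoppe_exp \<theta> n (\<lambda>p. \<Sum>j<n. hoppe_weight \<theta> n j * 2 ^ hoppe_depth p j) \<le> (\<theta> + real n - 1) / \<theta>"
proof -
  let ?W = "\<lambda>n. \<theta> + real n - 1"
  define S where "S = (\<lambda>n p. \<Sum>j<n. hoppe_weight \<theta> n j * 2 ^ hoppe_depth p j :: real)"
  have S: "?W n * hoppe_exp \<theta> n (S n) \<le> (?W n)\<^sup>2 / \<theta>"
    using n
  proof (induction n rule: dec_induct)
    case base
    have "S 1 = (\<lambda>p. 1)" using \<theta> by (simp add: S_def hoppe_weight_def fun_eq_iff)
    then show ?case using \<theta> by (simp add: hoppe_exp_const power2_eq_square)
  next
    case (step n)
    have W: "0 < ?W n" using \<theta> step by simp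
    have upd: "?W (Suc n) * S (Suc n) (p(n := j)) = ?W n * S n p + 2 * 2 ^ hoppe_depth p j" if "j < n" for p j
    proof -
      have "?W (Suc n) * S (Suc n) (p(n := j)) = (\<Sum>i<n. ?W (Suc n) * hoppe_weight \<theta> (Suc n) i * 2 ^ hoppe_depth p i) + ?W (Suc n) * hoppe_weight \<theta> (Suc n) n * 2 ^ Suc (hoppe_depth p j)"
        using that unfolding S_def by (simp add: depth_upd_less depth_upd_eq sum_distrib_left distrib_left mult.assoc del: fun_upd_apply)
      also have "(\<Sum>i<n. ?W (Suc n) * hoppe_weight \<theta> (Suc n) i * 2 ^ hoppe_depth p i) = ?W n * S n p"
        unfolding S_def sum_distrib_left using W \<theta> by (intro sum.cong) (auto simp: hoppe_weight_def)
      also have "?W (Suc n) * hoppe_weight \<theta> (Suc n) n * 2 ^ Suc (hoppe_depth p j) = 2 * 2 ^ hoppe_depth p j"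
        using W \<theta> step by (simp add: hoppe_weight_def)
      finally show ?thesis .
    qed
    have "(\<Sum>j<n. hoppe_weight \<theta> n j *\<^sub>R (?W (Suc n) * S (Suc n) (p(n := j)))) = (?W n + 2) * S n p" for p
    proof -
      have "(\<Sum>j<n. hoppe_weight \<theta> n j *\<^sub>R (?W (Suc n) * S (Suc n) (p(n := j)))) = (\<Sum>j<n. hoppe_weight \<theta> n j * (?W n * S n p) + 2 * (hoppe_weight \<theta> n j * 2 ^ hoppe_depth p j))"
        by (intro sum.cong refl) (simp only: real_scaleR_def upd lessThan_iff distrib_left mult.left_commute)
      also have "\<dots> = ?W n * S n p + 2 * S n p"
        unfolding sum.distrib sum_distrib_right[symmetric] sum_distrib_left[symmetric] S_def
        using sum_hoppe_weight[OF \<theta>, of n] step by simp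
      finally show ?thesis by (simp only: distrib_right)
    qed
    then have "hoppe_exp \<theta> (Suc n) (\<lambda>p. ?W (Suc n) * S (Suc n) p) = hoppe_exp \<theta> n (\<lambda>p. (?W n + 2) * S n p)"
      by (simp only: hoppe_exp_Suc[OF step(1)])
    then have "?W (Suc n) * hoppe_exp \<theta> (Suc n) (S (Suc n)) = (?W n + 2) * hoppe_exp \<theta> n (S n)"
      by (simp only: hoppe_exp_cmult)
    also have "\<dots> = (?W n + 2) / ?W n * (?W n * hoppe_exp \<theta> n (S n))" using W by simp
    also have "\<dots> \<le> (?W n + 2) / ?W n * ((?W n)\<^sup>2 / \<theta>)" using W step.IH by (intro mult_left_mono) auto
    also have "\<dots> = (?W n + 2) * ?W n / \<theta>" using W by (simp add: power2_eq_square)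
    \<comment> \<open>\<open>(W + 2) * W \<le> (W + 1)\<^sup>2\<close>, and \<open>W + 1\<close> is
      the next total weight.\<close>
    also have "\<dots> \<le> (?W (Suc n))\<^sup>2 / \<theta>"
      using \<theta> by (intro divide_right_mono) (auto simp: power2_eq_square algebra_simps)
    finally show ?case .
  qed
  have W: "0 < ?W n" using \<theta> n by simp
  have "hoppe_exp \<theta> n (S n) \<le> ?W n / \<theta>"
  proof -
    have "?W n * hoppe_exp \<theta> n (S n) \<le> ?W n * (?W n / \<theta>)"
      using S by (simp only: power2_eq_square times_divide_eq_right)
    then show ?thesis using W by (simp only: mult_le_cancel_left_pos)
  qed
  then show ?thesis by (simp add: S_def)
qed

text \<open>This is \<open>x \<le> exp x\<close> at \<open>x = d * ln b / q\<close>, raised to the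
  power \<open>q\<close>. It serves twice: for the moments of depths, and to turn exponential decay
  in \<open>a\<close> into polynomial decay in \<open>t\<close>.\<close>

lemma power_le_exponential:
  assumes "1 < b" shows "real d ^ q \<le> (real q / ln b) ^ q * b ^ d"
proof (cases "q = 0")
  case True
  then show ?thesis using assms by simp
next
  case False
  let ?x = "real d * ln b"
  have "?x / real q \<le> exp (?x / real q)" using exp_ge_add_one_self[of "?x / real q"] by linarith
  then have "(?x / real q) ^ q \<le> exp (?x / real q) ^ q" using assms by (intro power_mono) auto
  also have "\<dots> = exp ?x" using False by (simp add: exp_of_nat_mult[symmetric])
  also have "\<dots> = b ^ d" using assms by (simp add: exp_of_nat_mult)
  finally have "(?x / real q) ^ q \<le> b ^ d" .
  then have "(real q / ln b) ^ q * (?x / real q) ^ q \<le> (real q / ln b) ^ q * b ^ d"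
    using assms by (intro mult_left_mono) auto
  moreover have "(real q / ln b) ^ q * (?x / real q) ^ q = real d ^ q"
    using assms False by (simp add: power_mult_distrib[symmetric])
  ultimately show ?thesis by simp
qed

text \<open>The linear term is kept exact, since its conditional mean will vanish; all later
  binomial terms carry at least the factor \<open>\<epsilon>\<^sup>2\<close>.\<close>

lemma power_add_perturb_le:
  fixes y e \<epsilon> :: real
  assumes \<epsilon>: "0 \<le> \<epsilon>" "\<epsilon> \<le> 1" and q: "2 \<le> q"
  shows "(y + \<epsilon> * e) ^ q \<le> y ^ q + real q * y ^ (q - 1) * (\<epsilon> * e) + \<epsilon>\<^sup>2 * 2 ^ q * (\<bar>y\<bar> ^ q + \<bar>e\<bar> ^ q)"
proof -
  let ?t = "\<lambda>k. real (q choose k) * (\<epsilon> * e) ^ k * y ^ (q - k)"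
  have le: "?t k \<le> real (q choose k) * (\<epsilon>\<^sup>2 * (\<bar>y\<bar> ^ q + \<bar>e\<bar> ^ q))" if k: "2 \<le> k" "k \<le> q" for k
  proof -
    have "\<bar>e\<bar> ^ k * \<bar>y\<bar> ^ (q - k) \<le> max \<bar>y\<bar> \<bar>e\<bar> ^ k * max \<bar>y\<bar> \<bar>e\<bar> ^ (q - k)"
      by (intro mult_mono power_mono) auto
    also have "\<dots> = max \<bar>y\<bar> \<bar>e\<bar> ^ q" using k by (simp add: power_add[symmetric])
    also have "\<dots> \<le> \<bar>y\<bar> ^ q + \<bar>e\<bar> ^ q" by (simp add: max_def)
    finally have 1: "\<bar>e\<bar> ^ k * \<bar>y\<bar> ^ (q - k) \<le> \<bar>y\<bar> ^ q + \<bar>e\<bar> ^ q" .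
    have 2: "\<epsilon> ^ k \<le> \<epsilon>\<^sup>2" using \<epsilon> k by (intro power_decreasing) auto
    have "(\<epsilon> * e) ^ k * y ^ (q - k) \<le> \<bar>(\<epsilon> * e) ^ k * y ^ (q - k)\<bar>" by simp
    also have "\<dots> = \<epsilon> ^ k * (\<bar>e\<bar> ^ k * \<bar>y\<bar> ^ (q - k))"
      using \<epsilon> by (simp add: abs_mult power_abs power_mult_distrib)
    also have "\<dots> \<le> \<epsilon>\<^sup>2 * (\<bar>y\<bar> ^ q + \<bar>e\<bar> ^ q)"
      using 1 2 \<epsilon> by (intro mult_mono) auto
    finally show ?thesis by (simp add: mult_left_mono mult.assoc)
  qed
  have "(y + \<epsilon> * e) ^ q = (\<Sum>k\<le>q. ?t k)"
    using binomial_ring[of "\<epsilon> * e" y q] by (simp add: add.commute)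
  also have "{..q} = {0, 1} \<union> {2..q}" using q by auto
  also have "(\<Sum>k\<in>{0, 1} \<union> {2..q}. ?t k) = y ^ q + real q * y ^ (q - 1) * (\<epsilon> * e) + (\<Sum>k\<in>{2..q}. ?t k)"
    by (subst sum.union_disjoint) auto
  also have "(\<Sum>k\<in>{2..q}. ?t k) \<le> (\<Sum>k\<in>{2..q}. real (q choose k) * (\<epsilon>\<^sup>2 * (\<bar>y\<bar> ^ q + \<bar>e\<bar> ^ q)))"
    by (intro sum_mono le) auto
  also have "\<dots> \<le> (\<Sum>k\<le>q. real (q choose k) * (\<epsilon>\<^sup>2 * (\<bar>y\<bar> ^ q + \<bar>e\<bar> ^ q)))"
    by (intro sum_mono2) auto
  also have "\<dots> = 2 ^ q * (\<epsilon>\<^sup>2 * (\<bar>y\<bar> ^ q + \<bar>e\<bar> ^ q))"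
    unfolding sum_distrib_right[symmetric] of_nat_sum[symmetric] choose_row_sum by simp
  finally show ?thesis by (simp add: mult_ac)
qed

lemma power_add_le: "0 \<le> a \<Longrightarrow> 0 \<le> b \<Longrightarrow> (a + b) ^ q \<le> 2 ^ q * (a ^ q + b ^ q)" for a b :: real
proof -
  assume "0 \<le> a" "0 \<le> b"
  then have "(a + b) ^ q \<le> (2 * max a b) ^ q" by (intro power_mono) auto
  also have "\<dots> = 2 ^ q * max a b ^ q" by (simp add: power_mult_distrib)
  also have "\<dots> \<le> 2 ^ q * (a ^ q + b ^ q)"
    using \<open>0 \<le> a\<close> \<open>0 \<le> b\<close> by (intro mult_left_mono) (auto simp: max_def)
  finally show ?thesis .
qed

section \<open>The martingale\<close>

definition harmonic_shift :: "real \<Rightarrow> nat \<Rightarrow> real" where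
  "harmonic_shift \<theta> n = (\<Sum>i\<in>{2..n}. 1 / (\<theta> + real i - 1))"

definition centred_length :: "real \<Rightarrow> nat \<Rightarrow> (nat \<Rightarrow> nat) \<Rightarrow> real" where
  "centred_length \<theta> n p = real (internal_path_length p n) / (\<theta> + real n - 1) - harmonic_shift \<theta> n"

text \<open>The increment is the depth of the chosen parent minus its conditional mean, over the new
  total weight \<open>\<theta> + n\<close>. The shift accounts for the edge between the new node and
  its parent.\<close>

lemma centred_length_Suc_upd:
  assumes "0 < \<theta>" "1 \<le> n" "j < n"
  shows "centred_length \<theta> (Suc n) (p(n := j)) = centred_length \<theta> n p +
    (real (hoppe_depth p j) - real (internal_path_length p n) / (\<theta> + real n - 1)) / (\<theta> + real n)"
proof -
  have W: "0 < \<theta> + real n - 1" "0 < \<theta> + real n" using assms by auto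
  have "harmonic_shift \<theta> (Suc n) = harmonic_shift \<theta> n + 1 / (\<theta> + real n)"
    using assms by (simp add: harmonic_shift_def)
  moreover have "(I + (d + 1)) / (w + 1) - (h + 1 / (w + 1)) = I / w - h + (d - I / w) / (w + 1)" if "0 < w" for I d h w :: real
    using that by (simp add: divide_simps) (simp add: algebra_simps)
  from this[OF W(1), of "real (internal_path_length p n)" "real (hoppe_depth p j)" "harmonic_shift \<theta> n"]
  have "(real (internal_path_length p n) + (real (hoppe_depth p j) + 1)) / (\<theta> + real n) - (harmonic_shift \<theta> n + 1 / (\<theta> + real n)) =
    real (internal_path_length p n) / (\<theta> + real n - 1) - harmonic_shift \<theta> n + (real (hoppe_depth p j) - real (internal_path_length p n) / (\<theta> + real n - 1)) / (\<theta> + real n)"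
    by simp
  ultimately show ?thesis unfolding centred_length_def using assms
    by (simp add: internal_path_length_Suc_upd add_ac del: fun_upd_apply)
qed

text \<open>Jensen's inequality for the depth of a random parent.\<close>

lemma mean_depth_power_le:
  assumes \<theta>: "0 < \<theta>" and n: "1 \<le> n" and q: "even q"
  shows "(real (internal_path_length p n) / (\<theta> + real n - 1)) ^ q \<le> (\<Sum>j<n. hoppe_weight \<theta> n j * real (hoppe_depth p j) ^ q)"
  using convex_on_sum[OF _ _ convex_power_even[OF q], of "{..<n}" "hoppe_weight \<theta> n" "\<lambda>j. real (hoppe_depth p j)"]
    sum_hoppe_weight[OF \<theta> n] hoppe_weight_nonneg[OF \<theta> n] n
  by (simp add: sum_weight_depth[OF n] lessThan_empty_iff)

text \<open>The increment is split as \<open>\<epsilon> * e\<close>, with \<open>v\<close> the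
  fourth root of the next total weight, \<open>\<epsilon> = 1 / v ^ 3\<close> and \<open>e\<close>
  the centred depth over \<open>v\<close>. Then \<open>\<epsilon>\<^sup>2\<close> is the summable
  power -3/2 of that weight, while the \<open>q\<close>-th moment of \<open>e\<close> stays bounded:
  since \<open>q \<ge> 4\<close>, dividing by \<open>v ^ q\<close> offsets the linear bound on the
  depth moments. \<open>K\<close> absorbs the additive error into a multiplicative
  recursion.\<close>

lemma hoppe_exp_centred_length_step:
  assumes \<theta>: "0 < \<theta>" and n: "1 \<le> n" and q: "even q" "4 \<le> q"
  defines "v \<equiv> sqrt (sqrt (\<theta> + real n))" and "K \<equiv> 2 ^ (q + 1) * (real q / ln 2) ^ q / \<theta>"
  shows "hoppe_exp \<theta> (Suc n) (\<lambda>p. centred_length \<theta> (Suc n) p ^ q) + K \<le>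
     (1 + 2 ^ q / v ^ 6) * (hoppe_exp \<theta> n (\<lambda>p. centred_length \<theta> n p ^ q) + K)"
proof -
  let ?W = "\<theta> + real n - 1"
  have x1: "1 \<le> \<theta> + real n" using \<theta> n by simp
  have v1: "1 \<le> v" using x1 by (simp add: v_def)
  have v4: "v ^ 4 = \<theta> + real n"
  proof -
    have "v ^ 4 = (v\<^sup>2)\<^sup>2" by (simp add: power_mult[symmetric])
    then show ?thesis using x1 by (simp add: v_def)
  qed
  let ?\<epsilon> = "1 / v ^ 3"
  have \<epsilon>: "0 \<le> ?\<epsilon>" "?\<epsilon> \<le> 1" using v1 one_le_power[OF v1, of 3] by auto
  have \<epsilon>2: "?\<epsilon>\<^sup>2 = 1 / v ^ 6" by (simp add: power_divide power_mult[symmetric])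
  define e where "e = (\<lambda>p j. (real (hoppe_depth p j) - real (internal_path_length p n) / ?W) / v)"
  let ?Y = "centred_length \<theta> n" and ?w = "hoppe_weight \<theta> n"
  let ?D = "\<lambda>p. \<Sum>j<n. ?w j * real (hoppe_depth p j) ^ q"
  have upd: "centred_length \<theta> (Suc n) (p(n := j)) = ?Y p + ?\<epsilon> * e p j" if "j < n" for p j
  proof -
    have "?\<epsilon> * e p j = (real (hoppe_depth p j) - real (internal_path_length p n) / ?W) / v ^ 4"
      by (simp add: e_def eval_nat_numeral)
    then show ?thesis using centred_length_Suc_upd[OF \<theta> n that, of p] unfolding v4 by simp
  qed
  have mean0: "(\<Sum>j<n. ?w j * e p j) = 0" for p
  proof -
    have "(\<Sum>j<n. ?w j * e p j) = (\<Sum>j<n. ?w j * real (hoppe_depth p j) - ?w j * (real (internal_path_length p n) / ?W)) / v"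
      by (simp add: e_def sum_divide_distrib right_diff_distrib diff_divide_distrib)
    also have "(\<Sum>j<n. ?w j * real (hoppe_depth p j) - ?w j * (real (internal_path_length p n) / ?W)) = 0"
      unfolding sum_subtractf sum_distrib_right[symmetric] sum_weight_depth[OF n] sum_hoppe_weight[OF \<theta> n] by simp
    finally show ?thesis by simp
  qed
  have e_le: "(\<Sum>j<n. ?w j * \<bar>e p j\<bar> ^ q) \<le> 2 ^ (q + 1) / (\<theta> + real n) * ?D p" for p
  proof -
    let ?\<mu> = "real (internal_path_length p n) / ?W"
    have \<mu>: "0 \<le> ?\<mu>" using \<theta> n by simp
    have "\<theta> + real n \<le> v ^ q" unfolding v4[symmetric] using v1 q by (intro power_increasing)
    have "\<bar>e p j\<bar> ^ q \<le> 2 ^ q * (real (hoppe_depth p j) ^ q + ?\<mu> ^ q) / (\<theta> + real n)" for j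
    proof -
      have "\<bar>e p j\<bar> ^ q = \<bar>real (hoppe_depth p j) - ?\<mu>\<bar> ^ q / v ^ q"
        using v1 by (simp add: e_def abs_divide power_divide)
      also have "\<dots> \<le> (real (hoppe_depth p j) + ?\<mu>) ^ q / v ^ q"
        using \<mu> v1 by (intro divide_right_mono power_mono) (auto simp: abs_if)
      also have "\<dots> \<le> 2 ^ q * (real (hoppe_depth p j) ^ q + ?\<mu> ^ q) / (\<theta> + real n)"
        using \<mu> v1 x1 \<open>\<theta> + real n \<le> v ^ q\<close> by (intro frac_le power_add_le mult_nonneg_nonneg add_nonneg_nonneg zero_le_power) auto
      finally show ?thesis .
    qed
    then have "(\<Sum>j<n. ?w j * \<bar>e p j\<bar> ^ q) \<le> (\<Sum>j<n. ?w j * (2 ^ q * (real (hoppe_depth p j) ^ q + ?\<mu> ^ q) / (\<theta> + real n)))"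
      by (intro sum_mono mult_left_mono hoppe_weight_nonneg[OF \<theta> n])
    also have "\<dots> = 2 ^ q / (\<theta> + real n) * (\<Sum>j<n. ?w j * real (hoppe_depth p j) ^ q + ?w j * ?\<mu> ^ q)"
      unfolding sum_distrib_left by (intro sum.cong refl) (simp add: algebra_simps add_divide_distrib)
    also have "\<dots> = 2 ^ q / (\<theta> + real n) * (?D p + ?\<mu> ^ q)"
      unfolding sum.distrib sum_distrib_right[symmetric] sum_hoppe_weight[OF \<theta> n] by simp
    also have "\<dots> \<le> 2 ^ q / (\<theta> + real n) * (?D p + ?D p)"
      using x1 by (intro mult_left_mono add_left_mono mean_depth_power_le[OF \<theta> n q(1)]) auto
    finally show ?thesis by (simp add: mult_ac)
  qed
  have ED: "hoppe_exp \<theta> n ?D \<le> (real q / ln 2) ^ q * (?W / \<theta>)"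
  proof -
    have "hoppe_exp \<theta> n ?D \<le> hoppe_exp \<theta> n (\<lambda>p. (real q / ln 2) ^ q * (\<Sum>j<n. ?w j * 2 ^ hoppe_depth p j))"
    proof (rule hoppe_exp_mono[OF \<theta>])
      fix p
      have "?D p \<le> (\<Sum>j<n. ?w j * ((real q / ln 2) ^ q * 2 ^ hoppe_depth p j))"
        using q by (intro sum_mono mult_left_mono power_le_exponential hoppe_weight_nonneg[OF \<theta> n]) auto
      then show "?D p \<le> (real q / ln 2) ^ q * (\<Sum>j<n. ?w j * 2 ^ hoppe_depth p j)"
        by (simp add: sum_distrib_left mult_ac)
    qed
    also have "\<dots> \<le> (real q / ln 2) ^ q * (?W / \<theta>)"
      unfolding hoppe_exp_cmult by (intro mult_left_mono hoppe_exp_two_power_depth[OF \<theta> n]) auto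
    finally show ?thesis .
  qed
  have step: "(\<Sum>j<n. ?w j *\<^sub>R centred_length \<theta> (Suc n) (p(n := j)) ^ q) \<le>
     (1 + 2 ^ q / v ^ 6) * ?Y p ^ q + 2 ^ q / v ^ 6 * (2 ^ (q + 1) / (\<theta> + real n)) * ?D p" for p
  proof -
    have Yq: "\<bar>?Y p\<bar> ^ q = ?Y p ^ q" using q by (simp add: power_even_abs)
    have "(\<Sum>j<n. ?w j *\<^sub>R centred_length \<theta> (Suc n) (p(n := j)) ^ q) \<le>
      (\<Sum>j<n. ?w j * (?Y p ^ q + real q * ?Y p ^ (q - 1) * (?\<epsilon> * e p j) + ?\<epsilon>\<^sup>2 * 2 ^ q * (\<bar>?Y p\<bar> ^ q + \<bar>e p j\<bar> ^ q)))"
    proof (rule sum_mono)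
      fix j assume "j \<in> {..<n}"
      then have j: "j < n" by simp
      show "?w j *\<^sub>R centred_length \<theta> (Suc n) (p(n := j)) ^ q \<le> ?w j * (?Y p ^ q + real q * ?Y p ^ (q - 1) * (?\<epsilon> * e p j) + ?\<epsilon>\<^sup>2 * 2 ^ q * (\<bar>?Y p\<bar> ^ q + \<bar>e p j\<bar> ^ q))"
        unfolding upd[OF j] real_scaleR_def using q
        by (intro mult_left_mono power_add_perturb_le \<epsilon> hoppe_weight_nonneg[OF \<theta> n]) auto
    qed
    also have "\<dots> = (\<Sum>j<n. ?w j * ((1 + ?\<epsilon>\<^sup>2 * 2 ^ q) * ?Y p ^ q) + real q * ?Y p ^ (q - 1) * ?\<epsilon> * (?w j * e p j) + ?\<epsilon>\<^sup>2 * 2 ^ q * (?w j * \<bar>e p j\<bar> ^ q))"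
      unfolding Yq by (intro sum.cong refl) (simp only: distrib_left distrib_right mult_1_left mult_ac add_ac)
    also have "\<dots> = (1 + ?\<epsilon>\<^sup>2 * 2 ^ q) * ?Y p ^ q + ?\<epsilon>\<^sup>2 * 2 ^ q * (\<Sum>j<n. ?w j * \<bar>e p j\<bar> ^ q)"
      unfolding sum.distrib sum_distrib_right[symmetric] sum_distrib_left[symmetric] mean0 sum_hoppe_weight[OF \<theta> n] by simp
    also have "\<dots> \<le> (1 + ?\<epsilon>\<^sup>2 * 2 ^ q) * ?Y p ^ q + ?\<epsilon>\<^sup>2 * 2 ^ q * (2 ^ (q + 1) / (\<theta> + real n) * ?D p)"
      by (intro add_left_mono mult_left_mono e_le) auto
    finally show ?thesis unfolding \<epsilon>2 by (simp add: mult_ac)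
  qed
  have "hoppe_exp \<theta> (Suc n) (\<lambda>p. centred_length \<theta> (Suc n) p ^ q) \<le>
     hoppe_exp \<theta> n (\<lambda>p. (1 + 2 ^ q / v ^ 6) * ?Y p ^ q + 2 ^ q / v ^ 6 * (2 ^ (q + 1) / (\<theta> + real n)) * ?D p)"
    unfolding hoppe_exp_Suc[OF n] by (intro hoppe_exp_mono[OF \<theta>] step)
  also have "\<dots> = (1 + 2 ^ q / v ^ 6) * hoppe_exp \<theta> n (\<lambda>p. ?Y p ^ q) + 2 ^ q / v ^ 6 * (2 ^ (q + 1) / (\<theta> + real n)) * hoppe_exp \<theta> n ?D"
    unfolding hoppe_exp_add hoppe_exp_cmult ..
  also have "\<dots> \<le> (1 + 2 ^ q / v ^ 6) * hoppe_exp \<theta> n (\<lambda>p. ?Y p ^ q) + 2 ^ q / v ^ 6 * K"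
  proof -
    have "2 ^ (q + 1) / (\<theta> + real n) * hoppe_exp \<theta> n ?D \<le> 2 ^ (q + 1) / (\<theta> + real n) * ((real q / ln 2) ^ q * (?W / \<theta>))"
      using x1 by (intro mult_left_mono ED) auto
    also have "\<dots> = K * (?W / (\<theta> + real n))" by (simp add: K_def mult_ac)
    also have "\<dots> \<le> K * 1" using x1 \<theta> by (intro mult_left_mono) (auto simp: K_def)
    finally have "2 ^ q / v ^ 6 * (2 ^ (q + 1) / (\<theta> + real n) * hoppe_exp \<theta> n ?D) \<le> 2 ^ q / v ^ 6 * K"
      using v1 by (intro mult_left_mono) auto
    then show ?thesis unfolding mult.assoc by (rule add_left_mono)
  qed
  finally show ?thesis by (simp add: distrib_left distrib_right)
qed

text \<open>The growth factors \<open>1 + r n\<close> have bounded products, as \<open>r n\<close>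
  is of order \<open>n powr (-3 / 2)\<close>.\<close>

lemma hoppe_exp_centred_length_bounded:
  assumes \<theta>: "0 < \<theta>" and q: "even q" "4 \<le> q"
  shows "\<exists>C. \<forall>n\<ge>1. hoppe_exp \<theta> n (\<lambda>p. centred_length \<theta> n p ^ q) \<le> C"
proof -
  define K where "K = 2 ^ (q + 1) * (real q / ln 2) ^ q / \<theta>"
  define r where "r = (\<lambda>n. 2 ^ q / sqrt (sqrt (\<theta> + real n)) ^ 6 :: real)"
  define a where "a = (\<lambda>n. hoppe_exp \<theta> n (\<lambda>p. centred_length \<theta> n p ^ q) + K)"
  have K0: "0 \<le> K" using \<theta> by (simp add: K_def)
  have a0: "0 \<le> a n" for n
    unfolding a_def using K0 \<theta> q by (intro add_nonneg_nonneg hoppe_exp_nonneg) (auto simp: zero_le_even_power)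
  have r0: "0 \<le> r n" for n using \<theta> by (simp add: r_def)
  have "summable r"
  proof (rule summable_comparison_test')
    show "summable (\<lambda>n. 2 ^ q * real n powr (-3 / 2))" by (intro summable_mult) (simp add: summable_real_powr_iff)
    show "norm (r n) \<le> 2 ^ q * real n powr (-3 / 2)" if "n \<ge> 1" for n
    proof -
      have n0: "0 < real n" using that by simp
      have "sqrt y ^ 6 = y ^ 3" if "0 \<le> y" for y :: real
      proof -
        have "sqrt y ^ 6 = (sqrt y ^ 2) ^ 3" by (simp only: power_mult[symmetric]) simp
        then show ?thesis using that by (simp only: real_sqrt_pow2)
      qed
      then have "sqrt (sqrt (real n)) ^ 6 = sqrt (real n) ^ 3" by simp
      also have "\<dots> = real n powr (3 / 2)"
        using n0 by (simp add: powr_half_sqrt[symmetric] powr_realpow[symmetric] powr_powr)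
      finally have "sqrt (sqrt (real n)) ^ 6 = real n powr (3 / 2)" .
      moreover have "sqrt (sqrt (real n)) ^ 6 \<le> sqrt (sqrt (\<theta> + real n)) ^ 6" using \<theta> by (intro power_mono) auto
      ultimately have "r n \<le> 2 ^ q / real n powr (3 / 2)" unfolding r_def using n0 \<theta>
        by (intro divide_left_mono mult_pos_pos zero_less_power) auto
      then show ?thesis using r0[of n] by (simp add: powr_minus_divide)
    qed
  qed
  then have sum_le: "(\<Sum>i\<in>{1..<n}. r i) \<le> suminf r" for n
    using r0 by (intro sum_le_suminf) auto
  have "a n \<le> a 1 * exp (\<Sum>i\<in>{1..<n}. r i)" if "1 \<le> n" for n
    using that
  proof (induction n rule: dec_induct)
    case (step n)
    have "a (Suc n) \<le> (1 + r n) * a n"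
      unfolding a_def K_def r_def using hoppe_exp_centred_length_step[OF \<theta> step(1) q] by simp
    also have "\<dots> \<le> exp (r n) * (a 1 * exp (\<Sum>i\<in>{1..<n}. r i))"
      using step.IH a0 r0 exp_ge_add_one_self[of "r n"] by (intro mult_mono) auto
    also have "\<dots> = a 1 * exp (\<Sum>i\<in>{1..<Suc n}. r i)"
      using step by (simp add: exp_add sum.atLeastLessThan_Suc)
    finally show ?case .
  qed simp
  then have "a n \<le> a 1 * exp (suminf r)" if "1 \<le> n" for n
    using that sum_le[of n] a0[of 1] by (meson exp_le_cancel_iff mult_left_mono order_trans)
  moreover have "hoppe_exp \<theta> n (\<lambda>p. centred_length \<theta> n p ^ q) \<le> a n" for n using K0 by (simp add: a_def)
  ultimately show ?thesis by (meson order_trans)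
qed

section \<open>Comparison with the normalisation by n\<close>

lemma harmonic_shift_bounds:
  assumes \<theta>: "0 < \<theta>" and n: "1 \<le> n"
  shows "ln (\<theta> + real n) - ln (\<theta> + 1) \<le> harmonic_shift \<theta> n" "harmonic_shift \<theta> n \<le> ln (\<theta> + real n - 1) - ln \<theta>"
proof -
  have *: "1 / (x + 1) \<le> ln (x + 1) - ln x" "ln (x + 1) - ln x \<le> 1 / x" if "0 < x" for x :: real
  proof -
    have "ln (x / (x + 1)) \<le> x / (x + 1) - 1" using that by (intro ln_le_minus_one) auto
    then show "1 / (x + 1) \<le> ln (x + 1) - ln x"
    proof -
      have "ln (x / (x + 1)) = ln x - ln (x + 1)" using that by (simp add: ln_div)
      moreover have "x / (x + 1) - 1 = - (1 / (x + 1))" using that by (simp add: field_simps)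
      ultimately show ?thesis using \<open>ln (x / (x + 1)) \<le> _\<close> by linarith
    qed
    have "ln ((x + 1) / x) \<le> (x + 1) / x - 1" using that by (intro ln_le_minus_one) auto
    then show "ln (x + 1) - ln x \<le> 1 / x"
    proof -
      have "ln ((x + 1) / x) = ln (x + 1) - ln x" using that by (simp add: ln_div)
      moreover have "(x + 1) / x - 1 = 1 / x" using that by (simp add: field_simps)
      ultimately show ?thesis using \<open>ln ((x + 1) / x) \<le> _\<close> by linarith
    qed
  qed
  show "ln (\<theta> + real n) - ln (\<theta> + 1) \<le> harmonic_shift \<theta> n"
    using n
  proof (induction n rule: dec_induct)
    case base then show ?case by (simp add: harmonic_shift_def)
  next
    case (step n)
    have "harmonic_shift \<theta> (Suc n) = harmonic_shift \<theta> n + 1 / (\<theta> + real n)" using step by (simp add: harmonic_shift_def)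
    then show ?case using step *(2)[of "\<theta> + real n"] \<theta> by (simp add: add_ac)
  qed
  show "harmonic_shift \<theta> n \<le> ln (\<theta> + real n - 1) - ln \<theta>"
    using n
  proof (induction n rule: dec_induct)
    case base then show ?case by (simp add: harmonic_shift_def)
  next
    case (step n)
    have "harmonic_shift \<theta> (Suc n) = harmonic_shift \<theta> n + 1 / (\<theta> + real n)" using step by (simp add: harmonic_shift_def)
    then show ?case using step *(1)[of "\<theta> + real n - 1"] \<theta> by (simp add: add_ac)
  qed
qed

text \<open>Replacing the total weight by \<open>n\<close> costs a bounded factor and the term
  \<open>h * (\<theta> - 1) / n\<close>, where the shift \<open>h\<close> differs from
  \<open>ln n\<close> by a bounded amount.\<close>

lemma scaled_length_le_centred:
  assumes \<theta>: "0 < \<theta>"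
  shows "\<exists>C\<ge>0. \<forall>n\<ge>1. \<forall>p. \<bar>(real (internal_path_length p n) - real n * ln (real n)) / real n\<bar> \<le> (1 + \<theta>) * \<bar>centred_length \<theta> n p\<bar> + C"
proof -
  define c where "c = \<bar>ln (\<theta> + 1)\<bar> + \<bar>ln \<theta>\<bar>"
  have c0: "0 \<le> c" by (simp add: c_def)
  have h: "\<bar>harmonic_shift \<theta> n - ln (real n)\<bar> \<le> c" if n: "1 \<le> n" for n
  proof -
    have "ln (real n) \<le> ln (\<theta> + real n)" using n \<theta> by simp
    moreover have "ln (\<theta> + real n - 1) \<le> ln ((\<theta> + 1) * real n)"
    proof -
      have "\<theta> * 1 \<le> \<theta> * real n" using n \<theta> by (intro mult_left_mono) auto
      then have "\<theta> + real n - 1 \<le> (\<theta> + 1) * real n" using n by (simp add: distrib_right)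
      moreover have "0 < \<theta> + real n - 1" using n \<theta> by simp
      ultimately show ?thesis by (intro ln_mono) auto
    qed
    moreover have "ln ((\<theta> + 1) * real n) = ln (\<theta> + 1) + ln (real n)" using n \<theta> by (simp add: ln_mult)
    ultimately show ?thesis using harmonic_shift_bounds[OF \<theta> n] unfolding c_def by linarith
  qed
  define C where "C = (1 + c) * \<bar>\<theta> - 1\<bar> + c"
  have "\<bar>(real (internal_path_length p n) - real n * ln (real n)) / real n\<bar> \<le> (1 + \<theta>) * \<bar>centred_length \<theta> n p\<bar> + C" if n: "1 \<le> n" for n p
  proof -
    let ?W = "\<theta> + real n - 1" and ?h = "harmonic_shift \<theta> n"
    have n0: "0 < real n" "0 < ?W" using n \<theta> by auto
    have "real (internal_path_length p n) = (centred_length \<theta> n p + ?h) * ?W"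
      using n0 by (simp add: centred_length_def)
    then have "(real (internal_path_length p n) - real n * ln (real n)) / real n =
       ?W / real n * centred_length \<theta> n p + (?h / real n * (\<theta> - 1) + (?h - ln (real n)))"
    proof -
      have "((Y + h) * (\<theta> + m - 1) - m * L) / m = (\<theta> + m - 1) / m * Y + (h / m * (\<theta> - 1) + (h - L))"
        if "0 < m" for Y h m L :: real
        using that by (simp add: field_simps)
      from this[OF n0(1)] show ?thesis unfolding \<open>real (internal_path_length p n) = _\<close> .
    qed
    moreover have "\<bar>?W / real n * centred_length \<theta> n p\<bar> \<le> (1 + \<theta>) * \<bar>centred_length \<theta> n p\<bar>"
    proof -
      have "\<theta> * 1 \<le> \<theta> * real n" using n \<theta> by (intro mult_left_mono) auto
      then have "?W / real n \<le> 1 + \<theta>" using n0 by (simp add: field_simps)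
      then have "?W / real n * \<bar>centred_length \<theta> n p\<bar> \<le> (1 + \<theta>) * \<bar>centred_length \<theta> n p\<bar>"
        by (rule mult_right_mono) simp
      moreover have "\<bar>?W / real n\<bar> = ?W / real n" using n0 by (intro abs_of_nonneg) simp
      ultimately show ?thesis by (simp only: abs_mult)
    qed
    moreover have "\<bar>?h / real n * (\<theta> - 1)\<bar> \<le> (1 + c) * \<bar>\<theta> - 1\<bar>"
    proof -
      have "\<bar>?h\<bar> \<le> ln (real n) + c" using h[OF n] n by (smt (verit) ln_ge_zero_iff n0(1) of_nat_1 of_nat_le_iff)
      also have "\<dots> \<le> real n + c * real n" using ln_le_minus_one[OF n0(1)] c0 n mult_left_mono[of 1 "real n" c] by simp
      finally have "\<bar>?h\<bar> / real n \<le> 1 + c" using n0 by (simp add: field_simps)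
      then have "\<bar>?h\<bar> / real n * \<bar>\<theta> - 1\<bar> \<le> (1 + c) * \<bar>\<theta> - 1\<bar>" by (rule mult_right_mono) simp
      then show ?thesis by (simp only: abs_mult abs_divide abs_of_nat)
    qed
    moreover have "\<bar>a + (b + d)\<bar> \<le> x + (y + z)" if "\<bar>a\<bar> \<le> x" "\<bar>b\<bar> \<le> y" "\<bar>d\<bar> \<le> z" for a b d x y z :: real
      using that by linarith
    ultimately show ?thesis using h[OF n] unfolding C_def by (simp only:)
  qed
  moreover have "0 \<le> C" using c0 by (simp add: C_def)
  ultimately show ?thesis by blast
qed

lemma hoppe_exp_scaled_length_bounded:
  assumes \<theta>: "0 < \<theta>" and q: "even q" "4 \<le> q"
  shows "\<exists>K. \<forall>n\<ge>1. hoppe_exp \<theta> n (\<lambda>p. ((real (internal_path_length p n) - real n * ln (real n)) / real n) ^ q) \<le> K"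
proof -
  obtain C where C: "0 \<le> C" "\<And>n p. 1 \<le> n \<Longrightarrow> \<bar>(real (internal_path_length p n) - real n * ln (real n)) / real n\<bar> \<le> (1 + \<theta>) * \<bar>centred_length \<theta> n p\<bar> + C"
    using scaled_length_le_centred[OF \<theta>] by blast
  obtain B where B: "\<And>n. 1 \<le> n \<Longrightarrow> hoppe_exp \<theta> n (\<lambda>p. centred_length \<theta> n p ^ q) \<le> B"
    using hoppe_exp_centred_length_bounded[OF \<theta> q] by blast
  have "hoppe_exp \<theta> n (\<lambda>p. ((real (internal_path_length p n) - real n * ln (real n)) / real n) ^ q) \<le> 2 ^ q * (1 + \<theta>) ^ q * B + 2 ^ q * C ^ q"
    if n: "1 \<le> n" for n
  proof -
    have "((real (internal_path_length p n) - real n * ln (real n)) / real n) ^ q \<le> 2 ^ q * (1 + \<theta>) ^ q * centred_length \<theta> n p ^ q + 2 ^ q * C ^ q" for p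
    proof -
      let ?Z = "(real (internal_path_length p n) - real n * ln (real n)) / real n"
      have "?Z ^ q = \<bar>?Z\<bar> ^ q" using q by (simp only: power_even_abs)
      also have "\<dots> \<le> ((1 + \<theta>) * \<bar>centred_length \<theta> n p\<bar> + C) ^ q" by (intro power_mono C n) auto
      also have "\<dots> \<le> 2 ^ q * (((1 + \<theta>) * \<bar>centred_length \<theta> n p\<bar>) ^ q + C ^ q)" using C \<theta> by (intro power_add_le) auto
      also have "\<dots> = 2 ^ q * (1 + \<theta>) ^ q * centred_length \<theta> n p ^ q + 2 ^ q * C ^ q"
        using q by (simp add: power_mult_distrib power_even_abs distrib_left)
      finally show ?thesis .
    qed
    then have "hoppe_exp \<theta> n (\<lambda>p. ((real (internal_path_length p n) - real n * ln (real n)) / real n) ^ q) \<le>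
       hoppe_exp \<theta> n (\<lambda>p. 2 ^ q * (1 + \<theta>) ^ q * centred_length \<theta> n p ^ q + 2 ^ q * C ^ q)"
      by (intro hoppe_exp_mono[OF \<theta>])
    also have "\<dots> = 2 ^ q * (1 + \<theta>) ^ q * hoppe_exp \<theta> n (\<lambda>p. centred_length \<theta> n p ^ q) + 2 ^ q * C ^ q"
      unfolding hoppe_exp_add hoppe_exp_cmult hoppe_exp_const[OF \<theta>] ..
    also have "\<dots> \<le> 2 ^ q * (1 + \<theta>) ^ q * B + 2 ^ q * C ^ q"
      using B[OF n] \<theta> by (intro add_right_mono mult_left_mono) auto
    finally show ?thesis .
  qed
  then show ?thesis by blast
qed

section \<open>Densities from decaying characteristic functions\<close>

text \<open>Used to differentiate under the integral sign, where Taylor's formula supplies a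
  quadratic remainder.\<close>

lemma has_real_derivative_quadratic_bound:
  fixes F :: "real \<Rightarrow> real"
  assumes "\<And>y. \<bar>F y - F x - (y - x) * D\<bar> \<le> K * (y - x)\<^sup>2"
  shows "(F has_real_derivative D) (at x)"
proof -
  have "((\<lambda>y. (F y - F x) / (y - x) - D) \<longlongrightarrow> 0) (at x)"
  proof (rule Lim_null_comparison)
    show "\<forall>\<^sub>F y in at x. norm ((F y - F x) / (y - x) - D) \<le> \<bar>K\<bar> * \<bar>y - x\<bar>"
    proof (rule eventually_mono[OF eventually_neq_at_within[of x]])
      fix y assume y: "y \<noteq> x"
      then have "(F y - F x) / (y - x) - D = (F y - F x - (y - x) * D) / (y - x)" by (simp add: field_simps)
      then have "norm ((F y - F x) / (y - x) - D) = \<bar>F y - F x - (y - x) * D\<bar> / \<bar>y - x\<bar>" by simp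
      also have "\<dots> \<le> \<bar>K\<bar> * (y - x)\<^sup>2 / \<bar>y - x\<bar>"
        by (intro divide_right_mono order_trans[OF assms] mult_right_mono) auto
      finally have le: "norm ((F y - F x) / (y - x) - D) \<le> \<bar>K\<bar> * (y - x)\<^sup>2 / \<bar>y - x\<bar>" .
      have cancel: "c * (a * a) / a = c * a" if "a \<noteq> 0" for a c :: real using that by simp
      have "(y - x)\<^sup>2 = \<bar>y - x\<bar> * \<bar>y - x\<bar>" by (simp add: power2_eq_square)
      note le[unfolded this]
      also have "\<bar>K\<bar> * (\<bar>y - x\<bar> * \<bar>y - x\<bar>) / \<bar>y - x\<bar> = \<bar>K\<bar> * \<bar>y - x\<bar>"
        by (rule cancel) (use y in simp)
      finally show "norm ((F y - F x) / (y - x) - D) \<le> \<bar>K\<bar> * \<bar>y - x\<bar>" .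
    qed
    have "((\<lambda>y. \<bar>K\<bar> * \<bar>y - x\<bar>) \<longlongrightarrow> \<bar>K\<bar> * \<bar>x - x\<bar>) (at x)" by (intro tendsto_intros)
    then show "((\<lambda>y. \<bar>K\<bar> * \<bar>y - x\<bar>) \<longlongrightarrow> 0) (at x)" by simp
  qed
  then show ?thesis unfolding has_field_derivative_iff using LIM_zero_iff by blast
qed

lemma iexp_quadratic: "cmod (iexp u - 1 - \<i> * of_real u) \<le> u\<^sup>2 / 2"
  using iexp_approx1[of u 1] by (simp add: numeral_2_eq_2 algebra_simps)

lemma integrable_inverse_one_plus_square: "integrable lborel (\<lambda>t::real. inverse (1 + t\<^sup>2))"
proof -
  have "einterval (-\<infinity>) \<infinity> = (UNIV :: real set)" by (auto simp: einterval_def)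
  then show ?thesis using integrable_inverse_1_plus_square by (simp add: set_integrable_def)
qed

section \<open>Fourier inversion under polynomial decay\<close>

locale decaying_transform =
  fixes \<phi> :: "real \<Rightarrow> complex"
  assumes meas [measurable]: "\<phi> \<in> borel_measurable borel"
    and decay: "\<And>k. \<exists>C. \<forall>t. \<bar>t\<bar> ^ k * cmod (\<phi> t) \<le> C"
begin

text \<open>The bounds for \<open>k\<close> and \<open>k + 2\<close> together give domination by a
  multiple of \<open>1 / (1 + t\<^sup>2)\<close>.\<close>

lemma integrable_moment: "integrable lborel (\<lambda>t. \<bar>t\<bar> ^ k * cmod (\<phi> t))"
proof -
  obtain C where C: "\<And>t. \<bar>t\<bar> ^ k * cmod (\<phi> t) \<le> C" using decay by blast
  obtain C2 where C2: "\<And>t. \<bar>t\<bar> ^ (k + 2) * cmod (\<phi> t) \<le> C2" using decay by blast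
  show ?thesis
  proof (rule Bochner_Integration.integrable_bound)
    show "integrable lborel (\<lambda>t::real. (C + C2) * inverse (1 + t\<^sup>2))"
      by (intro integrable_mult_right integrable_inverse_one_plus_square)
    show "AE t in lborel. norm (\<bar>t\<bar> ^ k * cmod (\<phi> t)) \<le> norm ((C + C2) * inverse (1 + t\<^sup>2))"
    proof (intro AE_I2)
      fix t
      have "\<bar>t\<bar> ^ k * cmod (\<phi> t) * (1 + t\<^sup>2) \<le> C + C2"
      proof -
        have "\<bar>t\<bar> ^ (k + 2) * cmod (\<phi> t) = \<bar>t\<bar> ^ k * cmod (\<phi> t) * t\<^sup>2"
          by (simp only: power_add power2_abs mult_ac)
        then have "\<bar>t\<bar> ^ k * cmod (\<phi> t) * t\<^sup>2 \<le> C2" using C2[of t] by (simp only:)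
        then show ?thesis using C[of t] unfolding distrib_left by linarith
      qed
      moreover have "0 < 1 + t\<^sup>2" by (simp add: add_pos_nonneg)
      ultimately have "\<bar>t\<bar> ^ k * cmod (\<phi> t) \<le> (C + C2) * inverse (1 + t\<^sup>2)"
        by (simp add: field_simps)
      then show "norm (\<bar>t\<bar> ^ k * cmod (\<phi> t)) \<le> norm ((C + C2) * inverse (1 + t\<^sup>2))"
        unfolding real_norm_def by (subst abs_of_nonneg) auto
    qed
  qed simp
qed

definition moment :: "nat \<Rightarrow> real" where
  "moment k = (\<integral>t. \<bar>t\<bar> ^ k * cmod (\<phi> t) \<partial>lborel)"

text \<open>The \<open>k\<close>-th derivative in \<open>x\<close> of the inversion integrand;
  accordingly \<open>inv_transform k\<close> will be the \<open>k\<close>-th derivative of the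
  Fourier inverse.\<close>

definition kernel :: "nat \<Rightarrow> real \<Rightarrow> real \<Rightarrow> complex" where
  "kernel k x t = (- (\<i> * of_real t)) ^ k * iexp (- (t * x)) * \<phi> t"

definition inv_transform :: "nat \<Rightarrow> real \<Rightarrow> real" where
  "inv_transform k x = Re (\<integral>t. kernel k x t \<partial>lborel) / (2 * pi)"

lemma norm_kernel: "cmod (kernel k x t) = \<bar>t\<bar> ^ k * cmod (\<phi> t)"
  by (simp add: kernel_def norm_mult norm_power)

lemma integrable_kernel: "integrable lborel (kernel k x)"
proof (rule Bochner_Integration.integrable_bound[OF integrable_moment[of k]])
  show "kernel k x \<in> borel_measurable lborel" unfolding kernel_def[abs_def] by measurable
qed (simp add: norm_kernel abs_mult)

lemma abs_inv_transform_le: "\<bar>inv_transform k x\<bar> \<le> moment k"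
proof -
  have "\<bar>Re (\<integral>t. kernel k x t \<partial>lborel)\<bar> \<le> cmod (\<integral>t. kernel k x t \<partial>lborel)" by (rule abs_Re_le_cmod)
  also have "\<dots> \<le> moment k" unfolding moment_def norm_kernel[of k x, symmetric] by (rule integral_norm_bound)
  finally have *: "\<bar>Re (\<integral>t. kernel k x t \<partial>lborel)\<bar> \<le> moment k" .
  moreover have "1 \<le> 2 * pi" using pi_gt3 by simp
  ultimately have "\<bar>Re (\<integral>t. kernel k x t \<partial>lborel)\<bar> \<le> moment k * (2 * pi)"
    using mult_left_mono[of 1 "2 * pi" "moment k"] by linarith
  then show ?thesis unfolding inv_transform_def by (simp add: field_simps)
qed

lemma real_derivative_integral:
  assumes A: "\<And>y. integrable lborel (A y)" and D: "integrable lborel D"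
    and bound: "\<And>y. AE t in lborel. cmod (A y t - A x t - of_real (y - x) * D t) \<le> (y - x)\<^sup>2 / 2 * (\<bar>t\<bar> ^ k * cmod (\<phi> t))"
  shows "((\<lambda>y. Re (\<integral>t. A y t \<partial>lborel) / (2 * pi)) has_real_derivative Re (\<integral>t. D t \<partial>lborel) / (2 * pi)) (at x)"
proof (rule has_real_derivative_quadratic_bound)
  fix y
  have int: "integrable lborel (\<lambda>t. A y t - A x t - of_real (y - x) * D t)"
    using A D by (intro Bochner_Integration.integrable_diff integrable_mult_right)
  have eq: "(\<integral>t. A y t - A x t - of_real (y - x) * D t \<partial>lborel) =
     (\<integral>t. A y t \<partial>lborel) - (\<integral>t. A x t \<partial>lborel) - of_real (y - x) * (\<integral>t. D t \<partial>lborel)"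
    using A D by (simp add: Bochner_Integration.integral_diff Bochner_Integration.integrable_diff integrable_mult_right)
  have "\<bar>Re (\<integral>t. A y t \<partial>lborel) - Re (\<integral>t. A x t \<partial>lborel) - (y - x) * Re (\<integral>t. D t \<partial>lborel)\<bar> =
    \<bar>Re (\<integral>t. A y t - A x t - of_real (y - x) * D t \<partial>lborel)\<bar>"
    unfolding eq by simp
  also have "\<dots> \<le> cmod (\<integral>t. A y t - A x t - of_real (y - x) * D t \<partial>lborel)" by (rule abs_Re_le_cmod)
  also have "\<dots> \<le> (\<integral>t. (y - x)\<^sup>2 / 2 * (\<bar>t\<bar> ^ k * cmod (\<phi> t)) \<partial>lborel)"
    using bound by (intro order_trans[OF integral_norm_bound] integral_mono_AE integrable_norm int
       integrable_mult_right integrable_moment)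
  also have "\<dots> = (y - x)\<^sup>2 / 2 * moment k" unfolding moment_def by simp
  finally have "\<bar>Re (\<integral>t. A y t \<partial>lborel) - Re (\<integral>t. A x t \<partial>lborel) - (y - x) * Re (\<integral>t. D t \<partial>lborel)\<bar> / (2 * pi) \<le>
     (y - x)\<^sup>2 / 2 * moment k / (2 * pi)"
    by (rule divide_right_mono) simp
  moreover have "Re (\<integral>t. A y t \<partial>lborel) / (2 * pi) - Re (\<integral>t. A x t \<partial>lborel) / (2 * pi) - (y - x) * (Re (\<integral>t. D t \<partial>lborel) / (2 * pi)) =
     (Re (\<integral>t. A y t \<partial>lborel) - Re (\<integral>t. A x t \<partial>lborel) - (y - x) * Re (\<integral>t. D t \<partial>lborel)) / (2 * pi)"
    by (simp add: diff_divide_distrib)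
  ultimately show "\<bar>Re (\<integral>t. A y t \<partial>lborel) / (2 * pi) - Re (\<integral>t. A x t \<partial>lborel) / (2 * pi) - (y - x) * (Re (\<integral>t. D t \<partial>lborel) / (2 * pi))\<bar>
     \<le> moment k / 2 / (2 * pi) * (y - x)\<^sup>2"
    by (simp add: abs_divide mult_ac)
qed

lemma DERIV_inv_transform: "(inv_transform k has_real_derivative inv_transform (Suc k) x) (at x)"
  unfolding inv_transform_def[abs_def]
\<comment> \<open>The quadratic remainder of the exponential brings in two more powers of
  \<open>t\<close>.\<close>
proof (rule real_derivative_integral[where k = "k + 2"])
  fix y
  show "AE t in lborel. cmod (kernel k y t - kernel k x t - of_real (y - x) * kernel (Suc k) x t)
     \<le> (y - x)\<^sup>2 / 2 * (\<bar>t\<bar> ^ (k + 2) * cmod (\<phi> t))"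
  proof (intro AE_I2)
    fix t
    let ?u = "- (t * (y - x))"
    have "iexp (- (t * y)) = iexp (- (t * x)) * iexp ?u"
      by (simp add: exp_add[symmetric] algebra_simps)
    then have "kernel k y t - kernel k x t - of_real (y - x) * kernel (Suc k) x t = kernel k x t * (iexp ?u - 1 - \<i> * of_real ?u)"
      by (simp add: kernel_def algebra_simps)
    then have "cmod (kernel k y t - kernel k x t - of_real (y - x) * kernel (Suc k) x t) = \<bar>t\<bar> ^ k * cmod (\<phi> t) * cmod (iexp ?u - 1 - \<i> * of_real ?u)"
      by (simp only: norm_mult norm_kernel)
    also have "\<dots> \<le> \<bar>t\<bar> ^ k * cmod (\<phi> t) * (?u\<^sup>2 / 2)"
      by (intro mult_left_mono iexp_quadratic) auto
    also have "\<dots> = (y - x)\<^sup>2 / 2 * (\<bar>t\<bar> ^ (k + 2) * cmod (\<phi> t))"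
      by (simp add: power_mult_distrib power_add power2_eq_square mult_ac)
    finally show "cmod (kernel k y t - kernel k x t - of_real (y - x) * kernel (Suc k) x t)
      \<le> (y - x)\<^sup>2 / 2 * (\<bar>t\<bar> ^ (k + 2) * cmod (\<phi> t))" .
  qed
qed (rule integrable_kernel)+

lemma deriv_inv_transform: "(deriv ^^ k) (inv_transform 0) = inv_transform k"
proof (induction k)
  case (Suc k)
  then show ?case using DERIV_imp_deriv[OF DERIV_inv_transform] by (simp add: fun_eq_iff del: funpow.simps) (simp add: Suc)
qed simp

text \<open>The integrand of Levy's inversion formula for the mass of \<open>{a<..b}\<close>.
  Division by zero makes it 0 at \<open>t = 0\<close> instead of the continuous value, on a null
  set.\<close>

definition increment :: "real \<Rightarrow> real \<Rightarrow> real \<Rightarrow> complex" where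
  "increment a b t = (iexp (- (t * a)) - iexp (- (t * b))) / (\<i> * of_real t) * \<phi> t"

lemma norm_increment_le: "cmod (increment a b t) \<le> \<bar>b - a\<bar> * cmod (\<phi> t)"
proof (cases "t = 0")
  case False
  have *: "cmod ((iexp (- (t * a)) - iexp (- (t * b))) / (\<i> * of_real t)) \<le> b - a" if "a \<le> b" for a b
    using Levy_Inversion_aux2[of "-b" "-a" t] that False by simp
  have "cmod ((iexp (- (t * a)) - iexp (- (t * b))) / (\<i> * of_real t)) \<le> \<bar>b - a\<bar>"
    using *[of a b] *[of b a] by (cases "a \<le> b") (auto simp: norm_divide norm_minus_commute)
  then show ?thesis unfolding increment_def norm_mult by (intro mult_right_mono) auto
qed (simp add: increment_def)

lemma integrable_increment: "integrable lborel (increment a b)"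
proof (rule Bochner_Integration.integrable_bound)
  show "integrable lborel (\<lambda>t. \<bar>b - a\<bar> * cmod (\<phi> t))"
    using integrable_moment[of 0] by (intro integrable_mult_right) simp
  show "increment a b \<in> borel_measurable lborel" unfolding increment_def[abs_def] by measurable
qed (use norm_increment_le in \<open>auto simp: abs_mult\<close>)

lemma DERIV_increment:
  "((\<lambda>b. Re (\<integral>t. increment a b t \<partial>lborel) / (2 * pi)) has_real_derivative inv_transform 0 x) (at x)"
  unfolding inv_transform_def[abs_def]
\<comment> \<open>Two powers of \<open>t\<close> come from the remainder, and the denominator takes
  one away.\<close>
proof (rule real_derivative_integral[where k = 1])
  fix y
  \<comment> \<open>At \<open>t = 0\<close> the estimate can fail: \<open>increment\<close> is 0
    there, but \<open>kernel 0 x 0\<close> is \<open>\<phi> 0\<close>.\<close>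
  have "AE t in lborel. t \<noteq> (0::real)" by (rule AE_lborel_singleton)
  then show "AE t in lborel. cmod (increment a y t - increment a x t - of_real (y - x) * kernel 0 x t)
     \<le> (y - x)\<^sup>2 / 2 * (\<bar>t\<bar> ^ 1 * cmod (\<phi> t))"
  proof eventually_elim
    case (elim t)
    let ?u = "- (t * (y - x))"
    have "iexp (- (t * y)) = iexp (- (t * x)) * iexp ?u"
      by (simp add: exp_add[symmetric] algebra_simps)
    then have "increment a y t - increment a x t - of_real (y - x) * kernel 0 x t =
      kernel 0 x t * - ((iexp ?u - 1 - \<i> * of_real ?u) / (\<i> * of_real t))"
      using elim by (simp add: kernel_def increment_def divide_simps) (simp add: algebra_simps)
    then have "cmod (increment a y t - increment a x t - of_real (y - x) * kernel 0 x t) =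
       cmod (\<phi> t) * (cmod (iexp ?u - 1 - \<i> * of_real ?u) / \<bar>t\<bar>)"
      by (simp only: norm_mult norm_kernel norm_minus_cancel norm_divide norm_ii norm_of_real power_0 mult_1_left)
    also have "\<dots> \<le> cmod (\<phi> t) * (?u\<^sup>2 / 2 / \<bar>t\<bar>)"
      by (intro mult_left_mono divide_right_mono iexp_quadratic) auto
    also have "?u\<^sup>2 / 2 / \<bar>t\<bar> = (y - x)\<^sup>2 / 2 * \<bar>t\<bar>"
    proof -
      have "?u\<^sup>2 = \<bar>t\<bar> * \<bar>t\<bar> * (y - x)\<^sup>2" by (simp add: power_mult_distrib power2_eq_square)
      moreover have "a * a * d / 2 / a = d / 2 * a" if "a \<noteq> 0" for a d :: real using that by simp
      ultimately show ?thesis using elim by (simp only: abs_eq_0 not_False_eq_True)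
    qed
    finally show ?case by (simp add: mult_ac)
  qed
qed (rule integrable_increment integrable_kernel)+

text \<open>Levy's formula is a limit of symmetric truncated integrals; integrability turns this
  limit into the full integral.\<close>

lemma tendsto_CLBINT_increment:
  "(\<lambda>T::nat. CLBINT t=-real T..real T. increment a b t) \<longlonglongrightarrow> (\<integral>t. increment a b t \<partial>lborel)"
proof -
  have "(\<lambda>T::nat. \<integral>t. indicator {-real T<..<real T} t *\<^sub>R increment a b t \<partial>lborel) \<longlonglongrightarrow> (\<integral>t. increment a b t \<partial>lborel)"
  proof (rule integral_dominated_convergence)
    show "integrable lborel (\<lambda>t. cmod (increment a b t))" using integrable_increment by (rule integrable_norm)
    show "AE t in lborel. (\<lambda>T. indicator {- real T<..<real T} t *\<^sub>R increment a b t) \<longlonglongrightarrow> increment a b t"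
    proof (intro AE_I2 tendsto_eventually)
      fix t :: real
      obtain N where "\<bar>t\<bar> < real N" using reals_Archimedean2 by blast
      then show "\<forall>\<^sub>F T in sequentially. indicator {- real T<..<real T} t *\<^sub>R increment a b t = increment a b t"
      proof (intro eventually_sequentiallyI[of N])
        fix T assume "N \<le> T"
        then have "real N \<le> real T" by simp
        then have "t \<in> {- real T<..<real T}" using \<open>\<bar>t\<bar> < real N\<close> unfolding greaterThanLessThan_iff by linarith
        then show "indicator {- real T<..<real T} t *\<^sub>R increment a b t = increment a b t" by simp
      qed
    qed
    show "AE t in lborel. norm (indicator {- real T<..<real T} t *\<^sub>R increment a b t) \<le> cmod (increment a b t)" for T
      by (auto simp: indicator_def)
    show "increment a b \<in> borel_measurable lborel" using integrable_increment by auto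
    then show "(\<lambda>t. indicator {- real T<..<real T} t *\<^sub>R increment a b t) \<in> borel_measurable lborel" for T
      by measurable
  qed
  moreover have "(CLBINT t=-real T..real T. increment a b t) = (\<integral>t. indicator {-real T<..<real T} t *\<^sub>R increment a b t \<partial>lborel)" for T :: nat
    by (subst interval_integral_Ioo) (auto simp: set_lebesgue_integral_def)
  ultimately show ?thesis by simp
qed

end

section \<open>Rapid decay of the density and its derivatives\<close>

lemma lipschitz_of_derivative:
  fixes g g' :: "real \<Rightarrow> real"
  assumes "\<And>x. (g has_real_derivative g' x) (at x)" "\<And>x. \<bar>g' x\<bar> \<le> B"
  shows "\<bar>g y - g x\<bar> \<le> B * \<bar>y - x\<bar>"
proof -
  have *: "\<bar>g y - g x\<bar> \<le> B * \<bar>y - x\<bar>" if xy: "x < y" for x y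
  proof -
    obtain z where "g y - g x = (y - x) * g' z" using MVT2[OF xy, of g g'] assms(1) by blast
    then show ?thesis using assms(2)[of z] xy by (simp add: abs_mult mult.commute mult_right_mono)
  qed
  show ?thesis using *[of x y] *[of y x] by (cases x y rule: linorder_cases) (auto simp: abs_minus_commute)
qed

text \<open>The mean value theorem gives a point where \<open>g'\<close> equals the difference
  quotient, and the bound on \<open>g''\<close> carries this over to \<open>x\<close>.\<close>

lemma derivative_difference_quotient_bound:
  fixes g g' g'' :: "real \<Rightarrow> real"
  assumes g: "\<And>x. (g has_real_derivative g' x) (at x)" and g': "\<And>x. (g' has_real_derivative g'' x) (at x)"
    and B: "\<And>x. \<bar>g'' x\<bar> \<le> B" and "x \<noteq> y"
  shows "\<bar>g' x\<bar> \<le> (\<bar>g x\<bar> + \<bar>g y\<bar>) / \<bar>y - x\<bar> + B * \<bar>y - x\<bar>"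
proof -
  have "\<exists>z. g y - g x = (y - x) * g' z \<and> \<bar>z - x\<bar> \<le> \<bar>y - x\<bar>"
  proof (cases "x < y")
    case True
    then obtain z where "x < z" "z < y" "g y - g x = (y - x) * g' z" using MVT2[OF True, of g g'] g by blast
    then show ?thesis by (intro exI[of _ z]) auto
  next
    case False
    then have "y < x" using assms by simp
    then obtain z where "y < z" "z < x" "g x - g y = (x - y) * g' z" using MVT2[of y x g g'] g by blast
    then show ?thesis by (intro exI[of _ z]) (auto simp: algebra_simps)
  qed
  then obtain z where z: "g y - g x = (y - x) * g' z" "\<bar>z - x\<bar> \<le> \<bar>y - x\<bar>" by blast
  have B0: "0 \<le> B" using B[of 0] by linarith
  have "\<bar>g' z - g' x\<bar> \<le> B * \<bar>y - x\<bar>"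
    using lipschitz_of_derivative[OF g' B, of z x] z(2) B0 by (meson mult_left_mono order_trans)
  moreover have "\<bar>g' z\<bar> = \<bar>g y - g x\<bar> / \<bar>y - x\<bar>" using z(1) assms(4) by (simp add: abs_mult)
  moreover have "\<bar>g y - g x\<bar> / \<bar>y - x\<bar> \<le> (\<bar>g x\<bar> + \<bar>g y\<bar>) / \<bar>y - x\<bar>" by (intro divide_right_mono) auto
  ultimately show ?thesis by linarith
qed

text \<open>Landau's interpolation argument: step width \<open>\<bar>x\<bar>\<^sup>-\<^sup>m\<close> away from the origin.\<close>

lemma rapid_decay_derivative:
  fixes g g' g'' :: "real \<Rightarrow> real"
  assumes g: "\<And>x. (g has_real_derivative g' x) (at x)" and g': "\<And>x. (g' has_real_derivative g'' x) (at x)"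
    and B1: "\<And>x. \<bar>g' x\<bar> \<le> B1" and B: "\<And>x. \<bar>g'' x\<bar> \<le> B"
    and decay: "\<And>m::nat. \<exists>C. \<forall>x. \<bar>x\<bar> ^ m * \<bar>g x\<bar> \<le> C"
  shows "\<exists>C. \<forall>x. \<bar>x\<bar> ^ m * \<bar>g' x\<bar> \<le> C"
proof -
  \<comment> \<open>The exponent is doubled: with \<open>r = \<bar>x\<bar> ^ m\<close>, one factor
    \<open>r\<close> comes from the claim and another from dividing by the step width
    \<open>1 / r\<close>.\<close>
  obtain C where C: "\<And>x. \<bar>x\<bar> ^ (m + m) * \<bar>g x\<bar> \<le> C" using decay by blast
  have C0: "0 \<le> C" using C[of 0] by (meson abs_ge_zero order_trans mult_nonneg_nonneg zero_le_power)
  have B0: "0 \<le> B" "0 \<le> B1" using B[of 0] B1[of 0] by linarith+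
  have "\<bar>x\<bar> ^ m * \<bar>g' x\<bar> \<le> 2 * C + B + B1" for x
  proof (cases "\<bar>x\<bar> < 1")
    case True
    have "\<bar>x\<bar> ^ m * \<bar>g' x\<bar> \<le> 1 * B1" using True B1[of x] by (intro mult_mono power_le_one) auto
    then show ?thesis using C0 B0 by simp
  next
    case False
    define r where "r = \<bar>x\<bar> ^ m"
    have r1: "1 \<le> r" using False by (auto simp: r_def intro: one_le_power)
    define c where "c = 1 / r"
    define y where "y = (if 0 \<le> x then x + c else x - c)"
    have yx: "\<bar>y - x\<bar> = c" "x \<noteq> y" "\<bar>x\<bar> \<le> \<bar>y\<bar>"
    proof -
      have "0 < c" using r1 by (simp add: c_def)
      then show "\<bar>y - x\<bar> = c" "x \<noteq> y" "\<bar>x\<bar> \<le> \<bar>y\<bar>" unfolding y_def by auto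
    qed
    have gx: "r * (r * \<bar>g x\<bar>) \<le> C" using C[of x] by (simp add: r_def power_add mult_ac)
    have "r * (r * \<bar>g y\<bar>) \<le> \<bar>y\<bar> ^ m * (\<bar>y\<bar> ^ m * \<bar>g y\<bar>)"
      unfolding r_def using yx(3) by (intro mult_mono power_mono mult_nonneg_nonneg) auto
    also have "\<dots> \<le> C" using C[of y] by (simp add: power_add mult_ac)
    finally have gy: "r * (r * \<bar>g y\<bar>) \<le> C" .
    have "\<bar>g' x\<bar> \<le> (\<bar>g x\<bar> + \<bar>g y\<bar>) * r + B / r"
      using derivative_difference_quotient_bound[OF g g' B yx(2)] unfolding yx(1) c_def by simp
    then have "r * \<bar>g' x\<bar> \<le> r * ((\<bar>g x\<bar> + \<bar>g y\<bar>) * r + B / r)" using r1 by (intro mult_left_mono) auto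
    also have "\<dots> = r * (r * \<bar>g x\<bar>) + r * (r * \<bar>g y\<bar>) + B" using r1 by (simp add: algebra_simps)
    finally show ?thesis using gx gy B0 unfolding r_def[symmetric] by linarith
  qed
  then show ?thesis by blast
qed

text \<open>By the Lipschitz bound \<open>f\<close> stays above \<open>f x / 2\<close> on an
  interval of length \<open>f x / (2 * L)\<close>. Placed on the side of \<open>x\<close> away from
  the origin, the interval contributes a multiple of
  \<open>(\<bar>x\<bar> ^ m * f x)\<^sup>2\<close> to the moment of order
  \<open>2 * m\<close>.\<close>

lemma density_rapid_decay:
  fixes f :: "real \<Rightarrow> real"
  assumes f0: "\<And>x. 0 \<le> f x" and lip: "\<And>x y. \<bar>f y - f x\<bar> \<le> B * \<bar>y - x\<bar>"
    and int: "\<And>m::nat. integrable lborel (\<lambda>x. \<bar>x\<bar> ^ m * f x)"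
  shows "\<exists>C. \<forall>x. \<bar>x\<bar> ^ m * \<bar>f x\<bar> \<le> C"
proof -
  define L where "L = \<bar>B\<bar> + 1"
  have L: "0 < L" "\<bar>f y - f x\<bar> \<le> L * \<bar>y - x\<bar>" for x y
  proof -
    show "0 < L" by (simp add: L_def add_nonneg_pos)
    have "B \<le> L" by (simp add: L_def)
    then show "\<bar>f y - f x\<bar> \<le> L * \<bar>y - x\<bar>"
      using lip[of y x] mult_right_mono[of B L "\<bar>y - x\<bar>"] by simp
  qed
  define E where "E = (\<integral>x. \<bar>x\<bar> ^ (m + m) * f x \<partial>lborel)"
  have main: "(\<bar>x\<bar> ^ m * f x)\<^sup>2 \<le> 4 * L * E" for x
  proof -
    define \<delta> where "\<delta> = f x / (2 * L)"
    have \<delta>: "0 \<le> \<delta>" using f0 L by (simp add: \<delta>_def)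
    define I where "I = (if 0 \<le> x then {x..x + \<delta>} else {x - \<delta>..x})"
    have I: "measure lborel I = \<delta>" "I \<in> sets lborel" "emeasure lborel I < \<infinity>" using \<delta> by (auto simp: I_def)
    have y: "\<bar>x\<bar> \<le> \<bar>y\<bar>" "f x / 2 \<le> f y" if "y \<in> I" for y
    proof -
      show "\<bar>x\<bar> \<le> \<bar>y\<bar>" using that \<delta> by (auto simp: I_def split: if_splits)
      have "\<bar>y - x\<bar> \<le> \<delta>" using that \<delta> by (auto simp: I_def split: if_splits)
      then have "L * \<bar>y - x\<bar> \<le> L * \<delta>" using L by (intro mult_left_mono) auto
      also have "\<dots> = f x / 2" using L by (simp add: \<delta>_def)
      finally show "f x / 2 \<le> f y" using L(2)[of y x] by linarith
    qed
    have "\<delta> * (\<bar>x\<bar> ^ (m + m) * (f x / 2)) = (\<integral>y. indicator I y * (\<bar>x\<bar> ^ (m + m) * (f x / 2)) \<partial>lborel)"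
      using I by simp
    also have "\<dots> \<le> E" unfolding E_def
    proof (rule integral_mono)
      show "integrable lborel (\<lambda>y. indicator I y * (\<bar>x\<bar> ^ (m + m) * (f x / 2)))"
        using I by (intro integrable_mult_left integrable_real_indicator) auto
      fix z
      show "indicator I z * (\<bar>x\<bar> ^ (m + m) * (f x / 2)) \<le> \<bar>z\<bar> ^ (m + m) * f z"
      proof (cases "z \<in> I")
        case True
        have "\<bar>x\<bar> ^ (m + m) * (f x / 2) \<le> \<bar>z\<bar> ^ (m + m) * f z"
          using y[OF True] f0[of x] by (intro mult_mono power_mono) auto
        then show ?thesis using True by simp
      qed (use f0 in simp)
    qed (rule int)
    finally have "\<delta> * (\<bar>x\<bar> ^ (m + m) * (f x / 2)) \<le> E" .
    then have "4 * L * (\<delta> * (\<bar>x\<bar> ^ (m + m) * (f x / 2))) \<le> 4 * L * E" using L by (intro mult_left_mono) auto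
    moreover have "4 * L * (\<delta> * (\<bar>x\<bar> ^ (m + m) * (f x / 2))) = (\<bar>x\<bar> ^ m * f x)\<^sup>2"
      using L by (simp add: \<delta>_def power_add power2_eq_square power_mult_distrib)
    ultimately show ?thesis by (simp only:)
  qed
  have "\<bar>x\<bar> ^ m * \<bar>f x\<bar> \<le> sqrt (4 * L * E)" for x
    using main[of x] f0[of x] by (intro real_le_rsqrt) simp
  then show ?thesis by blast
qed

lemma (in real_distribution) ex_nonatom_between:
  assumes "a < b" obtains x where "a < x" "x < b" "measure M {x} = 0"
proof -
  have "uncountable {a<..<b}" using assms by (rule uncountable_open_interval[THEN iffD2])
  then have "\<not> {a<..<b} \<subseteq> {x. 0 < measure M {x}}" using countable_atoms countable_subset by blast
  then obtain x where x: "x \<in> {a<..<b}" "\<not> 0 < measure M {x}" by blast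
  then have "measure M {x} = 0" using measure_nonneg[of M "{x}"] by linarith
  then show ?thesis using that[of x] x by auto
qed

text \<open>Inversion gives the increments of the distribution function between points without mass,
  and right continuity extends this to all right end points. So the distribution function is
  differentiable; monotonicity makes the derivative nonnegative, and the fundamental theorem of
  calculus identifies the measure.\<close>

lemma (in real_distribution) density_inv_transform:
  assumes "decaying_transform (char M)"
  shows "\<And>x. 0 \<le> decaying_transform.inv_transform (char M) 0 x"
    and "M = density lborel (\<lambda>x. ennreal (decaying_transform.inv_transform (char M) 0 x))"
proof -
  interpret D: decaying_transform "char M" by fact
  define H where "H = (\<lambda>a b. Re (\<integral>t. D.increment a b t \<partial>lborel) / (2 * pi))"
  have cdf_H: "cdf M b - cdf M a = H a b" if ab: "a \<le> b" and at: "measure M {a} = 0" "measure M {b} = 0" for a b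
  proof (cases "a = b")
    case True then show ?thesis by (simp add: H_def D.increment_def)
  next
    case False
    have "(\<lambda>T. 1 / (2 * pi) * (CLBINT t=-real T..real T. D.increment a b t)) \<longlonglongrightarrow> of_real (measure M {a<..b})"
      unfolding D.increment_def using Levy_Inversion[OF ab at] by simp
    moreover have "(\<lambda>T. 1 / (2 * pi) * (CLBINT t=-real T..real T. D.increment a b t)) \<longlonglongrightarrow> 1 / (2 * pi) * (\<integral>t. D.increment a b t \<partial>lborel)"
      by (intro tendsto_intros D.tendsto_CLBINT_increment)
    ultimately have "of_real (measure M {a<..b}) = 1 / (2 * pi) * (\<integral>t. D.increment a b t \<partial>lborel)"
      by (rule LIMSEQ_unique)
    then have "Re (of_real (measure M {a<..b})) = Re (1 / (2 * pi) * (\<integral>t. D.increment a b t \<partial>lborel))" by simp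
    also have "\<dots> = H a b" by (simp add: H_def)
    finally show ?thesis using cdf_diff_eq[of a b] ab False by simp
  qed
  have cdf_deriv: "(cdf M has_real_derivative D.inv_transform 0 x) (at x)" for x
  proof -
    obtain a where a: "x - 1 < a" "a < x" "measure M {a} = 0" using ex_nonatom_between[of "x - 1" x] by auto
    \<comment> \<open>If the formula failed at \<open>b\<close>, it would fail throughout an
      interval to the right of \<open>b\<close>, which contains a point without mass.\<close>
    have eq: "cdf M b = cdf M a + H a b" if "a \<le> b" for b
    proof (rule ccontr)
      define u where "u = (\<lambda>y. cdf M y - cdf M a - H a y)"
      assume "cdf M b \<noteq> cdf M a + H a b"
      then have ub: "u b \<noteq> 0" by (simp add: u_def)
      have "isCont (H a) b" unfolding H_def using D.DERIV_increment DERIV_isCont by blast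
      then have "((\<lambda>y. cdf M y - cdf M a - H a y) \<longlongrightarrow> cdf M b - cdf M a - H a b) (at_right b)"
        using cdf_is_right_cont[of b] by (intro tendsto_intros) (auto simp: continuous_within isCont_def intro: tendsto_within_subset)
      then have "(u \<longlongrightarrow> u b) (at_right b)" by (simp add: u_def)
      then have "\<forall>\<^sub>F y in at_right b. u y \<noteq> 0" using ub by (rule tendsto_imp_eventually_ne)
      then obtain c where c: "b < c" "\<And>y. b < y \<Longrightarrow> y < c \<Longrightarrow> u y \<noteq> 0"
        using eventually_at_right[of b "b + 1"] by auto
      obtain y where "b < y" "y < c" "measure M {y} = 0" using ex_nonatom_between[OF c(1)] by auto
      then show False using cdf_H[of a y] a(3) that c(2)[of y] by (simp add: u_def)
    qed
    have "((\<lambda>b. cdf M a + H a b) has_real_derivative D.inv_transform 0 x) (at x)"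
      unfolding H_def using DERIV_add[OF DERIV_const D.DERIV_increment] by simp
    then show ?thesis
    proof (rule has_field_derivative_transform_within_open)
      show "open {a<..}" "x \<in> {a<..}" using a by auto
      show "cdf M a + H a y = cdf M y" if "y \<in> {a<..}" for y using that by (intro eq[symmetric]) simp
    qed
  qed
  show nonneg: "0 \<le> D.inv_transform 0 x" for x
    by (rule mono_on_imp_deriv_nonneg[OF _ cdf_deriv, of UNIV]) (auto simp: mono_on_def cdf_nondecreasing)
  have cont: "continuous_on UNIV (D.inv_transform 0)"
    by (intro continuous_at_imp_continuous_on ballI DERIV_isCont[OF D.DERIV_inv_transform])
  then have meas [measurable]: "D.inv_transform 0 \<in> borel_measurable borel" by (rule borel_measurable_continuous_onI)
  show "M = density lborel (\<lambda>x. ennreal (D.inv_transform 0 x))"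
  proof (rule measure_eqI_lessThan)
    show "sets M = sets borel" by simp
    show "emeasure M {x<..} < \<infinity>" for x by (simp add: emeasure_eq_measure)
    fix x
    have "emeasure (density lborel (\<lambda>x. ennreal (D.inv_transform 0 x))) {x<..} = (\<integral>\<^sup>+y. ennreal (D.inv_transform 0 y) * indicator {x<..} y \<partial>lborel)"
      by (rule emeasure_density) auto
    also have "\<dots> = (\<integral>\<^sup>+y. ennreal (D.inv_transform 0 y) * indicator {x..} y \<partial>lborel)"
    proof (rule nn_integral_cong_AE)
      have "AE y in lborel. y \<noteq> x" by (rule AE_lborel_singleton)
      then show "AE y in lborel. ennreal (D.inv_transform 0 y) * indicator {x<..} y = ennreal (D.inv_transform 0 y) * indicator {x..} y"
        by eventually_elim (auto simp: indicator_def)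
    qed
    also have "\<dots> = ennreal (1 - cdf M x)"
      by (rule nn_integral_FTC_atLeast[OF meas cdf_deriv nonneg cdf_lim_at_top_prob])
    also have "1 - cdf M x = measure M {x<..}"
    proof -
      have "{x<..} = space M - {..x}" by auto
      then show ?thesis using prob_compl[of "{..x}"] by (simp add: cdf_def2)
    qed
    finally show "emeasure M {x<..} = emeasure (density lborel (\<lambda>x. ennreal (D.inv_transform 0 x))) {x<..}"
      by (simp add: emeasure_eq_measure)
  qed simp
qed

text \<open>Order 0 rests on the sign of the density, which turns moments into pointwise bounds.
  Each further derivative inherits rapid decay from the preceding one by interpolation, all
  derivatives being bounded.\<close>

theorem (in real_distribution) schwartz_density:
  assumes D: "decaying_transform (char M)" and mom: "\<And>m::nat. integrable M (\<lambda>x. \<bar>x\<bar> ^ m)"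
  shows "\<exists>f. (\<forall>x. 0 \<le> f x) \<and> f \<in> borel_measurable borel \<and> M = density lborel (\<lambda>x. ennreal (f x)) \<and> schwartz_function f"
proof -
  interpret D: decaying_transform "char M" by fact
  let ?f = "D.inv_transform"
  have nonneg: "0 \<le> ?f 0 x" and dens: "M = density lborel (\<lambda>x. ennreal (?f 0 x))" for x
    using density_inv_transform[OF D] by auto
  have cont: "continuous_on UNIV (?f 0)"
    by (intro continuous_at_imp_continuous_on ballI DERIV_isCont[OF D.DERIV_inv_transform])
  then have meas [measurable]: "?f 0 \<in> borel_measurable borel" by (rule borel_measurable_continuous_onI)
  have int: "integrable lborel (\<lambda>x. \<bar>x\<bar> ^ m * ?f 0 x)" for m :: nat
  proof -
    have "integrable (density lborel (\<lambda>x. ennreal (?f 0 x))) (\<lambda>x. \<bar>x\<bar> ^ m)" using mom dens by simp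
    then show ?thesis using nonneg by (subst (asm) integrable_density) (auto simp: mult.commute)
  qed
  have decay: "\<exists>C. \<forall>x. \<bar>x\<bar> ^ m * \<bar>?f k x\<bar> \<le> C" for k m
  proof (induction k arbitrary: m)
    case 0
    show ?case
      by (rule density_rapid_decay[OF nonneg lipschitz_of_derivative[OF D.DERIV_inv_transform D.abs_inv_transform_le] int])
  next
    case (Suc k)
    show ?case
      by (rule rapid_decay_derivative[OF D.DERIV_inv_transform D.DERIV_inv_transform D.abs_inv_transform_le D.abs_inv_transform_le Suc.IH])
  qed
  have "schwartz_function (?f 0)"
    unfolding schwartz_function_def D.deriv_inv_transform
  proof (intro conjI allI)
    show "?f k differentiable (at x)" for k x
      using D.DERIV_inv_transform real_differentiable_def by blast
    fix k m :: nat
    obtain C where "\<And>x. \<bar>x\<bar> ^ m * \<bar>?f k x\<bar> \<le> C" using decay by blast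
    then show "bounded (range (\<lambda>x. \<bar>x\<bar> ^ m * \<bar>?f k x\<bar>))"
      by (intro boundedI[of _ C]) auto
  qed
  then show ?thesis using nonneg dens meas by blast
qed

section \<open>The limit law\<close>

theorem theorem2p8:
  fixes M :: "'a measure" and \<theta> :: real
    and P :: "nat \<Rightarrow> 'a \<Rightarrow> nat" and X :: "'a \<Rightarrow> real"
  assumes "prob_space M"
    and "\<theta> > 0"
    and "prob_space.indep_vars M (\<lambda>_. count_space UNIV) P {1..}"
    and "\<And>k. k \<ge> 1 \<Longrightarrow> measure M {\<omega> \<in> space M. P k \<omega> = 0} = \<theta> / (\<theta> + real k - 1)"
    and "\<And>k j. 1 \<le> j \<Longrightarrow> j < k \<Longrightarrow>
           measure M {\<omega> \<in> space M. P k \<omega> = j} = 1 / (\<theta> + real k - 1)"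
    and "X \<in> borel_measurable M"
    and "AE \<omega> in M. (\<lambda>n. (real (internal_path_length (\<lambda>k. P k \<omega>) n) - real n * ln (real n)) / real n)
                      \<longlonglongrightarrow> X \<omega>"
  shows "\<exists>f :: real \<Rightarrow> real. (\<forall>x. f x \<ge> 0) \<and> distributed M lborel X (\<lambda>x. ennreal (f x))
           \<and> schwartz_function f"
proof -
  interpret prob_space M by fact
  note \<theta> = assms(2) and X [measurable] = assms(6)
  define Z where "Z = (\<lambda>n p. (real (internal_path_length p n) - real n * ln (real n)) / real n)"
  let ?Z = "\<lambda>n \<omega>. Z n (\<lambda>k. P k \<omega>)"
  have lim: "AE \<omega> in M. (\<lambda>n. ?Z n \<omega>) \<longlonglongrightarrow> X \<omega>" using assms(7) by (simp add: Z_def)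
  have Z_upto: "Z n (parents_upto n p) = Z n p" for n p
    by (simp add: Z_def internal_path_length_parents_upto)
  have "P k \<in> measurable M (count_space UNIV)" if "1 \<le> k" for k
    using assms(3) that by (auto simp: indep_vars_def)
  then have Zm [measurable]: "?Z n \<in> borel_measurable M" for n
    using borel_measurable_parents_upto[of n "\<lambda>\<omega> k. P k \<omega>" M "Z n"] by (simp add: Z_upto)
  interpret D: real_distribution "distr M borel X" by (rule real_distribution_distr) simp

  have char_X: "char (distr M borel X) t = (\<integral>\<omega>. iexp (t * X \<omega>) \<partial>M)" for t
    unfolding char_def by (subst integral_distr) auto
  have char_lim: "(\<lambda>n. \<integral>\<omega>. iexp (t * ?Z n \<omega>) \<partial>M) \<longlonglongrightarrow> char (distr M borel X) t" for t
    unfolding char_X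
  proof (rule integral_dominated_convergence[where w = "\<lambda>_. 1"])
    show "AE \<omega> in M. (\<lambda>n. iexp (t * ?Z n \<omega>)) \<longlonglongrightarrow> iexp (t * X \<omega>)"
      using lim by eventually_elim (intro tendsto_intros)
  qed auto
  \<comment> \<open>The centring by \<open>ln n\<close> contributes only a phase, so it does not
    affect the modulus.\<close>
  have char_Z: "cmod (\<integral>\<omega>. iexp (t * ?Z n \<omega>) \<partial>M) = cmod (hoppe_exp \<theta> n (\<lambda>p. iexp (t / real n * real (internal_path_length p n))))"
    if n: "1 \<le> n" for t n
  proof -
    have "(\<integral>\<omega>. iexp (t * ?Z n \<omega>) \<partial>M) = (\<integral>\<omega>. iexp (t * Z n (parents_upto n (\<lambda>k. P k \<omega>))) \<partial>M)"
      by (simp only: Z_upto)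
    also have "\<dots> = hoppe_exp \<theta> n (\<lambda>p. iexp (t * Z n p))"
      using expectation_parents_upto[OF assms(2-5), of "\<lambda>p. iexp (t * Z n p)" n] by simp
    also have "\<dots> = hoppe_exp \<theta> n (\<lambda>p. iexp (- (t * ln (real n))) * iexp (t / real n * real (internal_path_length p n)))"
    proof (rule hoppe_exp_cong)
      fix p
      have "t * Z n p = - (t * ln (real n)) + t / real n * real (internal_path_length p n)"
        using n by (simp add: Z_def field_simps)
      then show "iexp (t * Z n p) = iexp (- (t * ln (real n))) * iexp (t / real n * real (internal_path_length p n))"
        by (simp only: of_real_add distrib_left exp_add)
    qed
    also have "\<dots> = iexp (- (t * ln (real n))) * hoppe_exp \<theta> n (\<lambda>p. iexp (t / real n * real (internal_path_length p n)))"
      by (rule hoppe_exp_linear) (auto intro: linearI simp: algebra_simps scaleR_conv_of_real)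
    finally show ?thesis by (simp only: norm_mult norm_exp_i_times mult_1_left)
  qed
  \<comment> \<open>The estimate is uniform in \<open>n \<ge> 84 * a\<close>, so it passes to the
    limit with \<open>a\<close> fixed.\<close>
  have char_le: "cmod (char (distr M borel X) t) \<le> 4 * decay_base ^ a"
    if a: "\<theta> + 2 \<le> real a" and t: "real a \<le> t" "t \<le> 2 * real a" for a t
  proof (rule LIMSEQ_le_const2[OF tendsto_norm[OF char_lim]])
    have "1 \<le> a" using a \<theta> by linarith
    show "\<exists>N. \<forall>n\<ge>N. cmod (\<integral>\<omega>. iexp (t * ?Z n \<omega>) \<partial>M) \<le> 4 * decay_base ^ a"
    proof (intro exI allI impI)
      fix n assume n: "84 * a \<le> n"
      then have "1 \<le> n" using \<open>1 \<le> a\<close> by simp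
      show "cmod (\<integral>\<omega>. iexp (t * ?Z n \<omega>) \<partial>M) \<le> 4 * decay_base ^ a"
        unfolding char_Z[OF \<open>1 \<le> n\<close>] by (rule hoppe_exp_char_le[OF \<theta> a n t])
    qed
  qed
  have char_minus: "cmod (char (distr M borel X) (- t)) = cmod (char (distr M borel X) t)" for t
  proof -
    have "(\<lambda>\<omega>. iexp (- t * X \<omega>)) = (\<lambda>\<omega>. cnj (iexp (t * X \<omega>)))" by (simp add: exp_cnj)
    then have "char (distr M borel X) (- t) = cnj (char (distr M borel X) t)"
      unfolding char_X by (simp only: Bochner_Integration.integral_cnj)
    then show ?thesis by simp
  qed
  have decaying: "decaying_transform (char (distr M borel X))"
  proof
    show "char (distr M borel X) \<in> borel_measurable borel" by (rule D.char_measurable)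
    fix k :: nat
    \<comment> \<open>For \<open>t \<ge> T\<close> the choice
      \<open>a = \<lceil>t / 2\<rceil>\<close> satisfies \<open>\<theta> + 2 \<le> a\<close>,
      \<open>a \<le> t\<close> and \<open>t \<le> 2 * a\<close>.\<close>
    define T where "T = 2 * \<theta> + 6"
    define C where "C = (real k / ln (1 / decay_base)) ^ k"
    have C: "real a ^ k * decay_base ^ a \<le> C" for a
    proof -
      have "1 < 1 / decay_base" using decay_base by simp
      from power_le_exponential[OF this, of a k] show ?thesis
        using decay_base by (simp add: C_def power_divide field_simps)
    qed
    have C0: "0 \<le> C" using C[of 0] decay_base by (simp add: C_def)
    have pos: "\<bar>t\<bar> ^ k * cmod (char (distr M borel X) t) \<le> T ^ k + 4 * 2 ^ k * C" if t0: "0 \<le> t" for t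
    proof (cases "t < T")
      case True
      then have "\<bar>t\<bar> ^ k * cmod (char (distr M borel X) t) \<le> T ^ k * 1"
        using t0 D.cmod_char_le_1[of t] by (intro mult_mono power_mono) auto
      then show ?thesis using C0 by (simp add: add_increasing2)
    next
      case False
      define a where "a = nat \<lceil>t / 2\<rceil>"
      have a1: "real a \<ge> t / 2" "real a \<le> t / 2 + 1" using t0 unfolding a_def by linarith+
      have a: "\<theta> + 2 \<le> real a" "real a \<le> t" "t \<le> 2 * real a" using a1 False \<theta> unfolding T_def by linarith+
      have "\<bar>t\<bar> ^ k * cmod (char (distr M borel X) t) \<le> (2 * real a) ^ k * (4 * decay_base ^ a)"
        using t0 a by (intro mult_mono power_mono char_le) auto
      also have "\<dots> = 4 * 2 ^ k * (real a ^ k * decay_base ^ a)" by (simp add: power_mult_distrib)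
      also have "\<dots> \<le> 4 * 2 ^ k * C" using C[of a] by (intro mult_left_mono) auto
      also have "\<dots> \<le> T ^ k + 4 * 2 ^ k * C" using \<theta> by (simp add: T_def)
      finally show ?thesis .
    qed
    have "\<bar>t\<bar> ^ k * cmod (char (distr M borel X) t) \<le> T ^ k + 4 * 2 ^ k * C" for t
      using pos[of t] pos[of "- t"] char_minus[of t] by (cases "0 \<le> t") auto
    then show "\<exists>C. \<forall>t. \<bar>t\<bar> ^ k * cmod (char (distr M borel X) t) \<le> C" by blast
  qed

  have even_moment: "integrable M (\<lambda>\<omega>. X \<omega> ^ q)" if q: "even q" "4 \<le> q" for q :: nat
  proof -
    obtain K where K: "\<And>n. 1 \<le> n \<Longrightarrow> hoppe_exp \<theta> n (\<lambda>p. Z n p ^ q) \<le> K"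
      using hoppe_exp_scaled_length_bounded[OF \<theta> q] unfolding Z_def by blast
    have nn: "(\<integral>\<^sup>+\<omega>. ennreal (?Z n \<omega> ^ q) \<partial>M) \<le> ennreal K" if n: "1 \<le> n" for n
    proof -
      have "integrable M (\<lambda>\<omega>. Z n (parents_upto n (\<lambda>k. P k \<omega>)) ^ q)"
        and val: "(\<integral>\<omega>. Z n (parents_upto n (\<lambda>k. P k \<omega>)) ^ q \<partial>M) = hoppe_exp \<theta> n (\<lambda>p. Z n p ^ q)"
        using expectation_parents_upto[OF assms(2-5), of "\<lambda>p. Z n p ^ q" n] by auto
      then have "(\<integral>\<^sup>+\<omega>. ennreal (?Z n \<omega> ^ q) \<partial>M) = ennreal (\<integral>\<omega>. ?Z n \<omega> ^ q \<partial>M)"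
        using q by (intro nn_integral_eq_integral) (auto simp: Z_upto zero_le_even_power)
      then show ?thesis using val K[OF n] by (simp add: Z_upto ennreal_leI)
    qed
    \<comment> \<open>Fatou's lemma carries the uniform moment bound over to the limit.\<close>
    have "(\<integral>\<^sup>+\<omega>. ennreal (X \<omega> ^ q) \<partial>M) = (\<integral>\<^sup>+\<omega>. liminf (\<lambda>n. ennreal (?Z n \<omega> ^ q)) \<partial>M)"
    proof (rule nn_integral_cong_AE)
      show "AE \<omega> in M. ennreal (X \<omega> ^ q) = liminf (\<lambda>n. ennreal (?Z n \<omega> ^ q))"
        using lim
      proof eventually_elim
        case (elim \<omega>)
        then have "(\<lambda>n. ennreal (?Z n \<omega> ^ q)) \<longlonglongrightarrow> ennreal (X \<omega> ^ q)" by (intro tendsto_intros tendsto_ennrealI)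
        then show ?case by (rule lim_imp_Liminf[OF sequentially_bot, symmetric])
      qed
    qed
    also have "\<dots> \<le> liminf (\<lambda>n. \<integral>\<^sup>+\<omega>. ennreal (?Z n \<omega> ^ q) \<partial>M)"
      by (rule nn_integral_liminf) measurable
    also have "\<dots> \<le> liminf (\<lambda>n::nat. ennreal K)"
      using nn by (intro Liminf_mono eventually_sequentiallyI[of 1]) auto
    also have "\<dots> = ennreal K" by (simp add: Liminf_const)
    finally have "(\<integral>\<^sup>+\<omega>. ennreal (X \<omega> ^ q) \<partial>M) < \<infinity>" by (simp add: le_less_trans[OF _ ennreal_less_top])
    then show ?thesis using q by (intro integrableI_nonneg) (auto simp: zero_le_even_power)
  qed
  have moments: "integrable (distr M borel X) (\<lambda>x. \<bar>x\<bar> ^ m)" for m :: nat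
  proof -
    have "integrable M (\<lambda>\<omega>. \<bar>X \<omega>\<bar> ^ m)"
    proof (rule Bochner_Integration.integrable_bound)
      \<comment> \<open>The exponent is even, at least 4 and larger than \<open>m\<close>.\<close>
      show "integrable M (\<lambda>\<omega>. 1 + X \<omega> ^ (2 * (m + 2)))"
        by (intro Bochner_Integration.integrable_add even_moment) auto
      show "AE \<omega> in M. norm (\<bar>X \<omega>\<bar> ^ m) \<le> norm (1 + X \<omega> ^ (2 * (m + 2)))"
      proof (intro AE_I2)
        fix \<omega>
        have "X \<omega> ^ (2 * (m + 2)) = \<bar>X \<omega>\<bar> ^ (2 * (m + 2))" by (rule power_even_abs[symmetric]) simp
        moreover have "\<bar>X \<omega>\<bar> ^ m \<le> 1 + \<bar>X \<omega>\<bar> ^ (2 * (m + 2))"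
        proof (cases "\<bar>X \<omega>\<bar> \<le> 1")
          case True
          then show ?thesis using power_le_one[of "\<bar>X \<omega>\<bar>" m] by (simp add: add_increasing2)
        next
          case False
          then have "\<bar>X \<omega>\<bar> ^ m \<le> \<bar>X \<omega>\<bar> ^ (2 * (m + 2))" by (intro power_increasing) auto
          then show ?thesis by simp
        qed
        ultimately show "norm (\<bar>X \<omega>\<bar> ^ m) \<le> norm (1 + X \<omega> ^ (2 * (m + 2)))" by simp
      qed
    qed simp
    then show ?thesis by (subst integrable_distr_eq) auto
  qed

  obtain f where f: "\<And>x. 0 \<le> f x" "f \<in> borel_measurable borel"
      "distr M borel X = density lborel (\<lambda>x. ennreal (f x))" "schwartz_function f"
    using D.schwartz_density[OF decaying moments] by blast
  have "distr M lborel X = distr M borel X" by (rule distr_cong) auto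
  then have "distributed M lborel X (\<lambda>x. ennreal (f x))"
    unfolding distributed_def using f by auto
  then show ?thesis using f by blast
qed

end
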